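(* The Banach space $\mathcal{X}_{cr}$ (constructed in the context), with its canonical basis $(e_n)$, is tight with constants: for any infinite dimensional closed subspace $Y$ of $\mathcal{X}_{cr}$ there is a sequence of successive intervals $I_1<I_2<\dots$ of $\mathbb{N}$ such that for any $K\in\mathbb{N}$ the subspace $Y$ does not embed with constant $K$ into the closed span $[e_i:\ i\notin I_K]$.
   Context: "Embeds with constant $K$" means that there is an isomorphism $T$ onto its image with $\|T\|\,\|T^{-1}\|\le K$. Notation. For finitely supported $x$, $\operatorname{minsupp}x=\min\operatorname{supp}x$ and $\operatorname{maxsupp}x=\max\operatorname{supp}x$. $E<F$ means $\max E<\min F$. A block sequence is a sequence of finitely supported vectors with successive supports. The Schreier families are $\mathcal{S}_0=\{\{k\}:k\in\mathbb{N}\}\cup\{\emptyset\}$ and $\mathcal{S}_{n+1}=\{F_1\cup\dots\cup F_k:\ k\le F_1<\dots<F_k,\ F_1,\dots,F_k\in\mathcal{S}_n\}$. For a family $\mathcal{M}$ of finite subsets of $\mathbb{N}$, a finite sequence of sets $(E_i)$ is $\mathcal{M}$-admissible if $E_1<E_2<\dots$ and $\{\min E_i\}_i\in\mathcal{M}$, and $\mathcal{M}$-allowable if the $E_i$ are pairwise disjoint and $\{\min E_i\}_i\in\mathcal{M}$. A sequence of vectors is $\mathcal{M}$-admissible (allowable) if the sequence of its supports is. The $(\mathcal{M},\theta)$-operation sends $(x_1,\dots,x_k)$ with $\{\operatorname{minsupp}x_i\}_i\in\mathcal{M}$ to $\theta(x_1+\dots+x_k)$. Sequences. $m_1=2$,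 $m_{j+1}=m_j^5$; $n_1=4$, $n_{j+1}=15s_jn_j$, where $s_j=\log_2(m_{j+1}^3)$. Special convex combinations. In a space with basis $(e_i)$, for $\varepsilon>0$ and $n\in\mathbb{N}$, $\sum_{i\in F}a_ie_i$ is an $(n,\varepsilon)$-basic scc if $F\in\mathcal{S}_n$, $a_i\in[0,1]$, $\sum_{i\in F}a_i=1$ and $\sum_{i\in G}a_i<\varepsilon$ for every $G\in\mathcal{S}_{n-1}$. A vector $\sum_{i\in F}a_ix_i$, with $(x_i)$ a block sequence, is an $(n,\varepsilon)$-scc of $(x_i)$ if $\sum_{i\in F}a_ie_{\operatorname{minsupp}x_i}$ is an $(n,\varepsilon)$-basic scc. The function $l$. For all $n\in\mathbb{N}$, $\varepsilon>0$ there is $l(n,\varepsilon)\ge n$, depending only on $n,\varepsilon$ and the sequences $(n_j),(m_j)$, with the following property (a known fact): for every Banach space $X$ with a basis satisfying $\frac{1}{m_{2j}}\sum_i\|E_ix\|\le\|x\|$ for all $x\in X$, $j\in\mathbb{N}$ and $\mathcal{S}_{n_{2j}}$-admissible $(E_i)$ (where $Ex$ is the coordinate projection of $x$ on $E$), and for any block sequence $(x_i)$ in $X$, there are $F\in\mathcal{S}_{l(n,\varepsilon)}$ and an $(n,\varepsilon)$-scc $x$ of a normalized block sequence of $(x_i)_{i\in F}$ with $\|x\|\ge1/2$. Fix such a function $l$. For $n\in\mathbb{N}$ put $\rho(n)=l(n_{2s},m_{2s}^{-2})$, where $s\in\mathbb{N}$ is minimal with $n^2\le m_{2s}$. Coding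 function. Fix a partition of $\mathbb{N}$ into two infinite sets $L_1,L_2$. Let $\mathcal{G}$ be the set of all finite sequences $(E_1,\dots,E_n)$, $n\in\mathbb{N}$, of intervals of $\mathbb{N}$ with $E_1<\dots<E_n$. Fix an injective $\sigma:\mathcal{G}\to2L_2=\{2l:l\in L_2\}$ with $n_{\sigma(E_1,\dots,E_n)}\ge\rho(\max E_n)+\max E_n$ for every $(E_1,\dots,E_n)\in\mathcal{G}$, $n\ge2$. Norming set. $W$ is the smallest subset of $c_{00}(\mathbb{N})$ such that: ($\alpha$) $\pm e_n\in W$ for all $n$, where $(e_n)$ is the canonical basis of $c_{00}(\mathbb{N})$; ($\beta$) if $f\in W$, $g\in c_{00}(\mathbb{N})$ and $|f|=|g|$ (coordinatewise), then $g\in W$; ($\gamma$) for each $j\in\mathbb{N}$, $W$ is closed under the $(\mathcal{S}_{n_{2j}},m_{2j}^{-1})$-operation on $\mathcal{S}_{n_{2j}}$-allowable sequences; ($\delta$) for each $j\in\mathbb{N}$, $W$ is closed under the $(\mathcal{S}_{n_{2j+1}},m_{2j+1}^{-1})$-operation on $(2j+1)$-dependent sequences. Dependent sequences. A block sequence $(f_i)_{i\in F}$ of elements of $W$, with $F=\{1,\dots,d\}$, is $(2j+1)$-dependent if it is $\mathcal{S}_{n_{2j+1}}$-admissible, each $f_i$ has the form $f_i=m_{2j_i}^{-1}\sum_{k\in K_i}f_{i,k}$ (the weight of $f_i$ is $m_{2j_i}^{-1}$, and $(f_{i,k})_{k\in K_i}$ is an $\mathcal{S}_{n_{2j_i}}$-admissible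 sequence in $W$), and there is a sequence $(E_r)_{r\in A}\in\mathcal{G}$ whose index set $A\subset\mathbb{N}$ is the union of successive intervals $A_k$, $k\in K_i$, $i\in F$ (where $K_1<K_2<\dots<K_d$ are successive intervals of indices), such that (1) $j_1\in L_1$ and $m_{2j_1}>n_{2j+1}$; (2) $2j_{i+1}=\sigma(E_r:\ r\in A_k,\ k\in K_l,\ l\le i)$ for any $i<\max F$; (3) $\operatorname{supp}f_{i,k}\subset\bigcup_{r\in A_k}E_r$ for all $k\in K_i$, $i\in F$; (4) $A_{\min K_i}$ is a singleton for each $i\in F$, and $(E_r)_{r\in A_k}$ is $\mathcal{S}_{\rho(\max E_{\max A_{k-1}})}$-admissible for any $k\in K_i$, $k>\min K_i$, $i\in F$. Some of the $f_{i,k}$ (hence of the $f_i$) are allowed to be $0$ (zero terms are ignored in admissibility conditions), so that the restriction of $m_{2j+1}^{-1}\sum_{i\in F}f_i$ to any subset of $\mathbb{N}$ is of the same form. The space. $\mathcal{X}_{cr}$ is the completion of $c_{00}(\mathbb{N})$ under $\|x\|=\sup\{|f(x)|:f\in W\}$, where $f(x)=\sum_if_ix_i$. Its canonical basis is $(e_n)$. *)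

theory Defs
  imports "HOL-Analysis.Analysis" "HOL-Probability.Discrete_Topology"
begin

text \<open>
  The natural numbers of the construction start at 1. They are represented by the positive elements
  of \<^typ>\<open>nat\<close>: vectors vanish at 0, sets of indices are contained in \<^term>\<open>{1::nat..}\<close>, and the
  sequences below take junk values at 0.
\<close>

section \<open>Finitely supported vectors and families of sets\<close>

definition supp :: "(nat \<Rightarrow> real) \<Rightarrow> nat set" where
  "supp x = {i. x i \<noteq> 0}"

definition c00 :: "(nat \<Rightarrow> real) set" where
  "c00 = {x. finite (supp x) \<and> x 0 = 0}"

definition minsupp :: "(nat \<Rightarrow> real) \<Rightarrow> nat" where
  "minsupp x = Min (supp x)"

definition unit_vec :: "nat \<Rightarrow> nat \<Rightarrow> real" where
  "unit_vec n = indicator {n}"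

definition pairing :: "(nat \<Rightarrow> real) \<Rightarrow> (nat \<Rightarrow> real) \<Rightarrow> real" where
  "pairing f x = (\<Sum>i\<in>supp x. f i * x i)"

definition lin_comb :: "(nat \<Rightarrow> 'a::real_vector) \<Rightarrow> (nat \<Rightarrow> real) \<Rightarrow> 'a" where
  "lin_comb b x = (\<Sum>i\<in>supp x. x i *\<^sub>R b i)"

text \<open>For nonempty finite sets this says \<open>max E < min F\<close>; it holds trivially if one set is empty.\<close>

definition set_less :: "nat set \<Rightarrow> nat set \<Rightarrow> bool" where
  "set_less E F \<longleftrightarrow> (\<forall>a\<in>E. \<forall>b\<in>F. a < b)"

definition interval :: "nat set \<Rightarrow> bool" where
  "interval E \<longleftrightarrow> (\<exists>a b. 1 \<le> a \<and> a \<le> b \<and> E = {a..b})"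

definition successive :: "nat set \<Rightarrow> (nat \<Rightarrow> nat set) \<Rightarrow> bool" where
  "successive I E \<longleftrightarrow> (\<forall>i\<in>I. \<forall>i'\<in>I. i < i' \<longrightarrow> set_less (E i) (E i'))"

text \<open>The sets \<open>F i\<close> are nonempty, so that \<open>k \<le> F 1\<close> is a genuine restriction;
  the empty set is obtained from \<open>k = 0\<close>.\<close>

primrec schreier :: "nat \<Rightarrow> nat set set" where
  "schreier 0 = insert {} {{k} | k. 1 \<le> k}"
| "schreier (Suc n) =
     {\<Union>i\<in>{1..k}. F i | k F.
        (\<forall>i\<in>{1..k}. F i \<in> schreier n \<and> F i \<noteq> {}) \<and> successive {1..k} F \<and> (\<forall>a\<in>F 1. 1 \<le> k \<longrightarrow> k \<le> a)}"

text \<open>Finite families of finite sets, indexed by a set \<open>I\<close> of numbers in increasing order. Empty sets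
  (the supports of zero vectors) are ignored.\<close>

definition minima :: "nat set \<Rightarrow> (nat \<Rightarrow> nat set) \<Rightarrow> nat set" where
  "minima I E = {Min (E i) | i. i \<in> I \<and> E i \<noteq> {}}"

definition admissible :: "nat set set \<Rightarrow> nat set \<Rightarrow> (nat \<Rightarrow> nat set) \<Rightarrow> bool" where
  "admissible M I E \<longleftrightarrow> successive I E \<and> minima I E \<in> M"

definition allowable :: "nat set set \<Rightarrow> nat set \<Rightarrow> (nat \<Rightarrow> nat set) \<Rightarrow> bool" where
  "allowable M I E \<longleftrightarrow> disjoint_family_on E I \<and> minima I E \<in> M"

definition block_seq :: "nat set \<Rightarrow> (nat \<Rightarrow> nat \<Rightarrow> real) \<Rightarrow> bool" where
  "block_seq I x \<longleftrightarrow> (\<forall>i\<in>I. x i \<in> c00 \<and> supp (x i) \<noteq> {}) \<and> successive I (\<lambda>i. supp (x i))"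


section \<open>The sequences of parameters\<close>

fun mm :: "nat \<Rightarrow> nat" where
  "mm 0 = 0"
| "mm (Suc 0) = 2"
| "mm (Suc (Suc j)) = mm (Suc j) ^ 5"

text \<open>The logarithm is an integer, see the lemma \<open>real_ss\<close> below.\<close>

definition ss :: "nat \<Rightarrow> nat" where
  "ss j = nat \<lfloor>log 2 (real (mm (Suc j) ^ 3))\<rfloor>"

fun nn :: "nat \<Rightarrow> nat" where
  "nn 0 = 0"
| "nn (Suc 0) = 4"
| "nn (Suc (Suc j)) = 15 * ss (Suc j) * nn (Suc j)"

lemma mm_Suc: "mm (Suc j) = 2 ^ (5 ^ j)"
  by (induction j) (simp_all add: power_mult[symmetric] mult.commute)

lemma real_ss: "real (ss j) = log 2 (real (mm (Suc j) ^ 3))"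
proof -
  have "real (mm (Suc j) ^ 3) = 2 ^ (5 ^ j * 3)"
    by (simp add: mm_Suc power_mult)
  then have "log 2 (real (mm (Suc j) ^ 3)) = real (5 ^ j * 3)"
    by (simp only: log_pow_cancel)
  then show ?thesis
    unfolding ss_def by (simp only: floor_of_nat nat_int)
qed


section \<open>Special convex combinations and the function \<open>l\<close>\<close>

definition basic_scc :: "nat \<Rightarrow> real \<Rightarrow> (nat \<Rightarrow> real) \<Rightarrow> bool" where
  "basic_scc n \<epsilon> a \<longleftrightarrow>
     (\<exists>F\<in>schreier n. supp a \<subseteq> F \<and> (\<forall>i\<in>F. a i \<in> {0..1}) \<and> (\<Sum>i\<in>F. a i) = 1) \<and>
     (\<forall>G\<in>schreier (n - 1). (\<Sum>i\<in>G. a i) < \<epsilon>)"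

definition scc :: "nat \<Rightarrow> real \<Rightarrow> nat set \<Rightarrow> (nat \<Rightarrow> nat \<Rightarrow> real) \<Rightarrow> (nat \<Rightarrow> real) \<Rightarrow> bool" where
  "scc n \<epsilon> I y x \<longleftrightarrow> finite I \<and> block_seq I y \<and>
     (\<exists>a. x = (\<lambda>t. \<Sum>i\<in>I. a i * y i t) \<and>
          basic_scc n \<epsilon> (\<lambda>t. \<Sum>i\<in>I. a i * unit_vec (minsupp (y i)) t))"

text \<open>\<open>(y k)\<^bsub>k \<in> I\<^esub>\<close> is a block sequence of \<open>(x i)\<^bsub>i \<in> F\<^esub>\<close>.\<close>

definition block_seq_of ::
    "nat set \<Rightarrow> (nat \<Rightarrow> nat \<Rightarrow> real) \<Rightarrow> nat set \<Rightarrow> (nat \<Rightarrow> nat \<Rightarrow> real) \<Rightarrow> bool" where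
  "block_seq_of F x I y \<longleftrightarrow> block_seq I y \<and>
     (\<exists>G c. successive I G \<and> (\<forall>k\<in>I. G k \<subseteq> F \<and> finite (G k) \<and> y k = (\<lambda>t. \<Sum>i\<in>G k. c i * x i t)))"

definition expansion :: "(nat \<Rightarrow> 'a::real_normed_vector) \<Rightarrow> 'a \<Rightarrow> (nat \<Rightarrow> real) \<Rightarrow> bool" where
  "expansion b x a \<longleftrightarrow> a 0 = 0 \<and> (\<lambda>n. \<Sum>i=1..n. a i *\<^sub>R b i) \<longlonglongrightarrow> x"

definition schauder_basis :: "(nat \<Rightarrow> 'a::banach) \<Rightarrow> 'a set \<Rightarrow> bool" where
  "schauder_basis b X \<longleftrightarrow> subspace X \<and> closed X \<and> b ` {1..} \<subseteq> X \<and> (\<forall>x\<in>X. \<exists>!a. expansion b x a)"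

definition coord_proj :: "(nat \<Rightarrow> 'a::banach) \<Rightarrow> nat set \<Rightarrow> 'a \<Rightarrow> 'a" where
  "coord_proj b E x = (\<Sum>i\<in>E. (THE a. expansion b x a) i *\<^sub>R b i)"

text \<open>Only finite sets \<open>E i\<close> are considered. The case of an infinite last set follows: with \<open>k = 1\<close> the
  estimate makes the basis unconditional, and one can pass to the limit.\<close>

definition lower_estimate :: "(nat \<Rightarrow> 'a::banach) \<Rightarrow> 'a set \<Rightarrow> bool" where
  "lower_estimate b X \<longleftrightarrow>
     (\<forall>x\<in>X. \<forall>j\<ge>1. \<forall>k E. (\<forall>i\<in>{1..k}. finite (E i)) \<and> admissible (schreier (nn (2 * j))) {1..k} E \<longrightarrow>
        (1 / real (mm (2 * j))) * (\<Sum>i=1..k. norm (coord_proj b (E i) x)) \<le> norm x)"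

instance bcontfun :: (metric_space, banach) banach ..

text \<open>Quantification over all Banach spaces with a basis is rendered by quantification over all closed
  subspaces with a basis of \<open>\<ell>\<^sub>\<infinity>\<close>, that is of \<^typ>\<open>nat discrete \<Rightarrow>\<^sub>C real\<close>: every Banach
  space with a basis is separable, hence isometric to a closed subspace of \<open>\<ell>\<^sub>\<infinity>\<close>. Finitely supported
  vectors of the space are given by their coordinates.\<close>

definition l_function :: "(nat \<Rightarrow> real \<Rightarrow> nat) \<Rightarrow> bool" where
  "l_function l \<longleftrightarrow>
     (\<forall>n\<ge>1. \<forall>\<epsilon>>0. n \<le> l n \<epsilon> \<and>
       (\<forall>(b :: nat \<Rightarrow> (nat discrete \<Rightarrow>\<^sub>C real)) X. schauder_basis b X \<and> lower_estimate b X \<longrightarrow>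
         (\<forall>u. block_seq {1..} u \<longrightarrow>
           (\<exists>F\<in>schreier (l n \<epsilon>). \<exists>d y x.
              block_seq_of F u {1..d} y \<and> (\<forall>k\<in>{1..d}. norm (lin_comb b (y k)) = 1) \<and>
              scc n \<epsilon> {1..d} y x \<and> norm (lin_comb b x) \<ge> 1 / 2))))"

definition rho :: "(nat \<Rightarrow> real \<Rightarrow> nat) \<Rightarrow> nat \<Rightarrow> nat" where
  "rho l n = (let s = (LEAST s. 1 \<le> s \<and> n\<^sup>2 \<le> mm (2 * s)) in l (nn (2 * s)) (1 / (real (mm (2 * s)))\<^sup>2))"


section \<open>The coding function and the norming set\<close>

definition interval_seqs :: "nat set list set" where
  "interval_seqs = {Es. Es \<noteq> [] \<and> (\<forall>E\<in>set Es. interval E) \<and> sorted_wrt set_less Es}"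

definition coding_function :: "(nat \<Rightarrow> real \<Rightarrow> nat) \<Rightarrow> nat set \<Rightarrow> (nat set list \<Rightarrow> nat) \<Rightarrow> bool" where
  "coding_function l L\<^sub>2 \<sigma> \<longleftrightarrow>
     inj_on \<sigma> interval_seqs \<and> \<sigma> ` interval_seqs \<subseteq> (\<lambda>i. 2 * i) ` L\<^sub>2 \<and>
     (\<forall>Es\<in>interval_seqs. 2 \<le> length Es \<longrightarrow> rho l (Max (last Es)) + Max (last Es) \<le> nn (\<sigma> Es))"

definition subseq_at :: "(nat \<Rightarrow> nat set) \<Rightarrow> nat set \<Rightarrow> nat set list" where
  "subseq_at E A = map E (sorted_list_of_set A)"

text \<open>The sequence \<open>f 1, \<dots>, f d\<close> is \<open>(2j+1)\<close>-dependent with respect to \<open>W\<close>; here \<open>w i\<close> is the number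
  written \<open>j\<^sub>i\<close> in the literature, so \<open>f i\<close> has weight \<open>1 / mm (2 * w i)\<close>. Zero terms are allowed
  regardless of whether \<open>0 \<in> W\<close>.\<close>

definition dependent_seq ::
    "nat set \<Rightarrow> (nat \<Rightarrow> nat) \<Rightarrow> (nat set list \<Rightarrow> nat) \<Rightarrow> (nat \<Rightarrow> real) set \<Rightarrow>
     nat \<Rightarrow> nat \<Rightarrow> (nat \<Rightarrow> nat \<Rightarrow> real) \<Rightarrow> bool" where
  "dependent_seq L\<^sub>1 \<rho> \<sigma> W j d f \<longleftrightarrow>
     1 \<le> d \<and> (\<forall>i\<in>{1..d}. f i \<in> insert (\<lambda>_. 0) W) \<and>
     admissible (schreier (nn (2 * j + 1))) {1..d} (\<lambda>i. supp (f i)) \<and>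
     (\<exists>w K g A E.
        (\<forall>i\<in>{1..d}. 1 \<le> w i \<and> interval (K i) \<and>
           (\<forall>k\<in>K i. g i k \<in> insert (\<lambda>_. 0) W) \<and>
           admissible (schreier (nn (2 * w i))) (K i) (\<lambda>k. supp (g i k)) \<and>
           f i = (\<lambda>t. (1 / real (mm (2 * w i))) * (\<Sum>k\<in>K i. g i k t))) \<and>
        successive {1..d} K \<and>
        (\<forall>k\<in>(\<Union>i\<in>{1..d}. K i). interval (A k)) \<and> successive (\<Union>i\<in>{1..d}. K i) A \<and>
        subseq_at E (\<Union>i\<in>{1..d}. \<Union>k\<in>K i. A k) \<in> interval_seqs \<and>
        w 1 \<in> L\<^sub>1 \<and> mm (2 * w 1) > nn (2 * j + 1) \<and>
        (\<forall>i\<in>{1..<d}. 2 * w (i + 1) = \<sigma> (subseq_at E (\<Union>l\<in>{1..i}. \<Union>k\<in>K l. A k))) \<and>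
        (\<forall>i\<in>{1..d}. \<forall>k\<in>K i. supp (g i k) \<subseteq> (\<Union>r\<in>A k. E r)) \<and>
        (\<forall>i\<in>{1..d}. is_singleton (A (Min (K i))) \<and>
           (\<forall>k\<in>K i. Min (K i) < k \<longrightarrow>
              admissible (schreier (\<rho> (Max (E (Max (A (k - 1))))))) (A k) E)))"

definition norming_closed ::
    "nat set \<Rightarrow> (nat \<Rightarrow> nat) \<Rightarrow> (nat set list \<Rightarrow> nat) \<Rightarrow> (nat \<Rightarrow> real) set \<Rightarrow> bool" where
  "norming_closed L\<^sub>1 \<rho> \<sigma> W \<longleftrightarrow>
     W \<subseteq> c00 \<and>
     (\<forall>n\<ge>1. unit_vec n \<in> W \<and> (\<lambda>t. - unit_vec n t) \<in> W) \<and>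
     (\<forall>f\<in>W. \<forall>g\<in>c00. (\<forall>t. \<bar>f t\<bar> = \<bar>g t\<bar>) \<longrightarrow> g \<in> W) \<and>
     (\<forall>j\<ge>1. \<forall>k\<ge>1. \<forall>f. (\<forall>i\<in>{1..k}. f i \<in> W) \<and>
        allowable (schreier (nn (2 * j))) {1..k} (\<lambda>i. supp (f i)) \<longrightarrow>
        (\<lambda>t. (1 / real (mm (2 * j))) * (\<Sum>i=1..k. f i t)) \<in> W) \<and>
     (\<forall>j\<ge>1. \<forall>d f. dependent_seq L\<^sub>1 \<rho> \<sigma> W j d f \<longrightarrow>
        (\<lambda>t. (1 / real (mm (2 * j + 1))) * (\<Sum>i=1..d. f i t)) \<in> W)"

definition norming_set ::
    "nat set \<Rightarrow> (nat \<Rightarrow> nat) \<Rightarrow> (nat set list \<Rightarrow> nat) \<Rightarrow> (nat \<Rightarrow> real) set" where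
  "norming_set L\<^sub>1 \<rho> \<sigma> = \<Inter> {W. norming_closed L\<^sub>1 \<rho> \<sigma> W}"


section \<open>Completion, embeddings, tightness\<close>

definition norm_W :: "(nat \<Rightarrow> real) set \<Rightarrow> (nat \<Rightarrow> real) \<Rightarrow> real" where
  "norm_W W x = (SUP f\<in>W. \<bar>pairing f x\<bar>)"

definition closed_span :: "(nat \<Rightarrow> 'a::real_normed_vector) \<Rightarrow> nat set \<Rightarrow> 'a set" where
  "closed_span e I = closure (span (e ` I))"

text \<open>\<open>e\<close> realises the completion of \<open>c00\<close> under \<open>norm_W W\<close> inside a Banach space: the linear map
  \<open>lin_comb e\<close>, which takes \<open>unit_vec n\<close> to \<open>e n\<close>, is isometric on \<open>c00\<close>, so that
  \<open>closed_span e {1..}\<close> is the completion and \<open>e\<close> its canonical basis.\<close>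

definition realises_completion :: "(nat \<Rightarrow> real) set \<Rightarrow> (nat \<Rightarrow> 'a::banach) \<Rightarrow> bool" where
  "realises_completion W e \<longleftrightarrow> (\<forall>x\<in>c00. norm (lin_comb e x) = norm_W W x)"

definition linear_on_set :: "'a::real_vector set \<Rightarrow> ('a \<Rightarrow> 'b::real_vector) \<Rightarrow> bool" where
  "linear_on_set Y T \<longleftrightarrow>
     (\<forall>x\<in>Y. \<forall>y\<in>Y. T (x + y) = T x + T y) \<and> (\<forall>c. \<forall>x\<in>Y. T (c *\<^sub>R x) = c *\<^sub>R T x)"

definition bounded_on_set :: "'a::real_normed_vector set \<Rightarrow> ('a \<Rightarrow> 'b::real_normed_vector) \<Rightarrow> bool" where
  "bounded_on_set Y T \<longleftrightarrow> (\<exists>C. \<forall>x\<in>Y. norm (T x) \<le> C * norm x)"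

text \<open>The analogue of \<^const>\<open>onorm\<close> for operators defined on a subspace only.\<close>

definition onorm_on :: "'a::real_normed_vector set \<Rightarrow> ('a \<Rightarrow> 'b::real_normed_vector) \<Rightarrow> real" where
  "onorm_on Y T = (SUP x\<in>Y. norm (T x) / norm x)"

definition embeds_with_constant ::
    "real \<Rightarrow> 'a::real_normed_vector set \<Rightarrow> 'b::real_normed_vector set \<Rightarrow> bool" where
  "embeds_with_constant C Y Z \<longleftrightarrow>
     (\<exists>T. linear_on_set Y T \<and> T ` Y \<subseteq> Z \<and> inj_on T Y \<and>
          bounded_on_set Y T \<and> bounded_on_set (T ` Y) (inv_into Y T) \<and>
          onorm_on Y T * onorm_on (T ` Y) (inv_into Y T) \<le> C)"

definition infinite_dimensional :: "'a::real_vector set \<Rightarrow> bool" where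
  "infinite_dimensional Y \<longleftrightarrow> (\<forall>B. finite B \<longrightarrow> \<not> Y \<subseteq> span B)"

definition tight_with_constants :: "(nat \<Rightarrow> 'a::banach) \<Rightarrow> bool" where
  "tight_with_constants e \<longleftrightarrow>
     (\<forall>Y. subspace Y \<and> closed Y \<and> Y \<subseteq> closed_span e {1..} \<and> infinite_dimensional Y \<longrightarrow>
       (\<exists>I. (\<forall>k\<ge>1. interval (I k)) \<and> successive {1..} I \<and>
         (\<forall>K\<ge>1. \<not> embeds_with_constant (real K) Y (closed_span e ({1..} - I K)))))"


section \<open>The construction is well posed\<close>

text \<open>The smallest set exists, and the completion is realised in \<open>\<ell>\<^sub>\<infinity>\<close>, for all choices of the
  parameters.\<close>

lemma dependent_seq_mono:
  assumes "dependent_seq L\<^sub>1 \<rho> \<sigma> W j d f" "W \<subseteq> W'"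
  shows "dependent_seq L\<^sub>1 \<rho> \<sigma> W' j d f"
proof -
  have W: "\<And>x. x \<in> insert (\<lambda>_. 0) W \<Longrightarrow> x \<in> insert (\<lambda>_. 0) W'"
    using assms(2) by blast
  have "dependent_seq L\<^sub>1 \<rho> \<sigma> W j d f \<longrightarrow> dependent_seq L\<^sub>1 \<rho> \<sigma> W' j d f"
    unfolding dependent_seq_def Ball_def
    by (rule imp_refl | rule conj_mono ex_mono all_mono imp_mono | rule allI | (rule impI, erule W))+
  then show ?thesis using assms(1) by simp
qed

lemma norming_closedD:
  assumes "norming_closed L\<^sub>1 \<rho> \<sigma> W"
  shows "W \<subseteq> c00"
    and "n \<ge> 1 \<Longrightarrow> unit_vec n \<in> W"
    and "n \<ge> 1 \<Longrightarrow> (\<lambda>t. - unit_vec n t) \<in> W"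
    and "f \<in> W \<Longrightarrow> g \<in> c00 \<Longrightarrow> (\<And>t. \<bar>f t\<bar> = \<bar>g t\<bar>) \<Longrightarrow> g \<in> W"
    and "j \<ge> 1 \<Longrightarrow> k \<ge> 1 \<Longrightarrow> (\<And>i. i \<in> {1..k} \<Longrightarrow> F i \<in> W) \<Longrightarrow>
      allowable (schreier (nn (2 * j))) {1..k} (\<lambda>i. supp (F i)) \<Longrightarrow>
      (\<lambda>t. (1 / real (mm (2 * j))) * (\<Sum>i=1..k. F i t)) \<in> W"
    and "j \<ge> 1 \<Longrightarrow> dependent_seq L\<^sub>1 \<rho> \<sigma> W j d F \<Longrightarrow>
      (\<lambda>t. (1 / real (mm (2 * j + 1))) * (\<Sum>i=1..d. F i t)) \<in> W"
proof -
  note parts = assms[unfolded norming_closed_def]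
  show "W \<subseteq> c00" using parts by (elim conjE)
  show "n \<ge> 1 \<Longrightarrow> unit_vec n \<in> W" "n \<ge> 1 \<Longrightarrow> (\<lambda>t. - unit_vec n t) \<in> W"
    using parts by simp_all
  show "f \<in> W \<Longrightarrow> g \<in> c00 \<Longrightarrow> (\<And>t. \<bar>f t\<bar> = \<bar>g t\<bar>) \<Longrightarrow> g \<in> W"
    using parts[THEN conjunct2, THEN conjunct2, THEN conjunct1, rule_format, of f g] by simp
  show "j \<ge> 1 \<Longrightarrow> k \<ge> 1 \<Longrightarrow> (\<And>i. i \<in> {1..k} \<Longrightarrow> F i \<in> W) \<Longrightarrow>
      allowable (schreier (nn (2 * j))) {1..k} (\<lambda>i. supp (F i)) \<Longrightarrow>
      (\<lambda>t. (1 / real (mm (2 * j))) * (\<Sum>i=1..k. F i t)) \<in> W"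
    by (rule parts[THEN conjunct2, THEN conjunct2, THEN conjunct2, THEN conjunct1, rule_format])
       (simp_all only: ball_simps simp_thms, blast?)
  show "j \<ge> 1 \<Longrightarrow> dependent_seq L\<^sub>1 \<rho> \<sigma> W j d F \<Longrightarrow>
      (\<lambda>t. (1 / real (mm (2 * j + 1))) * (\<Sum>i=1..d. F i t)) \<in> W"
    by (rule parts[THEN conjunct2, THEN conjunct2, THEN conjunct2, THEN conjunct2, rule_format])
qed

lemma c00_scaled_sum:
  assumes "\<And>i. i \<in> {1..d::nat} \<Longrightarrow> f i \<in> c00"
  shows "(\<lambda>t. c * (\<Sum>i=1..d. f i t)) \<in> c00"
proof -
  have "supp (\<lambda>t. c * (\<Sum>i=1..d. f i t)) \<subseteq> (\<Union>i\<in>{1..d}. supp (f i))"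
    by (auto simp: supp_def intro: ccontr)
  moreover have "finite (\<Union>i\<in>{1..d}. supp (f i))"
    using assms by (auto simp: c00_def)
  ultimately have "finite (supp (\<lambda>t. c * (\<Sum>i=1..d. f i t)))"
    by (rule finite_subset)
  moreover have "(\<Sum>i=1..d. f i 0) = 0"
    using assms by (intro sum.neutral) (auto simp: c00_def)
  ultimately show ?thesis by (simp add: c00_def)
qed

lemma zero_c00: "(\<lambda>_. 0) \<in> c00"
  by (simp add: c00_def supp_def)

lemma unit_vec_c00: "n \<ge> 1 \<Longrightarrow> unit_vec n \<in> c00" "n \<ge> 1 \<Longrightarrow> (\<lambda>t. - unit_vec n t) \<in> c00"
proof -
  have "supp (unit_vec n) \<subseteq> {n}" "supp (\<lambda>t. - unit_vec n t) \<subseteq> {n}"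
    by (auto simp: supp_def unit_vec_def indicator_def)
  then have "finite (supp (unit_vec n))" "finite (supp (\<lambda>t. - unit_vec n t))"
    by (auto intro: finite_subset)
  then show "n \<ge> 1 \<Longrightarrow> unit_vec n \<in> c00" "n \<ge> 1 \<Longrightarrow> (\<lambda>t. - unit_vec n t) \<in> c00"
    by (auto simp: c00_def unit_vec_def)
qed

lemma disjoint_sum_bound:
  fixes f :: "nat \<Rightarrow> nat \<Rightarrow> real"
  assumes disj: "disjoint_family_on (\<lambda>i. supp (f i)) {1..d}"
    and bd: "\<And>i. i \<in> {1..d} \<Longrightarrow> \<bar>f i t\<bar> \<le> 1"
  shows "\<bar>1 / real m * (\<Sum>i=1..d. f i t)\<bar> \<le> 1"
proof -
  have "\<bar>\<Sum>i=1..d. f i t\<bar> \<le> 1"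
  proof (cases "\<exists>i\<in>{1..d}. f i t \<noteq> 0")
    case True
    then obtain i where i: "i \<in> {1..d}" "f i t \<noteq> 0" by blast
    have "f k t = 0" if "k \<in> {1..d} - {i}" for k
      using disj i that by (fastforce simp: disjoint_family_on_def supp_def)
    then have "(\<Sum>k\<in>{1..d}. f k t) = f i t"
      using i(1) by (subst sum.remove[of _ i]) auto
    then show ?thesis using bd[OF i(1)] by simp
  next
    case False
    then show ?thesis by simp
  qed
  moreover have "0 \<le> 1 / real m" "1 / real m \<le> 1" by (cases m; simp)+
  ultimately show ?thesis
    unfolding abs_mult by (intro mult_le_one) auto
qed

definition rational_ball :: "(nat \<Rightarrow> real) set" where
  "rational_ball = {f \<in> c00. \<forall>t. f t \<in> \<rat> \<and> \<bar>f t\<bar> \<le> 1}"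

lemma rational_ball_scaled_sum:
  fixes f :: "nat \<Rightarrow> nat \<Rightarrow> real"
  assumes "\<And>i. i \<in> {1..d} \<Longrightarrow> f i \<in> rational_ball"
    and "disjoint_family_on (\<lambda>i. supp (f i)) {1..d}"
  shows "(\<lambda>t. (1 / real m) * (\<Sum>i=1..d. f i t)) \<in> rational_ball"
proof -
  have "(1 / real m) * (\<Sum>i=1..d. f i t) \<in> \<rat>" for t
    using assms(1) by (intro Rats_mult Rats_divide Rats_sum) (auto simp: rational_ball_def)
  moreover have "\<bar>1 / real m * (\<Sum>i=1..d. f i t)\<bar> \<le> 1" for t
    using assms by (intro disjoint_sum_bound) (auto simp: rational_ball_def)
  ultimately show ?thesis
    using c00_scaled_sum[of d f "1 / real m"] assms(1) by (auto simp: rational_ball_def)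
qed

lemma successive_disjoint:
  assumes "successive I E"
  shows "disjoint_family_on E I"
  unfolding disjoint_family_on_def
proof (intro ballI impI)
  fix i k assume "i \<in> I" "k \<in> I" "i \<noteq> k"
  then have "set_less (E i) (E k) \<or> set_less (E k) (E i)"
    using assms unfolding successive_def by (meson nat_neq_iff)
  then show "E i \<inter> E k = {}" unfolding set_less_def by blast
qed

lemma norming_closed_rational_ball: "norming_closed L\<^sub>1 \<rho> \<sigma> rational_ball"
  unfolding norming_closed_def
proof (intro conjI allI impI ballI)
  show "rational_ball \<subseteq> c00" by (auto simp: rational_ball_def)
  fix n :: nat assume "1 \<le> n"
  then show "unit_vec n \<in> rational_ball" "(\<lambda>t. - unit_vec n t) \<in> rational_ball"
    using unit_vec_c00 by (auto simp: rational_ball_def unit_vec_def indicator_def)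
next
  fix f g assume fg: "f \<in> rational_ball" "g \<in> c00" "\<forall>t. \<bar>f t\<bar> = \<bar>g t\<bar>"
  have "g t \<in> \<rat> \<and> \<bar>g t\<bar> \<le> 1" for t
  proof -
    have "g t = f t \<or> g t = - f t" using fg(3) by (metis abs_eq_iff)
    then show ?thesis using fg(1) by (auto simp: rational_ball_def)
  qed
  then show "g \<in> rational_ball" using fg(2) by (simp add: rational_ball_def)
next
  fix j k :: nat and f :: "nat \<Rightarrow> nat \<Rightarrow> real"
  assume "(\<forall>i\<in>{1..k}. f i \<in> rational_ball) \<and>
    allowable (schreier (nn (2 * j))) {1..k} (\<lambda>i. supp (f i))"
  then show "(\<lambda>t. 1 / real (mm (2 * j)) * (\<Sum>i = 1..k. f i t)) \<in> rational_ball"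
    by (intro rational_ball_scaled_sum) (auto simp: allowable_def)
next
  fix j d :: nat and f
  assume "dependent_seq L\<^sub>1 \<rho> \<sigma> rational_ball j d f"
  moreover have "(\<lambda>_. 0) \<in> rational_ball" using zero_c00 by (simp add: rational_ball_def)
  ultimately have "\<forall>i\<in>{1..d}. f i \<in> rational_ball" "successive {1..d} (\<lambda>i. supp (f i))"
    unfolding dependent_seq_def admissible_def by auto
  then show "(\<lambda>t. 1 / real (mm (2 * j + 1)) * (\<Sum>i = 1..d. f i t)) \<in> rational_ball"
    by (intro rational_ball_scaled_sum successive_disjoint) auto
qed

lemma norming_set_least: "norming_closed L\<^sub>1 \<rho> \<sigma> W \<Longrightarrow> norming_set L\<^sub>1 \<rho> \<sigma> \<subseteq> W"
  unfolding norming_set_def by blast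

lemma norming_closed_norming_set: "norming_closed L\<^sub>1 \<rho> \<sigma> (norming_set L\<^sub>1 \<rho> \<sigma>)"
proof -
  let ?W = "norming_set L\<^sub>1 \<rho> \<sigma>"
  have mem: "x \<in> ?W \<longleftrightarrow> (\<forall>S. norming_closed L\<^sub>1 \<rho> \<sigma> S \<longrightarrow> x \<in> S)" for x
    by (auto simp: norming_set_def)
  show ?thesis
    unfolding norming_closed_def
  proof (intro conjI allI impI ballI)
    show "?W \<subseteq> c00"
      using norming_set_least[OF norming_closed_rational_ball] by (auto simp: rational_ball_def)
  next
    fix n :: nat assume "1 \<le> n"
    then show "unit_vec n \<in> ?W" "(\<lambda>t. - unit_vec n t) \<in> ?W"
      unfolding mem by (auto intro: norming_closedD(2,3))
  next
    fix f g assume "f \<in> ?W" "g \<in> c00" "\<forall>t. \<bar>f t\<bar> = \<bar>g t\<bar>"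
    then show "g \<in> ?W" unfolding mem using norming_closedD(4) by metis
  next
    fix j k :: nat and f :: "nat \<Rightarrow> nat \<Rightarrow> real"
    assume jk: "1 \<le> j" "1 \<le> k" and f: "(\<forall>i\<in>{1..k}. f i \<in> ?W) \<and>
      allowable (schreier (nn (2 * j))) {1..k} (\<lambda>i. supp (f i))"
    show "(\<lambda>t. 1 / real (mm (2 * j)) * (\<Sum>i = 1..k. f i t)) \<in> ?W"
      unfolding mem
    proof (intro allI impI)
      fix S assume S: "norming_closed L\<^sub>1 \<rho> \<sigma> S"
      show "(\<lambda>t. 1 / real (mm (2 * j)) * (\<Sum>i = 1..k. f i t)) \<in> S"
        using f norming_set_least[OF S] by (intro norming_closedD(5)[OF S jk]) auto
    qed
  next
    fix j d :: nat and f
    assume j: "1 \<le> j" and f: "dependent_seq L\<^sub>1 \<rho> \<sigma> ?W j d f"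
    show "(\<lambda>t. 1 / real (mm (2 * j + 1)) * (\<Sum>i = 1..d. f i t)) \<in> ?W"
      unfolding mem
    proof (intro allI impI)
      fix S assume S: "norming_closed L\<^sub>1 \<rho> \<sigma> S"
      show "(\<lambda>t. 1 / real (mm (2 * j + 1)) * (\<Sum>i = 1..d. f i t)) \<in> S"
        by (rule norming_closedD(6)[OF S j dependent_seq_mono[OF f norming_set_least[OF S]]])
    qed
  qed
qed

lemma countable_rational_ball: "countable rational_ball"
proof -
  have "rational_ball \<subseteq> (\<lambda>xs t. if t < length xs then xs ! t else 0) ` lists \<rat>"
  proof
    fix f assume f: "f \<in> rational_ball"
    then obtain N where N: "\<forall>t\<in>supp f. t < N"
      by (auto simp: rational_ball_def c00_def finite_nat_set_iff_bounded)
    have "f = (\<lambda>t. if t < length (map f [0..<N]) then map f [0..<N] ! t else 0)"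
      using N by (auto simp: supp_def fun_eq_iff)
    moreover have "map f [0..<N] \<in> lists \<rat>" using f by (auto simp: rational_ball_def)
    ultimately show "f \<in> (\<lambda>xs t. if t < length xs then xs ! t else 0) ` lists \<rat>" by blast
  qed
  moreover have "countable (lists (\<rat> :: real set))"
    by (simp add: countable_rat)
  ultimately show ?thesis by (meson countable_image countable_subset)
qed

lemma completion_exists:
  "\<exists>e :: nat \<Rightarrow> (nat discrete \<Rightarrow>\<^sub>C real). realises_completion (norming_set L\<^sub>1 \<rho> \<sigma>) e"
proof -
  let ?W = "norming_set L\<^sub>1 \<rho> \<sigma>"
  define \<phi> where "\<phi> k = from_nat_into ?W (of_discrete k)" for k :: "nat discrete"
  have sub: "?W \<subseteq> rational_ball" by (rule norming_set_least[OF norming_closed_rational_ball])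
  have "unit_vec 1 \<in> ?W"
    by (rule norming_closedD(2)[OF norming_closed_norming_set]) simp
  then have "range (from_nat_into ?W) = ?W"
    using sub countable_rational_ball
    by (intro range_from_nat_into) (auto intro: countable_subset)
  moreover have "range (of_discrete :: nat discrete \<Rightarrow> nat) = UNIV"
    by (metis discrete_inverse UNIV_I surj_def)
  ultimately have "range \<phi> = ?W"
    unfolding \<phi>_def by (metis image_image)
  then have img: "(\<lambda>f. \<bar>pairing f x\<bar>) ` ?W = range (\<lambda>k. \<bar>pairing (\<phi> k) x\<bar>)" for x
    by (metis (no_types, lifting) image_cong image_image)
  have \<phi>: "\<phi> k \<in> rational_ball" for k using \<open>range \<phi> = ?W\<close> sub by blast
  define e where "e n = Bcontfun (\<lambda>k. \<phi> k n)" for n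
  have "(\<lambda>k. \<phi> k n) \<in> bcontfun" for n
    using \<phi> by (intro bcontfun_normI[of _ 1]) (auto simp: rational_ball_def continuous_on_open_invariant open_discrete)
  then have e: "apply_bcontfun (e n) k = \<phi> k n" for n k
    unfolding e_def by (simp add: Bcontfun_inverse)
  have sum: "apply_bcontfun (\<Sum>i\<in>A. x i *\<^sub>R e i) k = (\<Sum>i\<in>A. x i * \<phi> k i)" for A x k
    by (induction A rule: infinite_finite_induct) (auto simp: e)
  have "norm (lin_comb e x) = norm_W ?W x" for x
  proof -
    have "norm (lin_comb e x) = (SUP k. \<bar>apply_bcontfun (lin_comb e x) k\<bar>)"
      by (simp add: norm_conv_dist[of "lin_comb e x"] dist_bcontfun.rep_eq)
    also have "\<dots> = (SUP k. \<bar>pairing (\<phi> k) x\<bar>)"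
      by (simp add: lin_comb_def sum pairing_def mult.commute)
    finally show ?thesis by (simp add: norm_W_def img)
  qed
  then show ?thesis unfolding realises_completion_def by blast
qed

end

theory Submission
  imports Defs
begin

text \<open>
  Only three features of the norming set \<open>W\<close> matter: it is closed under changes of sign and
  restrictions; the average \<open>(h\<^sub>1 + \<dots> + h\<^sub>k) / m\<^sub>2\<close> of disjointly supported elements supported in
  \<open>[k, \<infinity>)\<close> belongs to \<open>W\<close>; and every element is a multiple of a coordinate or an average of
  disjointly supported elements with weight at most \<open>1 / m\<^sub>2\<close>, the minima forming a Schreier set.

  By the second feature, far out the norm is 1-concave on any fixed number of vectors, up to the
  factor \<open>m\<^sub>2\<close>. Let \<open>u\<close> be a normalized block sequence close to vectors of \<open>Y\<close>, and suppose that
  \<open>Y\<close> embeds with constant \<open>K\<close> into the span of \<open>e\<^sub>i\<close>, \<open>i \<notin> [a, b]\<close>, for all \<open>b\<close>. As in \<open>L\<^sub>1\<close>, the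
  images of many consecutive \<open>u\<^sub>i\<close> cannot all be dominated, up to a small error, by a fixed vector:
  otherwise their averages over signs would be too small, whereas \<open>u\<close> has an \<open>\<ell>\<^sub>1\<close> spreading model. So
  one selects a subsequence of \<open>u\<close> whose images have large, almost disjoint parts, and by concavity
  this subsequence is equivalent to the unit vector basis of \<open>\<ell>\<^sub>1\<close>.

  This is impossible because convex combinations of block vectors can be made small: if a sum over
  \<open>D\<close> disjoint functionals is bounded by \<open>\<Gamma>\<close> on suitable vectors arbitrarily far out, for every \<open>D\<close>, then
  by splitting the functionals once it is bounded by \<open>\<Gamma> / m\<^sub>2 + \<epsilon>\<close> on suitable averages of such vectors.
\<close>

section \<open>Schreier families\<close>

text \<open>The embeddings supplied for different gaps \<open>{a..b}\<close> are unrelated, and no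
  limit operator is available. They serve only to derive inequalities about \<open>u\<close>, in
  which \<open>b\<close> no longer occurs; so it suffices that for every \<open>n\<close> infinitely
  many \<open>b\<close> suit the first \<open>n\<close> chosen indices, and a pigeonhole over finite
  candidate sets preserves this. The gap enters through its length: concavity is applied to all
  \<open>2 ^ card F\<close> sign sums at once, which requires their parts after the gap to start
  late, so \<open>b\<close> is chosen after \<open>F\<close>. Before the gap there are only
  \<open>a\<close> coordinates, where orthogonality of the signs leaves order \<open>R\<close>
  against \<open>R\<^sup>2\<close> for the whole sum.

  Images of block vectors are not blocks, and their large parts interlace; hence averages of
  disjointly supported functionals, and not only of successive ones, are essential.

  In the upper estimate a functional splits into many pieces, which is why it is stated for sums
  over several functionals. Weights are unbounded, but on a fixed vector very large ones are
  negligible; averaging vectors with growing weight thresholds leaves each functional at most one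
  vector on which it is uncontrolled.\<close>

lemma schreier_finite: "F \<in> schreier n \<Longrightarrow> finite F"
  by (induction n arbitrary: F) auto

lemma schreier_pos: "F \<in> schreier n \<Longrightarrow> a \<in> F \<Longrightarrow> 1 \<le> a"
  by (induction n arbitrary: F a) fastforce+

text \<open>The recursive clause of \<open>schreier\<close> demands nonempty pieces, whereas taking
  preimages creates empty ones. They are discarded and the rest is renumbered from the left.\<close>

lemma drop_empty_sets:
  assumes "successive {1..k} F"
  shows "\<exists>k' F'. k' \<le> k \<and> (\<Union>i\<in>{1..k'}. F' i) = (\<Union>i\<in>{1..k}. F i) \<and>
    (\<forall>i\<in>{1..k'}. F' i \<noteq> {} \<and> F' i \<in> F ` {1..k}) \<and> successive {1..k'} F'"
  using assms
proof (induction k)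
  case 0
  show ?case by (intro exI[of _ 0] exI[of _ F]) (auto simp: successive_def)
next
  case (Suc k)
  have "successive {1..k} F"
    using Suc.prems by (auto simp: successive_def)
  from Suc.IH[OF this] obtain k' F' where *: "k' \<le> k"
      "(\<Union>i\<in>{1..k'}. F' i) = (\<Union>i\<in>{1..k}. F i)"
      "\<forall>i\<in>{1..k'}. F' i \<noteq> {} \<and> F' i \<in> F ` {1..k}" "successive {1..k'} F'"
    by blast
  have U: "(\<Union>i\<in>{1..Suc k}. F i) = (\<Union>i\<in>{1..k}. F i) \<union> F (Suc k)"
    by (auto simp: atLeastAtMostSuc_conv)
  show ?case
  proof (cases "F (Suc k) = {}")
    case True
    have "F ` {1..k} \<subseteq> F ` {1..Suc k}" by (intro image_mono) auto
    then show ?thesis using * U True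
      by (intro exI[of _ k'] exI[of _ F']) auto
  next
    case False
    define G where "G = F'(Suc k' := F (Suc k))"
    have G: "G i = F' i" if "i \<in> {1..k'}" for i using that by (simp add: G_def)
    have GS: "G (Suc k') = F (Suc k)" by (simp add: G_def)
    have split: "{1..Suc k'} = insert (Suc k') {1..k'}" by auto
    have "(\<Union>i\<in>{1..Suc k'}. G i) = (\<Union>i\<in>{1..Suc k}. F i)"
      unfolding U split using *(2) G GS by auto
    moreover have "\<forall>i\<in>{1..Suc k'}. G i \<noteq> {} \<and> G i \<in> F ` {1..Suc k}"
      unfolding split using *(3) G GS False by fastforce
    moreover have "successive {1..Suc k'} G"
      unfolding successive_def
    proof (intro ballI impI)
      fix i i' assume i: "i \<in> {1..Suc k'}" "i' \<in> {1..Suc k'}" "i < i'"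
      then have i1: "i \<in> {1..k'}" by auto
      show "set_less (G i) (G i')"
      proof (cases "i' = Suc k'")
        case True
        obtain r where "r \<in> {1..k}" "F' i = F r" using *(3) i1 by blast
        then show ?thesis using Suc.prems True G[OF i1] GS
          by (auto simp: successive_def)
      next
        case False
        then show ?thesis using *(4) i i1 G by (auto simp: successive_def)
      qed
    qed
    ultimately show ?thesis using *(1) by (intro exI[of _ "Suc k'"] exI[of _ G]) simp
  qed
qed

text \<open>Introduction rule that tolerates empty pieces. Since \<open>F 1\<close> may be empty,
  the bound on the number of pieces has to be required on the whole union.\<close>

lemma schreier_SucI:
  assumes "\<And>i. i \<in> {1..k} \<Longrightarrow> F i \<in> schreier n" "successive {1..k} F"
    and "\<And>a. a \<in> (\<Union>i\<in>{1..k}. F i) \<Longrightarrow> k \<le> a"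
  shows "(\<Union>i\<in>{1..k}. F i) \<in> schreier (Suc n)"
proof -
  obtain k' F' where *: "k' \<le> k" "(\<Union>i\<in>{1..k'}. F' i) = (\<Union>i\<in>{1..k}. F i)"
      "\<forall>i\<in>{1..k'}. F' i \<noteq> {} \<and> F' i \<in> F ` {1..k}" "successive {1..k'} F'"
    using drop_empty_sets[OF assms(2)] by (elim exE conjE) (rule that)
  have "F' i \<in> schreier n" if "i \<in> {1..k'}" for i
  proof -
    have "F' i \<in> F ` {1..k}" using *(3)[rule_format, OF that] ..
    then obtain r where "r \<in> {1..k}" "F' i = F r" by (rule imageE)
    show ?thesis unfolding \<open>F' i = F r\<close> by (rule assms(1)) fact
  qed
  moreover have "k' \<le> a" if "a \<in> F' 1" "1 \<le> k'" for a
  proof -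
    have "a \<in> (\<Union>i\<in>{1..k'}. F' i)" using that by (intro UN_I[of 1]) simp_all
    then have "k \<le> a" unfolding *(2) by (rule assms(3))
    then show ?thesis using *(1) by simp
  qed
  ultimately have "(\<Union>i\<in>{1..k'}. F' i) \<in> schreier (Suc n)"
    using *(3,4) unfolding schreier.simps by blast
  then show ?thesis using *(2) by simp
qed

text \<open>The defining bound speaks of \<open>F 1\<close> only; it passes to all of
  \<open>M\<close> because the other pieces lie to the right of some point of
  \<open>F 1\<close>.\<close>

lemma schreier_SucE:
  assumes "M \<in> schreier (Suc n)"
  obtains k F where "M = (\<Union>i\<in>{1..k}. F i)" "\<And>i. i \<in> {1..k} \<Longrightarrow> F i \<in> schreier n"
    "successive {1..k} F" "\<And>a. a \<in> M \<Longrightarrow> k \<le> a"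
proof -
  obtain k F where *: "M = (\<Union>i\<in>{1..k}. F i)" "\<forall>i\<in>{1..k}. F i \<in> schreier n \<and> F i \<noteq> {}"
      "successive {1..k} F" "\<forall>a\<in>F 1. 1 \<le> k \<longrightarrow> k \<le> a"
    using assms by auto
  have "k \<le> a" if a: "a \<in> M" for a
  proof -
    obtain i where i: "i \<in> {1..k}" "a \<in> F i" using a *(1) by blast
    then have "1 \<le> k" by auto
    show ?thesis
    proof (cases "i = 1")
      case True then show ?thesis using *(4) i \<open>1 \<le> k\<close> by blast
    next
      case False
      obtain c where c: "c \<in> F 1" using *(2) \<open>1 \<le> k\<close> by force
      have "set_less (F 1) (F i)" using *(3) i False \<open>1 \<le> k\<close> by (auto simp: successive_def)
      then have "c < a" using c i by (auto simp: set_less_def)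
      then show ?thesis using *(4) c \<open>1 \<le> k\<close> by fastforce
    qed
  qed
  then show ?thesis using that *(1-3) by blast
qed

lemma schreier_mono_Suc: "schreier n \<subseteq> schreier (Suc n)"
proof
  fix F assume F: "F \<in> schreier n"
  have "(\<Union>i\<in>{1..1::nat}. F) \<in> schreier (Suc n)"
    using F schreier_pos[OF F] by (intro schreier_SucI) (auto simp: successive_def)
  then show "F \<in> schreier (Suc n)" by simp
qed

lemma schreier_mono: "n \<le> n' \<Longrightarrow> schreier n \<subseteq> schreier n'"
  by (rule lift_Suc_mono_le[of schreier]) (rule schreier_mono_Suc)

lemma empty_schreier: "{} \<in> schreier n"
  using schreier_mono[of 0 n] by auto

text \<open>Such a set is a union of \<open>card F\<close> singletons, none of which lies before
  \<open>card F\<close>, so it already belongs to the first family.\<close>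

lemma small_set_schreier:
  assumes "finite F" "F \<subseteq> {1..}" "\<And>a. a \<in> F \<Longrightarrow> card F \<le> a" "1 \<le> n"
  shows "F \<in> schreier n"
proof -
  define xs where "xs = sorted_list_of_set F"
  have xs: "set xs = F" "length xs = card F" "sorted_wrt (<) xs"
    using assms(1) by (auto simp: xs_def)
  have F: "F = (\<Union>i\<in>{1..card F}. {xs ! (i - 1)})"
  proof -
    have "F = (\<lambda>i. xs ! i) ` {..<card F}" using xs by (auto simp: in_set_conv_nth)
    also have "{..<card F} = (\<lambda>i. i - 1) ` {1..card F}"
      by (force simp: image_iff intro: bexI[of _ "Suc _"])
    finally show ?thesis by auto
  qed
  have "(\<Union>i\<in>{1..card F}. {xs ! (i - 1)}) \<in> schreier (Suc 0)"
  proof (rule schreier_SucI)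
    show "{xs ! (i - 1)} \<in> schreier 0" if "i \<in> {1..card F}" for i
    proof -
      have "xs ! (i - 1) \<in> F" using that xs by (metis F UN_I insertI1)
      then show ?thesis using assms(2) by auto
    qed
    show "successive {1..card F} (\<lambda>i. {xs ! (i - 1)})"
      using xs(2,3) by (auto simp: successive_def set_less_def sorted_wrt_iff_nth_less)
    show "card F \<le> a" if "a \<in> (\<Union>i\<in>{1..card F}. {xs ! (i - 1)})" for a
      using that assms(3) F by metis
  qed
  then show ?thesis using F schreier_mono[of "Suc 0" n] assms(4) by (metis One_nat_def subsetD)
qed

text \<open>An ordered form of the marriage theorem, by greedy matching from the right: the largest
  point of \<open>G\<close> is sent to the largest point of \<open>F\<close> not beyond it. The
  counting condition survives the removal of both points: after \<open>z\<close> only total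
  cardinalities are compared, before \<open>z\<close> nothing has changed.\<close>

lemma monotone_injection:
  fixes G F :: "nat set"
  assumes "finite G" "finite F" "\<And>y. card (G \<inter> {..y}) \<le> card (F \<inter> {..y})"
  shows "\<exists>h. strict_mono_on G h \<and> h ` G \<subseteq> F \<and> (\<forall>x\<in>G. h x \<le> x)"
  using assms
proof (induction "card G" arbitrary: G F)
  case 0
  then show ?case by (intro exI[of _ id]) (auto simp: strict_mono_on_def)
next
  case (Suc n)
  then have ne: "G \<noteq> {}" by auto
  define x where "x = Max G"
  have x: "x \<in> G" "\<And>y. y \<in> G \<Longrightarrow> y \<le> x" using Suc ne by (auto simp: x_def)
  define F' where "F' = F \<inter> {..x}"
  have "G \<inter> {..x} = G" using x by auto
  then have cG: "card G \<le> card F'" using Suc.prems(3)[of x] by (simp add: F'_def)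
  then have "F' \<noteq> {}" using Suc.hyps(2) by auto
  define z where "z = Max F'"
  have fF': "finite F'" using Suc.prems by (simp add: F'_def)
  have z: "z \<in> F'" "\<And>y. y \<in> F' \<Longrightarrow> y \<le> z" using fF' \<open>F' \<noteq> {}\<close> by (auto simp: z_def)
  have "\<exists>h. strict_mono_on (G - {x}) h \<and> h ` (G - {x}) \<subseteq> F' - {z} \<and> (\<forall>x\<in>G - {x}. h x \<le> x)"
  proof (rule Suc.hyps(1))
    show "n = card (G - {x})" using Suc.hyps(2) x(1) Suc.prems(1) by simp
    show "finite (G - {x})" "finite (F' - {z})" using Suc.prems fF' by auto
    show "card ((G - {x}) \<inter> {..y}) \<le> card ((F' - {z}) \<inter> {..y})" for y
    proof (cases "z \<le> y")
      case True
      then have "(F' - {z}) \<inter> {..y} = F' - {z}" using z(2) by (meson Diff_subset Int_absorb2 atMost_iff order_trans subsetD subsetI)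
      then have "card ((F' - {z}) \<inter> {..y}) = card F' - 1" using z(1) fF' by simp
      moreover have "card ((G - {x}) \<inter> {..y}) \<le> card (G - {x})"
        using Suc.prems(1) by (intro card_mono) auto
      ultimately show ?thesis using cG x(1) Suc.prems(1) by simp
    next
      case False
      then have yx: "y < x" using z(1) by (auto simp: F'_def)
      have "(F' - {z}) \<inter> {..y} = F \<inter> {..y}" using False yx by (auto simp: F'_def)
      moreover have "(G - {x}) \<inter> {..y} = G \<inter> {..y}" using yx by auto
      ultimately show ?thesis using Suc.prems(3) by simp
    qed
  qed
  then obtain h where h: "strict_mono_on (G - {x}) h" "h ` (G - {x}) \<subseteq> F' - {z}"
      "\<forall>x\<in>G - {x}. h x \<le> x" by blast
  define h' where "h' = h(x := z)"
  have lt: "h y < z" if "y \<in> G - {x}" for y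
  proof -
    have "h y \<in> F' - {z}" using h(2) that by blast
    then show ?thesis using z(2)[of "h y"] by auto
  qed
  have "strict_mono_on G h'"
    unfolding strict_mono_on_def
  proof (intro allI impI, elim conjE)
    fix r s assume rs: "r \<in> G" "s \<in> G" "r < s"
    then have "r \<noteq> x" using x(2)[of s] by auto
    then show "h' r < h' s"
      using rs h(1) lt by (auto simp: h'_def strict_mono_on_def)
  qed
  moreover have "h' ` G \<subseteq> F" using h(2) z(1) by (auto simp: h'_def F'_def)
  moreover have "\<forall>x\<in>G. h' x \<le> x" using h(3) z(1) by (auto simp: h'_def F'_def)
  ultimately show ?case by blast
qed

text \<open>The preimages under \<open>h\<close> of the pieces of \<open>F\<close> are pieces of
  \<open>G\<close>; order is kept, and moving points to the right cannot violate the bound on the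
  number of pieces.\<close>

lemma schreier_spread_mono:
  assumes "F \<in> schreier n" "strict_mono_on G h" "h ` G \<subseteq> F" "\<forall>x\<in>G. h x \<le> x"
  shows "G \<in> schreier n"
  using assms
proof (induction n arbitrary: F G)
  case 0
  have "inj_on h G" using 0 by (simp add: strict_mono_on_imp_inj_on)
  consider "F = {}" | k where "1 \<le> k" "F = {k}" using 0 by auto
  then show ?case
  proof cases
    case 1 then show ?thesis using 0 by auto
  next
    case 2
    have "G = {} \<or> (\<exists>x. G = {x})"
      using \<open>inj_on h G\<close> 0 2 by (metis image_subset_iff inj_onD singletonD is_singletonI' is_singleton_the_elem)
    then show ?thesis using 0 2 by auto
  qed
next
  case (Suc n)
  obtain k E where E: "F = (\<Union>i\<in>{1..k}. E i)" "\<And>i. i \<in> {1..k} \<Longrightarrow> E i \<in> schreier n"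
    "successive {1..k} E" "\<And>a. a \<in> F \<Longrightarrow> k \<le> a"
    using schreier_SucE[OF Suc.prems(1)] by metis
  have "(\<Union>i\<in>{1..k}. {x\<in>G. h x \<in> E i}) \<in> schreier (Suc n)"
  proof (rule schreier_SucI)
    show "{x \<in> G. h x \<in> E i} \<in> schreier n" if i: "i \<in> {1..k}" for i
      using Suc.prems by (intro Suc.IH[OF E(2)[OF i]]) (auto simp: strict_mono_on_def)
    show "successive {1..k} (\<lambda>i. {x \<in> G. h x \<in> E i})"
      unfolding successive_def set_less_def
    proof (intro ballI impI)
      fix i i' x y assume *: "i \<in> {1..k}" "i' \<in> {1..k}" "i < i'" "x \<in> {x \<in> G. h x \<in> E i}"
        "y \<in> {x \<in> G. h x \<in> E i'}"
      then have "h x < h y" using E(3) unfolding successive_def set_less_def by blast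
      then show "x < y" using * Suc.prems(2)
        by (metis (no_types, lifting) mem_Collect_eq not_less_iff_gr_or_eq strict_mono_on_def)
    qed
    show "k \<le> a" if "a \<in> (\<Union>i\<in>{1..k}. {x \<in> G. h x \<in> E i})" for a
    proof -
      have "a \<in> G" using that by auto
      then have "h a \<in> F" "h a \<le> a" using Suc.prems(3,4) by blast+
      then have "k \<le> h a" "h a \<le> a" using E(4) by blast+
      then show ?thesis by simp
    qed
  qed
  moreover have "(\<Union>i\<in>{1..k}. {x\<in>G. h x \<in> E i}) = G" using Suc.prems(3) unfolding E(1) by blast
  ultimately show ?case by simp
qed

text \<open>An injection that moves points down need not be increasing, but it yields the counting
  inequalities from which an increasing one is built.\<close>

lemma schreier_spread:
  assumes "F \<in> schreier n" "finite G" "inj_on h G" "h ` G \<subseteq> F" "\<forall>x\<in>G. h x \<le> x"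
  shows "G \<in> schreier n"
proof -
  have "card (G \<inter> {..y}) \<le> card (F \<inter> {..y})" for y
  proof -
    have "h ` (G \<inter> {..y}) \<subseteq> F \<inter> {..y}" using assms(4,5) by fastforce
    moreover have "inj_on h (G \<inter> {..y})" using assms(3) by (rule inj_on_subset) auto
    ultimately show ?thesis
      using schreier_finite[OF assms(1)] by (metis card_inj_on_le finite_Int)
  qed
  then show ?thesis
    using monotone_injection[OF assms(2) schreier_finite[OF assms(1)]] schreier_spread_mono[OF assms(1)]
    by blast
qed

section \<open>The norming set\<close>

definition restr :: "nat set \<Rightarrow> (nat \<Rightarrow> real) \<Rightarrow> nat \<Rightarrow> real" where
  "restr E x = (\<lambda>t. if t \<in> E then x t else 0)"

lemma supp_restr: "supp (restr E x) = supp x \<inter> E"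
  by (auto simp: restr_def supp_def)

lemma restr_c00: "x \<in> c00 \<Longrightarrow> restr E x \<in> c00"
  by (simp add: c00_def supp_restr) (simp add: restr_def)

lemma restr_sum: "restr E (\<lambda>t. c * (\<Sum>i\<in>I. f i t)) = (\<lambda>t. c * (\<Sum>i\<in>I. restr E (f i) t))"
  by (auto simp: restr_def fun_eq_iff)

lemma restr_zero: "restr E (\<lambda>_. 0) = (\<lambda>_. 0)"
  by (auto simp: restr_def)

section \<open>Size of the parameters\<close>

lemma le_mm: "j \<le> mm j"
proof (cases j)
  case (Suc i)
  have "i < 5 ^ i" by (rule power_gt_expt) simp
  also have "(5::nat) ^ i < 2 ^ 5 ^ i" by (rule less_exp)
  finally show ?thesis using Suc by (simp add: mm_Suc)
qed simp

lemma mm_2: "mm 2 = 32"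
  using mm_Suc[of 1] by (simp only: Suc_1) simp

lemma mm_ge_32:
  assumes "2 \<le> j"
  shows "32 \<le> mm j"
proof -
  obtain i where i: "j = 2 + i" using le_Suc_ex[OF assms] by auto
  have "(5::nat) \<le> 5 ^ Suc i" by (rule self_le_power) simp_all
  then have "(2::nat) ^ 5 \<le> 2 ^ (5 ^ Suc i)" by (rule power_increasing) simp
  also have "\<dots> = mm j" using mm_Suc[of "Suc i"] i by (simp only: add_2_eq_Suc)
  finally show ?thesis by simp
qed

lemma nn_2_pos: "1 \<le> nn 2"
proof -
  have "real (ss 1) = log 2 (2 ^ 15)"
    unfolding real_ss Suc_1 mm_2 by simp
  also have "\<dots> = 15" by (subst log_pow_cancel) auto
  finally have "ss 1 = 15" by simp
  moreover have "nn 2 = 15 * ss 1 * nn 1" by (simp add: numeral_2_eq_2)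
  ultimately show ?thesis by simp
qed

text \<open>Shrinking the sets moves their minima to the right but may permute them. Sending a new
  minimum to the old minimum of the same set is injective by disjointness, and an injection suffices
  for spreading.\<close>

lemma minima_subset_schreier:
  assumes "finite I" "disjoint_family_on E I" "minima I E \<in> schreier n"
    and "\<And>i. i \<in> I \<Longrightarrow> finite (E i)" "\<And>i. i \<in> I \<Longrightarrow> E' i \<subseteq> E i"
  shows "minima I E' \<in> schreier n"
proof -
  define idx where "idx x = (SOME i. i \<in> I \<and> E' i \<noteq> {} \<and> x = Min (E' i))" for x
  have idx: "idx x \<in> I \<and> E' (idx x) \<noteq> {} \<and> x = Min (E' (idx x))" if x: "x \<in> minima I E'" for x
  proof -
    have "\<exists>i. i \<in> I \<and> E' i \<noteq> {} \<and> x = Min (E' i)" using x by (auto simp: minima_def)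
    then show ?thesis unfolding idx_def by (rule someI_ex)
  qed
  have mem: "x \<in> E (idx x)" "Min (E (idx x)) \<in> E (idx x)" "Min (E (idx x)) \<le> x"
    "Min (E (idx x)) \<in> minima I E"
    if x: "x \<in> minima I E'" for x
  proof -
    have i: "idx x \<in> I" "E' (idx x) \<noteq> {}" "x = Min (E' (idx x))" using idx[OF x] by auto
    have f: "finite (E (idx x))" "E' (idx x) \<subseteq> E (idx x)" using assms(4,5) i by auto
    then have "x \<in> E' (idx x)" using i Min_in finite_subset by metis
    then show "x \<in> E (idx x)" using f by auto
    then show "Min (E (idx x)) \<in> E (idx x)" "Min (E (idx x)) \<le> x"
      using f by (auto intro: Min_in)
    show "Min (E (idx x)) \<in> minima I E" using i \<open>x \<in> E (idx x)\<close> by (auto simp: minima_def)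
  qed
  show ?thesis
  proof (rule schreier_spread[OF assms(3), of _ "\<lambda>x. Min (E (idx x))"])
    have "minima I E' \<subseteq> (\<lambda>i. Min (E' i)) ` I" by (auto simp: minima_def)
    then show "finite (minima I E')" using assms(1) by (meson finite_imageI finite_subset)
    show "inj_on (\<lambda>x. Min (E (idx x))) (minima I E')"
    proof (rule inj_onI)
      fix x y assume xy: "x \<in> minima I E'" "y \<in> minima I E'" "Min (E (idx x)) = Min (E (idx y))"
      then have "E (idx x) \<inter> E (idx y) \<noteq> {}" using mem(2) by (metis disjoint_iff)
      then have "idx x = idx y"
        using assms(2) idx[OF xy(1)] idx[OF xy(2)] by (auto simp: disjoint_family_on_def)
      then show "x = y" using idx[OF xy(1)] idx[OF xy(2)] by simp
    qed
  qed (use mem in auto)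
qed

text \<open>A nonempty sum of disjointly supported nonzero elements is nonzero, so zero has to come
  from a dependent sequence, here one with a single zero term. Its first weight must have an index
  in \<open>L\<^sub>1\<close> and exceed a given number, which is where infinity of
  \<open>L\<^sub>1\<close> enters.\<close>

lemma zero_in_norming_set:
  assumes "infinite L\<^sub>1"
  shows "(\<lambda>_. 0) \<in> norming_set L\<^sub>1 \<rho> \<sigma>"
proof -
  obtain w where w: "w \<in> L\<^sub>1" "nn (2 * 1 + 1) < w"
    using assms by (meson infinite_nat_iff_unbounded)
  then have w': "nn (2 * 1 + 1) < mm (2 * w)" using le_mm[of "2 * w"] by linarith
  have int1: "interval {1::nat}" unfolding interval_def by (intro exI[of _ 1]) auto
  have "dependent_seq L\<^sub>1 \<rho> \<sigma> (norming_set L\<^sub>1 \<rho> \<sigma>) 1 1 (\<lambda>_ _. 0)"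
    unfolding dependent_seq_def
    using w w' int1 empty_schreier
    \<comment> \<open>The constant family \<open>{1}\<close> is used for \<open>K\<close>,
      \<open>A\<close> and \<open>E\<close> alike.\<close>
    by (intro conjI exI[of _ "\<lambda>_. w"] exI[of _ "\<lambda>_. {1}"] exI[of _ "\<lambda>_ _ _. 0"])
      (auto simp: admissible_def successive_def supp_def minima_def subseq_at_def
        interval_seqs_def is_singleton_def)
  then have "(\<lambda>t. (1 / real (mm (2 * 1 + 1))) * (\<Sum>i=1..1::nat. 0)) \<in> norming_set L\<^sub>1 \<rho> \<sigma>"
    by (intro norming_closedD(6)[OF norming_closed_norming_set]) auto
  then show ?thesis by simp
qed

lemma admissible_restr:
  assumes "finite I" "admissible (schreier n) I (\<lambda>i. supp (f i))" "\<And>i. i \<in> I \<Longrightarrow> f i \<in> c00"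
  shows "admissible (schreier n) I (\<lambda>i. supp (restr E (f i)))"
proof -
  have s: "successive I (\<lambda>i. supp (f i))" and m: "minima I (\<lambda>i. supp (f i)) \<in> schreier n"
    using assms(2) by (auto simp: admissible_def)
  have "minima I (\<lambda>i. supp (restr E (f i))) \<in> schreier n"
    by (rule minima_subset_schreier[OF assms(1) successive_disjoint[OF s] m])
      (use assms(3) in \<open>auto simp: c00_def supp_restr\<close>)
  moreover have "successive I (\<lambda>i. supp (restr E (f i)))"
    using s unfolding successive_def set_less_def supp_restr by blast
  ultimately show ?thesis by (simp add: admissible_def)
qed

lemma dependent_seq_restr:
  assumes "dependent_seq L\<^sub>1 \<rho> \<sigma> V j d f" "V \<subseteq> c00" "\<And>f. f \<in> V \<Longrightarrow> restr E f \<in> W"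
  shows "dependent_seq L\<^sub>1 \<rho> \<sigma> W j d (\<lambda>i. restr E (f i))"
proof -
  have V: "restr E f \<in> insert (\<lambda>_. 0) W" "f \<in> c00" if "f \<in> insert (\<lambda>_. 0) V" for f
    using that assms(2,3) by (auto simp: restr_zero zero_c00)
  obtain w K g A H where *: "\<forall>i\<in>{1..d}. 1 \<le> w i \<and> interval (K i) \<and>
           (\<forall>k\<in>K i. g i k \<in> insert (\<lambda>_. 0) V) \<and>
           admissible (schreier (nn (2 * w i))) (K i) (\<lambda>k. supp (g i k)) \<and>
           f i = (\<lambda>t. (1 / real (mm (2 * w i))) * (\<Sum>k\<in>K i. g i k t))"
     "successive {1..d} K \<and>
        (\<forall>k\<in>(\<Union>i\<in>{1..d}. K i). interval (A k)) \<and> successive (\<Union>i\<in>{1..d}. K i) A \<and>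
        subseq_at H (\<Union>i\<in>{1..d}. \<Union>k\<in>K i. A k) \<in> interval_seqs \<and>
        w 1 \<in> L\<^sub>1 \<and> mm (2 * w 1) > nn (2 * j + 1) \<and>
        (\<forall>i\<in>{1..<d}. 2 * w (i + 1) = \<sigma> (subseq_at H (\<Union>l\<in>{1..i}. \<Union>k\<in>K l. A k)))"
     "\<forall>i\<in>{1..d}. \<forall>k\<in>K i. supp (g i k) \<subseteq> (\<Union>r\<in>A k. H r)"
     "\<forall>i\<in>{1..d}. is_singleton (A (Min (K i))) \<and>
           (\<forall>k\<in>K i. Min (K i) < k \<longrightarrow>
              admissible (schreier (\<rho> (Max (H (Max (A (k - 1))))))) (A k) H)"
    using assms(1) unfolding dependent_seq_def by (elim conjE exE) (rule that; (intro conjI)?; assumption)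
  have a: "1 \<le> d" "\<forall>i\<in>{1..d}. f i \<in> insert (\<lambda>_. 0) V"
    "admissible (schreier (nn (2 * j + 1))) {1..d} (\<lambda>i. supp (f i))"
    using assms(1) unfolding dependent_seq_def by blast+
  have "\<forall>i\<in>{1..d}. 1 \<le> w i \<and> interval (K i) \<and>
           (\<forall>k\<in>K i. restr E (g i k) \<in> insert (\<lambda>_. 0) W) \<and>
           admissible (schreier (nn (2 * w i))) (K i) (\<lambda>k. supp (restr E (g i k))) \<and>
           restr E (f i) = (\<lambda>t. (1 / real (mm (2 * w i))) * (\<Sum>k\<in>K i. restr E (g i k) t))"
  proof (intro ballI conjI)
    fix i assume i: "i \<in> {1..d}"
    note ** = *(1)[rule_format, OF i]
    show "1 \<le> w i" "interval (K i)" using ** by blast+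
    then have "finite (K i)" by (auto simp: interval_def)
    then show "admissible (schreier (nn (2 * w i))) (K i) (\<lambda>k. supp (restr E (g i k)))"
      using ** V(2) by (intro admissible_restr) blast+
    show "restr E (g i k) \<in> insert (\<lambda>_. 0) W" if "k \<in> K i" for k
      using ** V(1) that by blast
    have "f i = (\<lambda>t. (1 / real (mm (2 * w i))) * (\<Sum>k\<in>K i. g i k t))" using ** by blast
    then show "restr E (f i) = (\<lambda>t. (1 / real (mm (2 * w i))) * (\<Sum>k\<in>K i. restr E (g i k) t))"
      by (simp only: restr_sum)
  qed
  moreover have "\<forall>i\<in>{1..d}. \<forall>k\<in>K i. supp (restr E (g i k)) \<subseteq> (\<Union>r\<in>A k. H r)"
    using *(3) unfolding supp_restr by blast
  moreover have "\<forall>i\<in>{1..d}. restr E (f i) \<in> insert (\<lambda>_. 0) W"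
    using a(2) V(1) by blast
  moreover have "admissible (schreier (nn (2 * j + 1))) {1..d} (\<lambda>i. supp (restr E (f i)))"
    using a V(2) by (intro admissible_restr) blast+
  ultimately show ?thesis
    unfolding dependent_seq_def using a(1) *(2,4)
    by (intro conjI exI[of _ w] exI[of _ K] exI[of _ "\<lambda>i k. restr E (g i k)"] exI[of _ A] exI[of _ H])
      blast+
qed

text \<open>Minimality of the norming set is used as an induction principle: the elements all of
  whose restrictions stay inside form a closed set.\<close>

lemma norming_set_restr:
  assumes "infinite L\<^sub>1" "f \<in> norming_set L\<^sub>1 \<rho> \<sigma>"
  shows "restr E f \<in> norming_set L\<^sub>1 \<rho> \<sigma>"
proof -
  let ?W = "norming_set L\<^sub>1 \<rho> \<sigma>"
  define V where "V = {f \<in> ?W. \<forall>E. restr E f \<in> ?W}"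
  note D = norming_closedD[OF norming_closed_norming_set[of L\<^sub>1 \<rho> \<sigma>]]
  note Z = zero_in_norming_set[OF assms(1), of \<rho> \<sigma>]
  have V: "V \<subseteq> ?W" "\<And>f E. f \<in> V \<Longrightarrow> restr E f \<in> ?W" by (auto simp: V_def)
  have "norming_closed L\<^sub>1 \<rho> \<sigma> V"
    unfolding norming_closed_def
  proof (intro conjI allI impI ballI)
    show "V \<subseteq> c00" using V(1) D(1) by blast
    fix n :: nat assume "1 \<le> n"
    note u = D(2,3)[OF \<open>1 \<le> n\<close>]
    have "restr E (unit_vec n) \<in> ?W" for E
    proof (cases "n \<in> E")
      case True
      then have "restr E (unit_vec n) = unit_vec n"
        by (auto simp: restr_def unit_vec_def indicator_def fun_eq_iff)
      then show ?thesis using u by simp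
    next
      case False
      then have "restr E (unit_vec n) = (\<lambda>_. 0)"
        by (auto simp: restr_def unit_vec_def indicator_def fun_eq_iff)
      then show ?thesis using Z by simp
    qed
    then show "unit_vec n \<in> V" using u by (simp add: V_def)
    have "restr E (\<lambda>t. - unit_vec n t) \<in> ?W" for E
    proof (cases "n \<in> E")
      case True
      then have "restr E (\<lambda>t. - unit_vec n t) = (\<lambda>t. - unit_vec n t)"
        by (auto simp: restr_def unit_vec_def indicator_def fun_eq_iff)
      then show ?thesis using u by simp
    next
      case False
      then have "restr E (\<lambda>t. - unit_vec n t) = (\<lambda>_. 0)"
        by (auto simp: restr_def unit_vec_def indicator_def fun_eq_iff)
      then show ?thesis using Z by simp
    qed
    then show "(\<lambda>t. - unit_vec n t) \<in> V" using u by (simp add: V_def)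
  next
    fix f g assume fg: "f \<in> V" "g \<in> c00" "\<forall>t. \<bar>f t\<bar> = \<bar>g t\<bar>"
    then have "g \<in> ?W" using D(4) V(1) by blast
    moreover have "restr E g \<in> ?W" for E
    proof (rule D(4)[OF V(2)[OF fg(1), of E]])
      show "restr E g \<in> c00" using fg(2) by (rule restr_c00)
      show "\<bar>restr E f t\<bar> = \<bar>restr E g t\<bar>" for t using fg(3) by (simp add: restr_def)
    qed
    ultimately show "g \<in> V" by (simp add: V_def)
  next
    fix j k :: nat and f :: "nat \<Rightarrow> nat \<Rightarrow> real"
    assume j: "1 \<le> j" "1 \<le> k" and f: "(\<forall>i\<in>{1..k}. f i \<in> V) \<and>
      allowable (schreier (nn (2 * j))) {1..k} (\<lambda>i. supp (f i))"
    have "(\<lambda>t. 1 / real (mm (2 * j)) * (\<Sum>i = 1..k. f i t)) \<in> ?W"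
      using f V(1) by (intro D(5)[OF j]) auto
    moreover have "restr E (\<lambda>t. 1 / real (mm (2 * j)) * (\<Sum>i = 1..k. f i t)) \<in> ?W" for E
      unfolding restr_sum
    proof (rule D(5)[OF j])
      show "restr E (f i) \<in> ?W" if "i \<in> {1..k}" for i using f V(2) that by blast
      have "minima {1..k} (\<lambda>i. supp (restr E (f i))) \<in> schreier (nn (2 * j))"
      proof (rule minima_subset_schreier[of _ "\<lambda>i. supp (f i)"])
        show "finite (supp (f i))" if "i \<in> {1..k}" for i
          using f V(1) D(1) that unfolding c00_def by blast
      qed (use f in \<open>simp_all add: supp_restr allowable_def\<close>)
      moreover have "disjoint_family_on (\<lambda>i. supp (restr E (f i))) {1..k}"
        using f unfolding supp_restr allowable_def disjoint_family_on_def by blast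
      ultimately show "allowable (schreier (nn (2 * j))) {1..k} (\<lambda>i. supp (restr E (f i)))"
        by (simp add: allowable_def)
    qed
    ultimately show "(\<lambda>t. 1 / real (mm (2 * j)) * (\<Sum>i = 1..k. f i t)) \<in> V"
      by (simp add: V_def)
  next
    fix j d :: nat and f
    assume j: "1 \<le> j" and f: "dependent_seq L\<^sub>1 \<rho> \<sigma> V j d f"
    have "(\<lambda>t. 1 / real (mm (2 * j + 1)) * (\<Sum>i = 1..d. f i t)) \<in> ?W"
      by (rule D(6)[OF j dependent_seq_mono[OF f V(1)]])
    moreover have "restr E (\<lambda>t. 1 / real (mm (2 * j + 1)) * (\<Sum>i = 1..d. f i t)) \<in> ?W" for E
      unfolding restr_sum
      by (rule D(6)[OF j dependent_seq_restr[OF f]]) (use V D(1) in auto)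
    ultimately show "(\<lambda>t. 1 / real (mm (2 * j + 1)) * (\<Sum>i = 1..d. f i t)) \<in> V"
      by (simp add: V_def)
  qed
  then have "f \<in> V" using norming_set_least assms(2) by blast
  then show ?thesis using V(2) by blast
qed

text \<open>Induction by minimality again. A dependent sequence is forgotten down to an allowable
  one, which merges the even and odd weights into a single index \<open>j\<close>; the smallest
  index that occurs is 2.\<close>

lemma norming_set_decomposition:
  assumes "infinite L\<^sub>1" "f \<in> norming_set L\<^sub>1 \<rho> \<sigma>"
  shows "(\<exists>n. supp f \<subseteq> {n}) \<or>
    (\<exists>j\<ge>2. \<exists>k fs. (\<forall>i\<in>{1..k}. fs i \<in> norming_set L\<^sub>1 \<rho> \<sigma>) \<and>
       allowable (schreier (nn j)) {1..k} (\<lambda>i. supp (fs i)) \<and>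
       f = (\<lambda>t. 1 / real (mm j) * (\<Sum>i=1..k. fs i t)))"
    (is "?P f")
proof -
  let ?W = "norming_set L\<^sub>1 \<rho> \<sigma>"
  define V where "V = {f \<in> ?W. ?P f}"
  note D = norming_closedD[OF norming_closed_norming_set[of L\<^sub>1 \<rho> \<sigma>]]
  note Z = zero_in_norming_set[OF assms(1), of \<rho> \<sigma>]
  have V: "V \<subseteq> ?W" by (auto simp: V_def)
  have "norming_closed L\<^sub>1 \<rho> \<sigma> V"
    unfolding norming_closed_def
  proof (intro conjI allI impI ballI)
    show "V \<subseteq> c00" using V(1) D(1) by blast
    fix n :: nat assume "1 \<le> n"
    have "supp (unit_vec n) \<subseteq> {n}" "supp (\<lambda>t. - unit_vec n t) \<subseteq> {n}"
      by (auto simp: supp_def unit_vec_def indicator_def)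
    then show "unit_vec n \<in> V" "(\<lambda>t. - unit_vec n t) \<in> V"
      using D(2,3)[OF \<open>1 \<le> n\<close>] unfolding V_def by blast+
  next
    fix f g assume fg: "f \<in> V" "g \<in> c00" "\<forall>t. \<bar>f t\<bar> = \<bar>g t\<bar>"
    then have gW: "g \<in> ?W" using D(4) V(1) by blast
    have supp: "supp g = supp f" using fg(3) unfolding supp_def by (metis abs_eq_0)
    have "?P f" using fg(1) by (simp add: V_def)
    then have "?P g"
    proof (elim disjE exE conjE)
      fix n assume "supp f \<subseteq> {n}"
      then show "?P g" using supp by blast
    next
      fix j k fs assume j: "2 \<le> j" and fs: "\<forall>i\<in>{1..k}. fs i \<in> ?W"
        "allowable (schreier (nn j)) {1..k} (\<lambda>i. supp (fs i))"
        "f = (\<lambda>t. 1 / real (mm j) * (\<Sum>i=1..k. fs i t))"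
      \<comment> \<open>Multiplying every piece by the common sign pattern \<open>s\<close> turns a
        decomposition of \<open>f\<close> into one of \<open>g\<close> without changing
        supports.\<close>
      define s where "s t = (if f t = g t then 1 else -1 :: real)" for t
      have gs: "g t = s t * f t" for t
        using fg(3)[rule_format, of t] by (auto simp: s_def)
      define gg where "gg i = (\<lambda>t. s t * fs i t)" for i
      have sg: "supp (gg i) = supp (fs i)" for i by (auto simp: gg_def supp_def s_def)
      have "gg i \<in> ?W" if i: "i \<in> {1..k}" for i
      proof (rule D(4))
        show fi: "fs i \<in> ?W" using fs i by blast
        then have "fs i \<in> c00" using D(1) by blast
        then show "gg i \<in> c00" using sg[of i] by (auto simp: c00_def gg_def)
        show "\<bar>fs i t\<bar> = \<bar>gg i t\<bar>" for t by (simp add: gg_def s_def)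
      qed
      moreover have "g = (\<lambda>t. 1 / real (mm j) * (\<Sum>i=1..k. gg i t))"
      proof
        fix t
        show "g t = 1 / real (mm j) * (\<Sum>i=1..k. gg i t)"
          unfolding gs[of t] fs(3) gg_def by (simp add: sum_distrib_left)
      qed
      ultimately show "?P g" using j fs(2) sg
        by (intro disjI2 exI[of _ j] conjI exI[of _ k] exI[of _ gg]) auto
    qed
    then show "g \<in> V" using gW by (simp add: V_def)
  next
    fix j k :: nat and f :: "nat \<Rightarrow> nat \<Rightarrow> real"
    assume j: "1 \<le> j" "1 \<le> k" and f: "(\<forall>i\<in>{1..k}. f i \<in> V) \<and>
      allowable (schreier (nn (2 * j))) {1..k} (\<lambda>i. supp (f i))"
    have "(\<lambda>t. 1 / real (mm (2 * j)) * (\<Sum>i = 1..k. f i t)) \<in> ?W"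
      using f V(1) by (intro D(5)[OF j]) auto
    moreover have "?P (\<lambda>t. 1 / real (mm (2 * j)) * (\<Sum>i = 1..k. f i t))"
      using j f V by (intro disjI2 exI[of _ "2 * j"] conjI exI[of _ k] exI[of _ f]) auto
    ultimately show "(\<lambda>t. 1 / real (mm (2 * j)) * (\<Sum>i = 1..k. f i t)) \<in> V"
      by (simp add: V_def)
  next
    fix j d :: nat and f
    assume j: "1 \<le> j" and f: "dependent_seq L\<^sub>1 \<rho> \<sigma> V j d f"
    have "(\<lambda>t. 1 / real (mm (2 * j + 1)) * (\<Sum>i = 1..d. f i t)) \<in> ?W"
      by (rule D(6)[OF j dependent_seq_mono[OF f V(1)]])
    moreover have "?P (\<lambda>t. 1 / real (mm (2 * j + 1)) * (\<Sum>i = 1..d. f i t))"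
    proof -
      have "\<forall>i\<in>{1..d}. f i \<in> insert (\<lambda>_. 0) V"
        "admissible (schreier (nn (2 * j + 1))) {1..d} (\<lambda>i. supp (f i))"
        using f unfolding dependent_seq_def by blast+
      \<comment> \<open>The zero terms of a dependent sequence are legitimate pieces because zero
        lies in the norming set.\<close>
      then have "\<forall>i\<in>{1..d}. f i \<in> ?W" "allowable (schreier (nn (2 * j + 1))) {1..d} (\<lambda>i. supp (f i))"
        using V Z by (auto simp: admissible_def allowable_def successive_disjoint)
      then show ?thesis
        using j by (intro disjI2 exI[of _ "2 * j + 1"] conjI exI[of _ d] exI[of _ f]) auto
    qed
    ultimately show "(\<lambda>t. 1 / real (mm (2 * j + 1)) * (\<Sum>i = 1..d. f i t)) \<in> V"
      by (simp add: V_def)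
  qed
  then have "f \<in> V" using norming_set_least assms(2) by blast
  then show ?thesis unfolding V_def by blast
qed

text \<open>The interface between the construction and the analysis. The constant 32 is
  \<open>mm 2\<close>. The average of \<open>k\<close> pieces supported after \<open>k\<close> is
  allowable because their minima form a set of the first Schreier family, which is contained in the
  family of index \<open>nn 2\<close>.\<close>

locale modified_norming_set =
  fixes W :: "(nat \<Rightarrow> real) set"
  assumes W_c00: "W \<subseteq> c00"
    and W_bounded: "f \<in> W \<Longrightarrow> \<bar>f t\<bar> \<le> 1"
    and W_unit: "1 \<le> n \<Longrightarrow> unit_vec n \<in> W"
    and W_solid: "f \<in> W \<Longrightarrow> (\<And>t. g t = 0 \<or> \<bar>g t\<bar> = \<bar>f t\<bar>) \<Longrightarrow> g \<in> W"
    and W_average_nat: "(\<And>i. i \<in> {1..k} \<Longrightarrow> h i \<in> W) \<Longrightarrow>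
      disjoint_family_on (\<lambda>i. supp (h i)) {1..k} \<Longrightarrow> (\<And>i. i \<in> {1..k} \<Longrightarrow> supp (h i) \<subseteq> {k..}) \<Longrightarrow>
      (\<lambda>t. 1 / 32 * (\<Sum>i=1..k. h i t)) \<in> W"
    and W_decomposition: "f \<in> W \<Longrightarrow> (\<exists>n. supp f \<subseteq> {n}) \<or>
      (\<exists>j\<ge>2. \<exists>k fs. (\<forall>i\<in>{1..k}. fs i \<in> W) \<and>
       allowable (schreier (nn j)) {1..k} (\<lambda>i. supp (fs i)) \<and>
       f = (\<lambda>t. 1 / real (mm j) * (\<Sum>i=1..k. fs i t)))"

lemma modified_norming_set_norming_set:
  assumes "infinite L\<^sub>1"
  shows "modified_norming_set (norming_set L\<^sub>1 \<rho> \<sigma>)"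
proof
  let ?W = "norming_set L\<^sub>1 \<rho> \<sigma>"
  note D = norming_closedD[OF norming_closed_norming_set[of L\<^sub>1 \<rho> \<sigma>]]
  show "?W \<subseteq> c00" by (rule D)
  show "\<bar>f t\<bar> \<le> 1" if "f \<in> ?W" for f t
  proof -
    have "f \<in> rational_ball" using norming_set_least[OF norming_closed_rational_ball] that by blast
    then show ?thesis by (simp add: rational_ball_def)
  qed
  show "unit_vec n \<in> ?W" if "1 \<le> n" for n using D(2) that .
  show "g \<in> ?W" if "f \<in> ?W" "\<And>t. g t = 0 \<or> \<bar>g t\<bar> = \<bar>f t\<bar>" for f g
  proof (rule D(4))
    \<comment> \<open>Cutting \<open>f\<close> to the support of \<open>g\<close> reduces the claim
      to a pure change of signs.\<close>
    show r: "restr (supp g) f \<in> ?W" by (rule norming_set_restr[OF assms that(1)])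
    have "f t = 0 \<Longrightarrow> g t = 0" for t using that(2)[of t] by auto
    then have "supp g \<subseteq> supp f" by (auto simp: supp_def)
    moreover have "f \<in> c00" using that(1) D(1) by blast
    ultimately show "g \<in> c00" by (auto simp: c00_def supp_def intro: finite_subset)
    show "\<bar>restr (supp g) f t\<bar> = \<bar>g t\<bar>" for t
      using that(2)[of t] by (auto simp: restr_def supp_def)
  qed
  show "(\<lambda>t. 1 / 32 * (\<Sum>i=1..k. h i t)) \<in> ?W"
    if h: "\<And>i. i \<in> {1..k} \<Longrightarrow> h i \<in> ?W" "disjoint_family_on (\<lambda>i. supp (h i)) {1..k}"
       "\<And>i. i \<in> {1..k} \<Longrightarrow> supp (h i) \<subseteq> {k..}" for k h
  proof (cases "k = 0")
    case True
    then show ?thesis using zero_in_norming_set[OF assms] by simp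
  next
    case False
    have "(\<lambda>t. (1 / real (mm (2 * 1))) * (\<Sum>i=1..k. h i t)) \<in> ?W"
    proof (rule D(5))
      let ?M = "minima {1..k} (\<lambda>i. supp (h i))"
      have sub: "?M \<subseteq> (\<lambda>i. Min (supp (h i))) ` {1..k}" by (auto simp: minima_def)
      have c: "h i \<in> c00" if "i \<in> {1..k}" for i using h(1) that D(1) by blast
      have mem: "\<exists>i\<in>{1..k}. a \<in> supp (h i)" if a: "a \<in> ?M" for a
      proof -
        obtain i where "i \<in> {1..k}" "supp (h i) \<noteq> {}" "a = Min (supp (h i))"
          using a unfolding minima_def by blast
        moreover then have "Min (supp (h i)) \<in> supp (h i)" using c by (intro Min_in) (auto simp: c00_def)
        ultimately show ?thesis by blast
      qed
      have fin: "finite ?M" using sub by (rule finite_subset) simp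
      have "card ?M \<le> card ((\<lambda>i. Min (supp (h i))) ` {1..k})" using sub by (intro card_mono) auto
      also have "\<dots> \<le> k" using card_image_le[of "{1..k}"] by fastforce
      finally have "card ?M \<le> k" .
      moreover have "k \<le> a" if "a \<in> ?M" for a using mem[OF that] h(3) by fastforce
      ultimately have "?M \<in> schreier (nn (2 * 1))"
        using False nn_2_pos fin by (intro small_set_schreier) force+
      then show "allowable (schreier (nn (2 * 1))) {1..k} (\<lambda>i. supp (h i))"
        using h(2) by (simp add: allowable_def)
    qed (use False h in auto)
    then show ?thesis by (simp add: mm_2)
  qed
  show "(\<exists>n. supp f \<subseteq> {n}) \<or>
      (\<exists>j\<ge>2. \<exists>k fs. (\<forall>i\<in>{1..k}. fs i \<in> ?W) \<and>
       allowable (schreier (nn j)) {1..k} (\<lambda>i. supp (fs i)) \<and>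
       f = (\<lambda>t. 1 / real (mm j) * (\<Sum>i=1..k. fs i t)))" if "f \<in> ?W" for f
    using norming_set_decomposition[OF assms that] .
qed

section \<open>The norm\<close>

lemma c00_subset: "x \<in> c00 \<Longrightarrow> supp y \<subseteq> supp x \<Longrightarrow> y \<in> c00"
  unfolding c00_def by (auto simp: supp_def intro: finite_subset)

lemma c00_finite_supp: "x \<in> c00 \<Longrightarrow> finite (supp x)"
  by (simp add: c00_def)

lemma c00_sum:
  assumes "finite I" "\<And>i. i \<in> I \<Longrightarrow> x i \<in> c00"
  shows "(\<lambda>t. \<Sum>i\<in>I. x i t) \<in> c00"
proof -
  have "supp (\<lambda>t. \<Sum>i\<in>I. x i t) \<subseteq> (\<Union>i\<in>I. supp (x i))"
    by (auto simp: supp_def intro: ccontr sum.neutral)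
  moreover have "finite (\<Union>i\<in>I. supp (x i))" using assms by (auto simp: c00_def)
  moreover have "(\<Sum>i\<in>I. x i 0) = 0" using assms by (intro sum.neutral) (simp add: c00_def)
  ultimately show ?thesis unfolding c00_def using finite_subset by blast
qed

lemma c00_add: "x \<in> c00 \<Longrightarrow> y \<in> c00 \<Longrightarrow> (\<lambda>t. x t + y t) \<in> c00"
proof -
  assume "x \<in> c00" "y \<in> c00"
  moreover have "supp (\<lambda>t. x t + y t) \<subseteq> supp x \<union> supp y" by (auto simp: supp_def)
  ultimately show ?thesis unfolding c00_def by (auto intro: finite_subset)
qed

lemma c00_scale: "x \<in> c00 \<Longrightarrow> (\<lambda>t. c * x t) \<in> c00"
  by (erule c00_subset) (auto simp: supp_def)

lemma c00_abs: "x \<in> c00 \<Longrightarrow> (\<lambda>t. \<bar>x t\<bar>) \<in> c00"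
  by (erule c00_subset) (auto simp: supp_def)

lemma c00_lin_comb: "finite I \<Longrightarrow> (\<And>i. i \<in> I \<Longrightarrow> x i \<in> c00) \<Longrightarrow> (\<lambda>t. \<Sum>i\<in>I. c i * x i t) \<in> c00"
  by (intro c00_sum c00_scale)

lemma supp_disjoint_sum:
  fixes f :: "nat \<Rightarrow> nat \<Rightarrow> real"
  assumes "finite I" "disjoint_family_on (\<lambda>i. supp (f i)) I" "c \<noteq> 0"
  shows "supp (\<lambda>t. c * (\<Sum>i\<in>I. f i t)) = (\<Union>i\<in>I. supp (f i))"
proof (intro equalityI subsetI)
  fix t assume "t \<in> supp (\<lambda>t. c * (\<Sum>i\<in>I. f i t))"
  then have "(\<Sum>i\<in>I. f i t) \<noteq> 0" by (simp add: supp_def)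
  then obtain i where "i \<in> I" "f i t \<noteq> 0" by (rule sum.not_neutral_contains_not_neutral)
  then show "t \<in> (\<Union>i\<in>I. supp (f i))" by (auto simp: supp_def)
next
  fix t assume "t \<in> (\<Union>i\<in>I. supp (f i))"
  then obtain i where i: "i \<in> I" "t \<in> supp (f i)" by blast
  have "f i' t = 0" if "i' \<in> I - {i}" for i'
  proof -
    have "supp (f i') \<inter> supp (f i) = {}"
      using assms(2) i(1) that unfolding disjoint_family_on_def by blast
    then show ?thesis using i(2) unfolding supp_def by blast
  qed
  then have "(\<Sum>i\<in>I. f i t) = f i t"
    using i(1) assms(1) by (subst sum.remove[of _ i]) simp_all
  then show "t \<in> supp (\<lambda>t. c * (\<Sum>i\<in>I. f i t))" using i(2) assms(3) by (simp add: supp_def)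
qed

lemma pairing_superset:
  assumes "finite A" "supp x \<subseteq> A"
  shows "pairing f x = (\<Sum>t\<in>A. f t * x t)"
  unfolding pairing_def using assms by (intro sum.mono_neutral_left) (auto simp: supp_def)

lemma pairing_add:
  assumes "x \<in> c00" "y \<in> c00"
  shows "pairing f (\<lambda>t. x t + y t) = pairing f x + pairing f y"
proof -
  let ?A = "supp x \<union> supp y"
  have "finite ?A" using assms by (simp add: c00_def)
  moreover have "supp (\<lambda>t. x t + y t) \<subseteq> ?A" by (auto simp: supp_def)
  ultimately show ?thesis
    by (simp add: pairing_superset[of ?A] distrib_left sum.distrib)
qed

lemma pairing_scale:
  assumes "x \<in> c00"
  shows "pairing f (\<lambda>t. c * x t) = c * pairing f x"
proof -
  have "supp (\<lambda>t. c * x t) \<subseteq> supp x" by (auto simp: supp_def)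
  then show ?thesis
    using c00_finite_supp[OF assms]
    by (simp add: pairing_superset[of "supp x"] sum_distrib_left mult.left_commute)
qed

lemma pairing_sum_right:
  assumes "finite I" "\<And>i. i \<in> I \<Longrightarrow> x i \<in> c00"
  shows "pairing f (\<lambda>t. \<Sum>i\<in>I. x i t) = (\<Sum>i\<in>I. pairing f (x i))"
  using assms
proof (induction I rule: finite_induct)
  case empty
  then show ?case by (simp add: pairing_def)
next
  case (insert i I)
  then have "pairing f (\<lambda>t. x i t + (\<Sum>i\<in>I. x i t)) = pairing f (x i) + pairing f (\<lambda>t. \<Sum>i\<in>I. x i t)"
    by (intro pairing_add c00_sum) auto
  then show ?case using insert by simp
qed

lemma pairing_scaled_sum_left: "pairing (\<lambda>t. c * (\<Sum>i\<in>I. f i t)) x = c * (\<Sum>i\<in>I. pairing (f i) x)"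
proof -
  have "pairing (\<lambda>t. c * (\<Sum>i\<in>I. f i t)) x = (\<Sum>t\<in>supp x. \<Sum>i\<in>I. c * (f i t * x t))"
    by (simp add: pairing_def sum_distrib_left sum_distrib_right mult.assoc)
  also have "\<dots> = (\<Sum>i\<in>I. \<Sum>t\<in>supp x. c * (f i t * x t))" by (rule sum.swap)
  finally show ?thesis by (simp add: pairing_def sum_distrib_left)
qed

section \<open>The norm as a lattice norm\<close>

context modified_norming_set
begin

abbreviation N :: "(nat \<Rightarrow> real) \<Rightarrow> real" where "N \<equiv> norm_W W"

lemma zero_W: "(\<lambda>_. 0) \<in> W"
  by (rule W_solid[OF W_unit[of 1]]) auto

lemma pairing_bound:
  assumes "f \<in> W"
  shows "\<bar>pairing f x\<bar> \<le> (\<Sum>t\<in>supp x. \<bar>x t\<bar>)"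
proof -
  have "\<bar>pairing f x\<bar> \<le> (\<Sum>t\<in>supp x. \<bar>f t * x t\<bar>)" unfolding pairing_def by (rule sum_abs)
  also have "\<dots> \<le> (\<Sum>t\<in>supp x. \<bar>x t\<bar>)"
  proof (rule sum_mono)
    fix t
    show "\<bar>f t * x t\<bar> \<le> \<bar>x t\<bar>"
      using mult_right_mono[OF W_bounded[OF assms, of t], of "\<bar>x t\<bar>"] by (simp add: abs_mult)
  qed
  finally show ?thesis .
qed

lemma pairing_le_N: "f \<in> W \<Longrightarrow> \<bar>pairing f x\<bar> \<le> N x"
  unfolding norm_W_def
  by (rule cSUP_upper) (auto intro!: bdd_aboveI2 pairing_bound)

lemma N_le:
  assumes "\<And>f. f \<in> W \<Longrightarrow> \<bar>pairing f x\<bar> \<le> C"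
  shows "N x \<le> C"
  unfolding norm_W_def using zero_W assms by (intro cSUP_least) auto

lemma N_nonneg: "0 \<le> N x"
  using pairing_le_N[OF zero_W, of x] by linarith

lemma N_le_sum: "finite A \<Longrightarrow> supp x \<subseteq> A \<Longrightarrow> N x \<le> (\<Sum>t\<in>A. \<bar>x t\<bar>)"
  by (rule order_trans[OF N_le[OF pairing_bound] sum_mono2]) auto

lemma pairing_abs_W:
  assumes "f \<in> W"
  obtains g where "g \<in> W" "\<And>t. 0 \<le> g t" "\<bar>pairing f x\<bar> \<le> pairing g (\<lambda>t. \<bar>x t\<bar>)"
proof -
  have "\<bar>pairing f x\<bar> \<le> (\<Sum>t\<in>supp x. \<bar>f t * x t\<bar>)" unfolding pairing_def by (rule sum_abs)
  also have "\<dots> = pairing (\<lambda>t. \<bar>f t\<bar>) (\<lambda>t. \<bar>x t\<bar>)"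
    by (simp add: pairing_def supp_def abs_mult)
  finally show ?thesis using W_solid[OF assms, of "\<lambda>t. \<bar>f t\<bar>"] by (intro that[of "\<lambda>t. \<bar>f t\<bar>"]) auto
qed

lemma pairing_abs_le_N:
  assumes "g \<in> W" "\<And>t. 0 \<le> g t"
  shows "pairing g (\<lambda>t. \<bar>x t\<bar>) \<le> N x"
proof -
  define f where "f t = (if 0 \<le> x t then g t else - g t)" for t
  have "f \<in> W" by (rule W_solid[OF assms(1)]) (auto simp: f_def)
  then have "\<bar>pairing f x\<bar> \<le> N x" by (rule pairing_le_N)
  moreover have "pairing g (\<lambda>t. \<bar>x t\<bar>) = pairing f x"
    by (auto simp: pairing_def supp_def f_def intro: sum.cong)
  ultimately show ?thesis by simp
qed

lemma N_attained:
  assumes "0 < \<epsilon>"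
  obtains g where "g \<in> W" "\<And>t. 0 \<le> g t" "N x - \<epsilon> < pairing g (\<lambda>t. \<bar>x t\<bar>)"
proof -
  have "\<exists>f\<in>W. N x - \<epsilon> < \<bar>pairing f x\<bar>"
  proof (rule ccontr)
    assume "\<not> (\<exists>f\<in>W. N x - \<epsilon> < \<bar>pairing f x\<bar>)"
    then have "N x \<le> N x - \<epsilon>" by (intro N_le) (auto simp: not_less)
    then show False using assms by simp
  qed
  then obtain f where f: "f \<in> W" "N x - \<epsilon> < \<bar>pairing f x\<bar>" by blast
  obtain g where "g \<in> W" "\<And>t. 0 \<le> g t" "\<bar>pairing f x\<bar> \<le> pairing g (\<lambda>t. \<bar>x t\<bar>)"
    using pairing_abs_W[OF f(1)] by blast
  then show ?thesis using f(2) by (intro that[of g]) auto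
qed

text \<open>By solidity the norm is computed by nonnegative functionals acting on the modulus, so it
  is monotone in the modulus. All unconditionality used later is contained here.\<close>

lemma N_mono:
  assumes "y \<in> c00" "\<And>t. \<bar>x t\<bar> \<le> \<bar>y t\<bar>"
  shows "N x \<le> N y"
proof (rule N_le)
  fix f assume "f \<in> W"
  obtain g where g: "g \<in> W" "\<And>t. 0 \<le> g t" "\<bar>pairing f x\<bar> \<le> pairing g (\<lambda>t. \<bar>x t\<bar>)"
    using pairing_abs_W[OF \<open>f \<in> W\<close>] by blast
  have "x t \<noteq> 0 \<Longrightarrow> y t \<noteq> 0" for t using assms(2)[of t] by auto
  then have s: "supp (\<lambda>t. \<bar>x t\<bar>) \<subseteq> supp y" "supp (\<lambda>t. \<bar>y t\<bar>) \<subseteq> supp y" by (auto simp: supp_def)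
  have "pairing g (\<lambda>t. \<bar>x t\<bar>) = (\<Sum>t\<in>supp y. g t * \<bar>x t\<bar>)"
    using c00_finite_supp[OF assms(1)] s(1) by (rule pairing_superset)
  also have "\<dots> \<le> (\<Sum>t\<in>supp y. g t * \<bar>y t\<bar>)"
    using assms(2) g(2) by (intro sum_mono mult_left_mono)
  also have "\<dots> = pairing g (\<lambda>t. \<bar>y t\<bar>)"
    using c00_finite_supp[OF assms(1)] s(2) by (rule pairing_superset[symmetric])
  also have "\<dots> \<le> N y" using g(1,2) by (rule pairing_abs_le_N)
  finally show "\<bar>pairing f x\<bar> \<le> N y" using g(3) by simp
qed

lemma N_add:
  assumes "x \<in> c00" "y \<in> c00"
  shows "N (\<lambda>t. x t + y t) \<le> N x + N y"
proof (rule N_le)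
  fix f assume "f \<in> W"
  then have "\<bar>pairing f x\<bar> \<le> N x" "\<bar>pairing f y\<bar> \<le> N y" by (auto intro: pairing_le_N)
  then show "\<bar>pairing f (\<lambda>t. x t + y t)\<bar> \<le> N x + N y"
    unfolding pairing_add[OF assms] by linarith
qed

lemma N_zero: "N (\<lambda>_. 0) = 0"
  using N_le_sum[of "{}" "\<lambda>_. 0"] N_nonneg[of "\<lambda>_. 0"] by (simp add: supp_def)

lemma N_scale:
  assumes "x \<in> c00"
  shows "N (\<lambda>t. c * x t) = \<bar>c\<bar> * N x"
proof -
  have le: "N (\<lambda>t. c * x t) \<le> \<bar>c\<bar> * N x" if "x \<in> c00" for x c
  proof (rule N_le)
    fix f assume "f \<in> W"
    then show "\<bar>pairing f (\<lambda>t. c * x t)\<bar> \<le> \<bar>c\<bar> * N x"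
      unfolding pairing_scale[OF that] abs_mult by (intro mult_left_mono pairing_le_N) auto
  qed
  show ?thesis
  proof (cases "c = 0")
    case True
    then show ?thesis by (simp add: N_zero)
  next
    case False
    have "N x \<le> \<bar>inverse c\<bar> * N (\<lambda>t. c * x t)"
      using le[OF c00_scale[OF assms, of c], of "inverse c"] False by (simp add: mult.assoc[symmetric])
    then have "\<bar>c\<bar> * N x \<le> N (\<lambda>t. c * x t)" using False by (simp add: field_simps)
    then show ?thesis using le[OF assms, of c] by simp
  qed
qed

lemma N_sum:
  assumes "finite I" "\<And>i. i \<in> I \<Longrightarrow> x i \<in> c00"
  shows "N (\<lambda>t. \<Sum>i\<in>I. x i t) \<le> (\<Sum>i\<in>I. N (x i))"
proof (rule N_le)
  fix f assume f: "f \<in> W"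
  have "\<bar>\<Sum>i\<in>I. pairing f (x i)\<bar> \<le> (\<Sum>i\<in>I. N (x i))"
    using f by (intro order_trans[OF sum_abs] sum_mono pairing_le_N)
  then show "\<bar>pairing f (\<lambda>t. \<Sum>i\<in>I. x i t)\<bar> \<le> (\<Sum>i\<in>I. N (x i))"
    using pairing_sum_right[OF assms, where f = f] by simp
qed

lemma N_lin_comb:
  assumes "finite I" "\<And>i. i \<in> I \<Longrightarrow> x i \<in> c00"
  shows "N (\<lambda>t. \<Sum>i\<in>I. c i * x i t) \<le> (\<Sum>i\<in>I. \<bar>c i\<bar> * N (x i))"
  using N_sum[of I "\<lambda>i t. c i * x i t"] assms by (simp add: c00_scale N_scale)

lemma abs_le_N:
  assumes "x \<in> c00"
  shows "\<bar>x t\<bar> \<le> N x"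
proof (cases "x t = 0")
  case True
  then show ?thesis using N_nonneg by simp
next
  case False
  then have "1 \<le> t" using assms by (cases t) (auto simp: c00_def)
  have "pairing (unit_vec t) x = (\<Sum>i\<in>supp x. if i = t then x i else 0)"
    by (auto simp: pairing_def unit_vec_def indicator_def intro: sum.cong)
  also have "\<dots> = x t"
    using False c00_finite_supp[OF assms] by (simp add: supp_def)
  finally show ?thesis using pairing_le_N[OF W_unit[OF \<open>1 \<le> t\<close>], of x] by simp
qed

lemma W_average:
  assumes "finite R" "\<And>r. r \<in> R \<Longrightarrow> h r \<in> W" "disjoint_family_on (\<lambda>r. supp (h r)) R"
    "\<And>r. r \<in> R \<Longrightarrow> supp (h r) \<subseteq> {q..}" "card R \<le> q"
  shows "(\<lambda>t. 1 / 32 * (\<Sum>r\<in>R. h r t)) \<in> W"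
proof -
  obtain b where b: "bij_betw b {1..card R} R"
    using ex_bij_betw_nat_finite_1[OF assms(1)] by blast
  have mem: "b i \<in> R" if "i \<in> {1..card R}" for i using b that by (auto simp: bij_betw_def)
  have "(\<lambda>t. 1 / 32 * (\<Sum>i=1..card R. h (b i) t)) \<in> W"
  proof (rule W_average_nat)
    show "h (b i) \<in> W" "supp (h (b i)) \<subseteq> {card R..}" if "i \<in> {1..card R}" for i
      using assms(2,4)[OF mem[OF that]] assms(5) by auto
    show "disjoint_family_on (\<lambda>i. supp (h (b i))) {1..card R}"
      unfolding disjoint_family_on_def
    proof (intro ballI impI)
      fix i j assume ij: "i \<in> {1..card R}" "j \<in> {1..card R}" "i \<noteq> j"
      then have "b i \<noteq> b j"
        using inj_on_eq_iff[OF bij_betw_imp_inj_on[OF b]] by simp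
      then show "supp (h (b i)) \<inter> supp (h (b j)) = {}"
        using assms(3) mem ij unfolding disjoint_family_on_def by blast
    qed
  qed
  moreover have "(\<Sum>i=1..card R. h (b i) t) = (\<Sum>r\<in>R. h r t)" for t
    using b by (rule sum.reindex_bij_betw)
  ultimately show ?thesis by simp
qed

text \<open>The pointwise maximum of few positive functionals, being a sum of disjointly supported
  pieces, has norm at most 32.\<close>

lemma N_concave:
  assumes R: "finite R" "card R \<le> q"
    and x: "\<And>r. r \<in> R \<Longrightarrow> x r \<in> c00" "\<And>r. r \<in> R \<Longrightarrow> supp (x r) \<subseteq> {q..}"
  shows "(\<Sum>r\<in>R. N (x r)) \<le> 32 * N (\<lambda>t. \<Sum>r\<in>R. \<bar>x r t\<bar>)"
proof (cases "R = {}")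
  case True
  then show ?thesis using N_nonneg by simp
next
  case False
  let ?S = "\<lambda>t. \<Sum>r\<in>R. \<bar>x r t\<bar>"
  have "(\<Sum>r\<in>R. N (x r)) \<le> 32 * N ?S + \<epsilon>" if "0 < \<epsilon>" for \<epsilon>
  proof -
    define \<delta> where "\<delta> = \<epsilon> / card R"
    have "0 < \<delta>" using that False R by (simp add: \<delta>_def card_gt_0_iff)
    then have "\<forall>r. \<exists>g. g \<in> W \<and> (\<forall>t. 0 \<le> g t) \<and> N (x r) - \<delta> < pairing g (\<lambda>t. \<bar>x r t\<bar>)"
      using N_attained by metis
    then obtain g where g: "\<And>r. g r \<in> W" "\<And>r t. 0 \<le> g r t"
      "\<And>r. N (x r) - \<delta> < pairing (g r) (\<lambda>t. \<bar>x r t\<bar>)" by metis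
    have "\<exists>r\<in>R. \<forall>r'\<in>R. g r' t \<le> g r t" for t
    proof -
      have "Max ((\<lambda>r. g r t) ` R) \<in> (\<lambda>r. g r t) ` R" using R False by (intro Max_in) auto
      then obtain r where "r \<in> R" "g r t = Max ((\<lambda>r. g r t) ` R)" by auto
      then show ?thesis using R by (intro bexI[of _ r]) auto
    qed
    then obtain p where p: "\<And>t. p t \<in> R" "\<And>t r. r \<in> R \<Longrightarrow> g r t \<le> g (p t) t" by metis
    \<comment> \<open>On the set where \<open>p\<close> takes the value \<open>r\<close> the
      functional \<open>g r\<close> is a largest one; cutting each \<open>g r\<close> to its set
      makes the supports disjoint.\<close>
    define h where "h r t = (if q \<le> t \<and> p t = r then g r t else 0)" for r t
    let ?F = "\<lambda>t. 1 / 32 * (\<Sum>r\<in>R. h r t)"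
    have F: "?F \<in> W"
    proof (rule W_average[OF R(1) _ _ _ R(2)])
      show "h r \<in> W" for r by (rule W_solid[OF g(1)[of r]]) (auto simp: h_def)
      show "disjoint_family_on (\<lambda>r. supp (h r)) R"
        by (auto simp: disjoint_family_on_def supp_def h_def split: if_splits)
      show "supp (h r) \<subseteq> {q..}" for r by (auto simp: supp_def h_def split: if_splits)
    qed
    have h0: "0 \<le> h r t" for r t using g(2) by (simp add: h_def)
    have Fpos: "0 \<le> ?F t" for t by (simp add: h0 sum_nonneg)
    have Ft: "?F t = 1 / 32 * g (p t) t" if "q \<le> t" for t
      using that p(1)[of t] R by (simp add: h_def sum.delta')
    define A where "A = (\<Union>r\<in>R. supp (x r))"
    have A: "finite A" using R x(1) by (auto simp: A_def c00_def)
    have AS: "supp (\<lambda>t. \<bar>x r t\<bar>) \<subseteq> A" if "r \<in> R" for r using that by (auto simp: A_def supp_def)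
    have ASS: "supp (\<lambda>t. \<bar>?S t\<bar>) \<subseteq> A"
    proof
      fix t assume "t \<in> supp (\<lambda>t. \<bar>?S t\<bar>)"
      then have "?S t \<noteq> 0" by (simp add: supp_def)
      then obtain r where "r \<in> R" "\<bar>x r t\<bar> \<noteq> 0" by (rule sum.not_neutral_contains_not_neutral)
      then show "t \<in> A" by (auto simp: A_def supp_def)
    qed
    have "(\<Sum>r\<in>R. pairing (g r) (\<lambda>t. \<bar>x r t\<bar>)) = (\<Sum>r\<in>R. \<Sum>t\<in>A. g r t * \<bar>x r t\<bar>)"
      by (intro sum.cong refl pairing_superset A AS)
    also have "\<dots> = (\<Sum>t\<in>A. \<Sum>r\<in>R. g r t * \<bar>x r t\<bar>)" by (rule sum.swap)
    also have "\<dots> \<le> (\<Sum>t\<in>A. 32 * (?F t * \<bar>?S t\<bar>))"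
    proof (rule sum_mono)
      fix t assume "t \<in> A"
      then have "q \<le> t" using x(2) by (auto simp: A_def)
      have "(\<Sum>r\<in>R. g r t * \<bar>x r t\<bar>) \<le> (\<Sum>r\<in>R. g (p t) t * \<bar>x r t\<bar>)"
        using p(2) by (intro sum_mono mult_right_mono) auto
      also have "\<dots> = g (p t) t * \<bar>?S t\<bar>" by (simp add: sum_distrib_left sum_nonneg)
      finally show "(\<Sum>r\<in>R. g r t * \<bar>x r t\<bar>) \<le> 32 * (?F t * \<bar>?S t\<bar>)"
        unfolding Ft[OF \<open>q \<le> t\<close>] by simp
    qed
    also have "\<dots> = 32 * pairing ?F (\<lambda>t. \<bar>?S t\<bar>)"
      by (subst pairing_superset[OF A ASS]) (simp only: sum_distrib_left)
    also have "\<dots> \<le> 32 * N ?S"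
      by (rule mult_left_mono[OF pairing_abs_le_N[OF F Fpos]]) simp
    finally have "(\<Sum>r\<in>R. pairing (g r) (\<lambda>t. \<bar>x r t\<bar>)) \<le> 32 * N ?S" .
    moreover have "(\<Sum>r\<in>R. N (x r)) \<le> (\<Sum>r\<in>R. pairing (g r) (\<lambda>t. \<bar>x r t\<bar>) + \<delta>)"
      using g(3) by (intro sum_mono) (smt (verit, best))
    moreover have "(\<Sum>r\<in>R. \<delta>) = \<epsilon>" using False R by (simp add: \<delta>_def)
    ultimately show ?thesis by (simp add: sum.distrib)
  qed
  then show ?thesis by (rule field_le_epsilon)
qed

end

section \<open>Convex combinations of small norm\<close>

lemma sum_UN_bound:
  fixes a :: "'b \<Rightarrow> real"
  assumes "finite B" "finite K" "\<And>s. 0 \<le> a s"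
  shows "(\<Sum>s\<in>{s\<in>B. \<exists>k\<in>K. Q k s}. a s) \<le> (\<Sum>k\<in>K. \<Sum>s\<in>{s\<in>B. Q k s}. a s)"
proof -
  have "(\<Sum>s\<in>{s\<in>B. \<exists>k\<in>K. Q k s}. a s) = (\<Sum>s\<in>B. if \<exists>k\<in>K. Q k s then a s else 0)"
    using assms(1) by (rule sum.inter_filter)
  also have "\<dots> \<le> (\<Sum>s\<in>B. \<Sum>k\<in>K. if Q k s then a s else 0)"
  proof (rule sum_mono)
    fix s assume "s \<in> B"
    show "(if \<exists>k\<in>K. Q k s then a s else 0) \<le> (\<Sum>k\<in>K. if Q k s then a s else 0)"
    proof (cases "\<exists>k\<in>K. Q k s")
      case True
      then obtain k where k: "k \<in> K" "Q k s" by blast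
      have "(if Q k s then a s else 0) \<le> (\<Sum>k\<in>K. if Q k s then a s else 0)"
        using k(1) assms(2,3) by (intro member_le_sum) auto
      then show ?thesis using k by auto
    next
      case False
      then show ?thesis using assms(3) by (simp add: sum_nonneg)
    qed
  qed
  also have "\<dots> = (\<Sum>k\<in>K. \<Sum>s\<in>B. if Q k s then a s else 0)" by (rule sum.swap)
  also have "\<dots> = (\<Sum>k\<in>K. \<Sum>s\<in>{s\<in>B. Q k s}. a s)"
    by (intro sum.cong refl sum.inter_filter[symmetric] assms(1))
  finally show ?thesis .
qed

text \<open>The interval is the range allotted to the block vector with index \<open>s\<close>;
  being half-open, these ranges are disjoint for monotone \<open>p\<close>.\<close>

definition hits :: "(nat \<Rightarrow> nat) \<Rightarrow> nat set \<Rightarrow> nat \<Rightarrow> bool" where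
  "hits p M s \<longleftrightarrow> M \<inter> {p s<..p (Suc s)} \<noteq> {}"

text \<open>Repeated averages. At the next level, \<open>R\<close> successive averages of the
  previous level are averaged again. A set of the next family consists of \<open>k\<close> sets of
  the previous one, with \<open>k\<close> below its minimum: the first average that it meets
  contributes at most \<open>1 / R\<close>, and by then \<open>k\<close> is bounded in terms of
  \<open>p\<close>, so all later averages were built with enough precision to absorb the factor
  \<open>k\<close>.\<close>

lemma schreier_small_average:
  assumes "mono p" "0 < \<epsilon>"
  shows "\<exists>a B. finite B \<and> B \<subseteq> {q..} \<and> (\<forall>s. 0 \<le> a s) \<and> (\<forall>s. s \<notin> B \<longrightarrow> a s = 0) \<and> sum a B = (1::real) \<and>
     (\<forall>M\<in>schreier n. sum a {s\<in>B. hits p M s} \<le> \<epsilon>)"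
  using assms(2)
proof (induction n arbitrary: q \<epsilon>)
  case 0
  obtain R :: nat where R: "1 / \<epsilon> < R" using reals_Archimedean2 by blast
  then have "0 < R" using 0 by (metis divide_pos_pos less_trans of_nat_0_less_iff zero_less_one)
  define B where "B = {q..<q + R}"
  define a where "a s = (if s \<in> B then 1 / real R else 0)" for s
  have small: "sum a {s\<in>B. hits p M s} \<le> \<epsilon>" if M: "M \<in> schreier 0" for M
  proof -
    have "s = s'" if "hits p M s" "hits p M s'" for s s'
    proof (rule ccontr)
      obtain k where k: "M \<subseteq> {k}" using M by auto
      then have k1: "p s < k" "k \<le> p (Suc s)" "p s' < k" "k \<le> p (Suc s')"
        using that by (auto simp: hits_def)
      assume "s \<noteq> s'"
      then have "Suc s \<le> s' \<or> Suc s' \<le> s" by auto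
      then have "p (Suc s) \<le> p s' \<or> p (Suc s') \<le> p s" using assms(1) by (auto simp: mono_def)
      then show False using k1 by auto
    qed
    then have "card {s\<in>B. hits p M s} \<le> 1" by (simp add: card_le_Suc0_iff_eq B_def)
    then have "real (card {s\<in>B. hits p M s}) * (1 / real R) \<le> 1 * (1 / real R)"
      by (intro mult_right_mono) auto
    moreover have "sum a {s\<in>B. hits p M s} = (\<Sum>s\<in>{s\<in>B. hits p M s}. 1 / real R)"
      by (intro sum.cong) (auto simp: a_def)
    moreover have "1 / real R \<le> \<epsilon>" using R 0 \<open>0 < R\<close> by (simp add: field_simps)
    ultimately show ?thesis by simp
  qed
  have "sum a B = (\<Sum>s\<in>B. 1 / real R)" by (intro sum.cong) (auto simp: a_def)
  then have "sum a B = 1" using \<open>0 < R\<close> by (simp add: B_def)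
  then show ?case using small
    by (intro exI[of _ a] exI[of _ B]) (auto simp: a_def B_def)
next
  case (Suc n)
  \<comment> \<open>The precision depends on where the average starts: a set first met by an earlier
    average has at most \<open>p q\<close> pieces.\<close>
  have "\<forall>q. \<exists>a B. finite B \<and> B \<subseteq> {q..} \<and> (\<forall>s. 0 \<le> a s) \<and> (\<forall>s. s \<notin> B \<longrightarrow> a s = 0) \<and> sum a B = (1::real) \<and>
     (\<forall>M\<in>schreier n. sum a {s\<in>B. hits p M s} \<le> \<epsilon> / (2 * (p q + 1)))"
    using Suc.prems by (intro allI Suc.IH) (simp add: add_nonneg_pos)
  then obtain aa BB where A0: "\<forall>q. finite (BB q) \<and> BB q \<subseteq> {q..} \<and> (\<forall>s. 0 \<le> aa q s) \<and>
     (\<forall>s. s \<notin> BB q \<longrightarrow> aa q s = 0) \<and> sum (aa q) (BB q) = (1::real) \<and>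
     (\<forall>M\<in>schreier n. sum (aa q) {s\<in>BB q. hits p M s} \<le> \<epsilon> / (2 * (p q + 1)))"
    unfolding choice_iff by (elim exE) (rule that)
  then have A: "\<And>q. finite (BB q)" "\<And>q. BB q \<subseteq> {q..}" "\<And>q s. 0 \<le> aa q s"
     "\<And>q s. s \<notin> BB q \<Longrightarrow> aa q s = (0::real)" "\<And>q. sum (aa q) (BB q) = 1"
     "\<And>q M. M \<in> schreier n \<Longrightarrow> sum (aa q) {s\<in>BB q. hits p M s} \<le> \<epsilon> / (2 * (p q + 1))"
    by blast+
  \<comment> \<open>The outer \<open>Suc\<close> gives \<open>Suc s \<le> Q (Suc r)\<close> for
    \<open>s\<close> in \<open>BB (Q r)\<close>, so that even the right end \<open>p (Suc s)\<close>
    of the range lies below \<open>p (Q (Suc r))\<close>.\<close>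
  define Q where "Q = rec_nat q (\<lambda>_ q. Suc (Max (insert q (BB q))))"
  have Q0: "Q 0 = q" and QS: "Q (Suc r) = Suc (Max (insert (Q r) (BB (Q r))))" for r
    by (simp_all add: Q_def)
  have Qmono: "Q r \<le> Q r'" if "r \<le> r'" for r r'
  proof (rule lift_Suc_mono_le[OF _ that])
    show "Q i \<le> Q (Suc i)" for i
      unfolding QS by (rule le_SucI, rule Max_ge) (use A(1) in auto)
  qed
  have Qlt: "Suc s \<le> Q (Suc r)" if "s \<in> BB (Q r)" for s r
    unfolding QS by (subst Suc_le_mono, rule Max_ge) (use A(1) that in auto)
  obtain R :: nat where R: "2 / \<epsilon> < R" using reals_Archimedean2 by blast
  then have "0 < R" using Suc.prems by (metis divide_pos_pos less_trans of_nat_0_less_iff zero_less_numeral)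
  define B where "B = (\<Union>r<R. BB (Q r))"
  define a where "a s = 1 / real R * (\<Sum>r<R. aa (Q r) s)" for s
  have fB: "finite B" using A(1) by (simp add: B_def)
  have swap: "sum a {s\<in>B. P s} = 1 / real R * (\<Sum>r<R. sum (aa (Q r)) {s\<in>BB (Q r). P s})" for P
  proof -
    have "sum (aa (Q r)) {s\<in>B. P s} = sum (aa (Q r)) {s\<in>BB (Q r). P s}" if "r < R" for r
      using fB A(4)[of _ "Q r"] that by (intro sum.mono_neutral_right) (auto simp: B_def)
    then have "(\<Sum>r<R. sum (aa (Q r)) {s\<in>B. P s}) = (\<Sum>r<R. sum (aa (Q r)) {s\<in>BB (Q r). P s})"
      by (rule sum.cong[OF refl]) simp
    then show ?thesis
      unfolding a_def sum_distrib_left[symmetric] by (subst sum.swap) simp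
  qed
  have "sum a {s\<in>B. hits p M s} \<le> \<epsilon>" if M: "M \<in> schreier (Suc n)" for M
  proof -
    define T where "T r = sum (aa (Q r)) {s\<in>BB (Q r). hits p M s}" for r
    have T1: "T r \<le> 1" for r
      unfolding T_def A(5)[of "Q r", symmetric] using A(1,3) by (intro sum_mono2) auto
    obtain k F where F: "M = (\<Union>i\<in>{1..k}. F i)" "\<And>i. i \<in> {1..k} \<Longrightarrow> F i \<in> schreier n"
      "\<And>a. a \<in> M \<Longrightarrow> k \<le> a"
      using schreier_SucE[OF M] by metis
    have Tk: "T r \<le> k * (\<epsilon> / (2 * (p (Q r) + 1)))" for r
    proof -
      have "{s\<in>BB (Q r). hits p M s} = {s\<in>BB (Q r). \<exists>i\<in>{1..k}. hits p (F i) s}"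
        unfolding F(1) hits_def by blast
      then have "T r \<le> (\<Sum>i\<in>{1..k}. sum (aa (Q r)) {s\<in>BB (Q r). hits p (F i) s})"
        unfolding T_def using A(1,3) sum_UN_bound[of "BB (Q r)" "{1..k}" "aa (Q r)" "\<lambda>i. hits p (F i)"]
        by simp
      also have "\<dots> \<le> (\<Sum>i\<in>{1..k}. \<epsilon> / (2 * (p (Q r) + 1)))"
        using A(6) F(2) by (intro sum_mono) blast
      finally show ?thesis by simp
    qed
    have "(\<Sum>r<R. T r) \<le> 1 + R * (\<epsilon> / 2)"
    proof (cases "\<exists>r<R. \<exists>s\<in>BB (Q r). hits p M s")
      case False
      then have "(\<Sum>r<R. T r) = 0" unfolding T_def by (intro sum.neutral) (auto intro: sum.neutral)
      then show ?thesis using Suc.prems by simp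
    next
      case True
      \<comment> \<open>The first average that \<open>M\<close> meets. A point of \<open>M\<close>
        in its range bounds the number \<open>k\<close> of pieces.\<close>
      define r0 where "r0 = (LEAST r. r < R \<and> (\<exists>s\<in>BB (Q r). hits p M s))"
      have r0: "r0 < R" "\<exists>s\<in>BB (Q r0). hits p M s"
        using LeastI_ex[OF True] by (auto simp: r0_def)
      obtain s where s: "s \<in> BB (Q r0)" "hits p M s" using r0 by blast
      then obtain t where t: "t \<in> M" "t \<le> p (Suc s)" by (auto simp: hits_def)
      have kp: "k \<le> p (Q (Suc r0))"
        using F(3)[OF t(1)] t(2) monoD[OF assms(1) Qlt[OF s(1)]] by linarith
      have "T r \<le> \<epsilon> / 2 + (if r = r0 then 1 else 0)" if "r < R" for r
      proof -
        consider "r < r0" | "r = r0" | "r0 < r" by linarith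
        then show ?thesis
        proof cases
          case 1
          then have "\<not> (\<exists>s\<in>BB (Q r). hits p M s)"
            using not_less_Least[of r "\<lambda>r. r < R \<and> (\<exists>s\<in>BB (Q r). hits p M s)"] that
            by (auto simp: r0_def)
          then have "T r = 0" unfolding T_def by (intro sum.neutral) blast
          then show ?thesis using Suc.prems by simp
        next
          case 2
          then show ?thesis using T1[of r] Suc.prems by simp
        next
          case 3
          then have "p (Q (Suc r0)) \<le> p (Q r)" by (intro monoD[OF assms(1)] Qmono) simp
          then have "real k \<le> p (Q r) + 1" using kp by simp
          then have "k * (\<epsilon> / (2 * (p (Q r) + 1))) \<le> (p (Q r) + 1) * (\<epsilon> / (2 * (p (Q r) + 1)))"
            using Suc.prems by (intro mult_right_mono) auto
          also have "\<dots> = \<epsilon> / 2" by (simp add: field_simps)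
          finally have "T r \<le> \<epsilon> / 2" by (rule order_trans[OF Tk[of r]])
          then show ?thesis using 3 by simp
        qed
      qed
      then have "(\<Sum>r<R. T r) \<le> (\<Sum>r<R. \<epsilon> / 2 + (if r = r0 then 1 else 0))" by (intro sum_mono) auto
      also have "\<dots> = 1 + R * (\<epsilon> / 2)" using r0(1) by (simp add: sum.distrib)
      finally show ?thesis .
    qed
    then have "sum a {s\<in>B. hits p M s} \<le> 1 / real R * (1 + R * (\<epsilon> / 2))"
      unfolding swap[of "hits p M"] T_def by (intro mult_left_mono) auto
    also have "\<dots> = 1 / real R + \<epsilon> / 2" using \<open>0 < R\<close> by (simp add: field_simps)
    also have "1 / real R \<le> \<epsilon> / 2" using R Suc.prems \<open>0 < R\<close> by (simp add: field_simps)
    finally show ?thesis by simp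
  qed
  moreover have "sum a B = 1"
    using swap[of "\<lambda>_. True"] A(5) \<open>0 < R\<close> by simp
  moreover have "B \<subseteq> {q..}"
  proof
    fix s assume "s \<in> B"
    then obtain r where "s \<in> BB (Q r)" by (auto simp: B_def)
    then have "Q r \<le> s" using A(2) by blast
    then show "s \<in> {q..}" using Qmono[of 0 r] Q0 by simp
  qed
  moreover have "0 \<le> a s" for s using A(3) by (simp add: a_def sum_nonneg)
  moreover have "a s = 0" if "s \<notin> B" for s
    using A(4) that unfolding a_def B_def by (simp add: sum.neutral)
  ultimately show ?case using fB by (intro exI[of _ a] exI[of _ B]) blast
qed

section \<open>Sums over disjoint functionals, and weights\<close>

context modified_norming_set
begin

definition disjoint_bound :: "nat \<Rightarrow> (nat \<Rightarrow> real) \<Rightarrow> real \<Rightarrow> bool" where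
  "disjoint_bound D x \<Gamma> \<longleftrightarrow> (\<forall>h. \<forall>R::nat set. finite R \<and> card R \<le> D \<and> (\<forall>k\<in>R. h k \<in> W) \<and>
     disjoint_family_on (\<lambda>k. supp (h k)) R \<longrightarrow> (\<Sum>k\<in>R. \<bar>pairing (h k) x\<bar>) \<le> \<Gamma>)"

text \<open>The definition has to fix the index type; a bijection frees it, since pairs of indices
  occur when functionals are split.\<close>

lemma disjoint_boundD:
  assumes "disjoint_bound D x \<Gamma>" "finite R" "card R \<le> D" "\<And>k. k \<in> R \<Longrightarrow> h k \<in> W"
    "disjoint_family_on (\<lambda>k. supp (h k)) R"
  shows "(\<Sum>k\<in>R. \<bar>pairing (h k) x\<bar>) \<le> \<Gamma>"
proof -
  obtain b where b: "bij_betw b {1..card R} R"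
    using ex_bij_betw_nat_finite_1[OF assms(2)] by blast
  have mem: "b i \<in> R" if "i \<in> {1..card R}" for i using b that by (auto simp: bij_betw_def)
  have "disjoint_family_on (\<lambda>i. supp (h (b i))) {1..card R}"
    unfolding disjoint_family_on_def
  proof (intro ballI impI)
    fix i j assume ij: "i \<in> {1..card R}" "j \<in> {1..card R}" "i \<noteq> j"
    then have "b i \<noteq> b j"
      using inj_on_eq_iff[OF bij_betw_imp_inj_on[OF b]] by simp
    then show "supp (h (b i)) \<inter> supp (h (b j)) = {}"
      using assms(5) mem ij unfolding disjoint_family_on_def by blast
  qed
  moreover have "\<forall>i\<in>{1..card R}. h (b i) \<in> W" using mem assms(4) by blast
  ultimately have "(\<Sum>i=1..card R. \<bar>pairing (h (b i)) x\<bar>) \<le> \<Gamma>"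
    using assms(1,3) unfolding disjoint_bound_def
    by (elim allE[of _ "\<lambda>i. h (b i)"] allE[of _ "{1..card R}"]) simp
  then show ?thesis using sum.reindex_bij_betw[OF b, of "\<lambda>k. \<bar>pairing (h k) x\<bar>"] by simp
qed

lemma disjoint_bound_mono: "disjoint_bound D x \<Gamma> \<Longrightarrow> \<Gamma> \<le> \<Gamma>' \<Longrightarrow> disjoint_bound D x \<Gamma>'"
  unfolding disjoint_bound_def by (meson order_trans)

text \<open>With signs adjusted and everything before \<open>D\<close> cut off, at most
  \<open>D\<close> disjoint functionals average to an element of \<open>W\<close>. The cut loses
  nothing on a vector supported after \<open>D\<close>.\<close>

lemma disjoint_bound_trivial:
  assumes "x \<in> c00" "supp x \<subseteq> {D..}"
  shows "disjoint_bound D x (32 * N x)"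
  unfolding disjoint_bound_def
proof (intro allI impI, elim conjE)
  fix h and R :: "nat set"
  assume R: "finite R" "card R \<le> D" "\<forall>k\<in>R. h k \<in> W" "disjoint_family_on (\<lambda>k. supp (h k)) R"
  define g where "g k t = (if D \<le> t then sgn (pairing (h k) x) * h k t else 0)" for k t
  have "(\<lambda>t. 1 / 32 * (\<Sum>k\<in>R. g k t)) \<in> W"
  proof (rule W_average[OF R(1) _ _ _ R(2)])
    show "g k \<in> W" if "k \<in> R" for k
      by (rule W_solid[OF R(3)[rule_format, OF that]]) (auto simp: g_def sgn_if)
    have "supp (g k) \<subseteq> supp (h k)" for k by (auto simp: g_def supp_def)
    then show "disjoint_family_on (\<lambda>k. supp (g k)) R"
      using R(4) unfolding disjoint_family_on_def by blast
    show "supp (g k) \<subseteq> {D..}" for k by (auto simp: g_def supp_def)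
  qed
  then have "\<bar>pairing (\<lambda>t. 1 / 32 * (\<Sum>k\<in>R. g k t)) x\<bar> \<le> N x" by (rule pairing_le_N)
  moreover have "pairing (g k) x = \<bar>pairing (h k) x\<bar>" for k
  proof -
    have "pairing (g k) x = (\<Sum>t\<in>supp x. sgn (pairing (h k) x) * (h k t * x t))"
      unfolding pairing_def using assms(2) by (intro sum.cong) (auto simp: g_def pairing_def)
    also have "\<dots> = sgn (pairing (h k) x) * pairing (h k) x"
      by (simp add: sum_distrib_left[symmetric] pairing_def)
    finally show ?thesis by (simp add: abs_sgn mult.commute)
  qed
  ultimately show "(\<Sum>k\<in>R. \<bar>pairing (h k) x\<bar>) \<le> 32 * N x"
    unfolding pairing_scaled_sum_left by simp
qed

definition has_weight :: "nat \<Rightarrow> (nat \<Rightarrow> real) \<Rightarrow> bool" where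
  "has_weight j f \<longleftrightarrow> 2 \<le> j \<and> (\<exists>k fs. (\<forall>i\<in>{1..k}. fs i \<in> W) \<and>
       allowable (schreier (nn j)) {1..k} (\<lambda>i. supp (fs i)) \<and>
       f = (\<lambda>t. 1 / real (mm j) * (\<Sum>i=1..k. fs i t)))"

lemma singleton_or_weight: "f \<in> W \<Longrightarrow> (\<exists>n. supp f \<subseteq> {n}) \<or> (\<exists>j. has_weight j f)"
  using W_decomposition unfolding has_weight_def by blast

text \<open>Disjoint pieces bounded by 1 add up to a function bounded by 1, so every coordinate of
  \<open>f\<close> is at most \<open>1 / mm j\<close>. The crude l1 estimate is enough because
  \<open>j\<close> will be taken large after \<open>x\<close>.\<close>

lemma large_weight_small:
  assumes "has_weight j f"
  shows "\<bar>pairing f x\<bar> \<le> (\<Sum>t\<in>supp x. \<bar>x t\<bar>) / j"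
proof -
  obtain k fs where j: "2 \<le> j" and fs: "\<forall>i\<in>{1..k}. fs i \<in> W"
       "allowable (schreier (nn j)) {1..k} (\<lambda>i. supp (fs i))"
       "f = (\<lambda>t. 1 / real (mm j) * (\<Sum>i=1..k. fs i t))"
    using assms unfolding has_weight_def by blast
  have "\<bar>\<Sum>i=1..k. fs i t\<bar> \<le> 1" for t
    using disjoint_sum_bound[of fs k t 1] fs(1,2) W_bounded by (simp add: allowable_def)
  then have "\<bar>f t\<bar> \<le> 1 / mm j" for t
    unfolding fs(3) by (simp add: abs_mult divide_right_mono)
  also have "1 / real (mm j) \<le> 1 / j" using j le_mm[of j] by (intro divide_left_mono) auto
  finally have f: "\<bar>f t\<bar> \<le> 1 / j" for t .
  have "\<bar>pairing f x\<bar> \<le> (\<Sum>t\<in>supp x. \<bar>f t * x t\<bar>)" unfolding pairing_def by (rule sum_abs)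
  also have "\<dots> \<le> (\<Sum>t\<in>supp x. 1 / j * \<bar>x t\<bar>)"
    unfolding abs_mult by (intro sum_mono mult_right_mono f) simp
  finally show ?thesis by (simp add: sum_divide_distrib)
qed

end

text \<open>Later \<open>C\<close> consists of convex combinations of a subsequence of
  \<open>u\<close>. Closure under convex combinations keeps averaged vectors in \<open>C\<close>,
  which allows the estimate to be iterated.\<close>

locale convex_block_set = modified_norming_set +
  fixes C :: "(nat \<Rightarrow> real) set" and c :: real
  assumes C_c00: "C \<subseteq> c00"
    and C_bound: "x \<in> C \<Longrightarrow> N x \<le> c"
    and C_convex: "finite (I :: nat set) \<Longrightarrow> (\<And>i. i \<in> I \<Longrightarrow> z i \<in> C) \<Longrightarrow> (\<And>i. i \<in> I \<Longrightarrow> 0 \<le> a i) \<Longrightarrow>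
      sum a I = 1 \<Longrightarrow> (\<lambda>t. \<Sum>i\<in>I. a i * z i t) \<in> C"
    and C_tail: "\<exists>x\<in>C. supp x \<subseteq> {q..}"
begin

text \<open>One \<Gamma> has to serve all \<open>D\<close>: when functionals are split, the number
  of relevant pieces is governed by the position of the vector, which is not known in
  advance.\<close>

definition tail_bound :: "real \<Rightarrow> bool" where
  "tail_bound \<Gamma> \<longleftrightarrow> (\<forall>D q. \<exists>x\<in>C. supp x \<subseteq> {q..} \<and> disjoint_bound D x \<Gamma>)"

lemma c_nonneg: "0 \<le> c"
  using C_tail[of 0] C_bound N_nonneg order_trans by blast

lemma tail_bound_trivial: "tail_bound (32 * c)"
  unfolding tail_bound_def
proof (intro allI)
  fix D q
  obtain x where x: "x \<in> C" "supp x \<subseteq> {max D q..}" using C_tail by blast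
  have "disjoint_bound D x (32 * N x)"
    using x C_c00 by (intro disjoint_bound_trivial) auto
  then have "disjoint_bound D x (32 * c)"
    by (rule disjoint_bound_mono) (simp add: C_bound x(1))
  then show "\<exists>x\<in>C. supp x \<subseteq> {q..} \<and> disjoint_bound D x (32 * c)"
    using x by (intro bexI[of _ x]) auto
qed

lemma sum_abs_pairing_comb:
  assumes "finite B" "finite R" "\<And>s. s \<in> B \<Longrightarrow> z s \<in> c00" "\<And>s. s \<in> B \<Longrightarrow> 0 \<le> a s"
  shows "(\<Sum>k\<in>R. \<bar>pairing (h k) (\<lambda>t. \<Sum>s\<in>B. a s * z s t)\<bar>)
    \<le> (\<Sum>s\<in>B. a s * (\<Sum>k\<in>R. \<bar>pairing (h k) (z s)\<bar>))"
proof -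
  have "\<bar>pairing (h k) (\<lambda>t. \<Sum>s\<in>B. a s * z s t)\<bar> \<le> (\<Sum>s\<in>B. a s * \<bar>pairing (h k) (z s)\<bar>)" for k
  proof -
    have "pairing (h k) (\<lambda>t. \<Sum>s\<in>B. a s * z s t) = (\<Sum>s\<in>B. a s * pairing (h k) (z s))"
      using assms by (simp add: pairing_sum_right c00_scale pairing_scale)
    also have "\<bar>\<dots>\<bar> \<le> (\<Sum>s\<in>B. \<bar>a s * pairing (h k) (z s)\<bar>)" by (rule sum_abs)
    also have "\<dots> = (\<Sum>s\<in>B. a s * \<bar>pairing (h k) (z s)\<bar>)"
      using assms(4) by (intro sum.cong) (simp_all add: abs_mult)
    finally show ?thesis .
  qed
  then have "(\<Sum>k\<in>R. \<bar>pairing (h k) (\<lambda>t. \<Sum>s\<in>B. a s * z s t)\<bar>)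
      \<le> (\<Sum>k\<in>R. \<Sum>s\<in>B. a s * \<bar>pairing (h k) (z s)\<bar>)"
    by (intro sum_mono)
  also have "\<dots> = (\<Sum>s\<in>B. \<Sum>k\<in>R. a s * \<bar>pairing (h k) (z s)\<bar>)" by (rule sum.swap)
  finally show ?thesis by (simp add: sum_distrib_left)
qed

lemma sum_abs_pairing_card:
  assumes "x \<in> C" "\<And>k. k \<in> R \<Longrightarrow> h k \<in> W"
  shows "(\<Sum>k\<in>R. \<bar>pairing (h k) x\<bar>) \<le> card R * c"
proof -
  have "(\<Sum>k\<in>R. \<bar>pairing (h k) x\<bar>) \<le> (\<Sum>k\<in>R. c)"
    using assms pairing_le_N C_bound by (intro sum_mono) (meson order_trans)
  then show ?thesis by simp
qed

text \<open>Only the pieces starting at or before \<open>p\<close> act on \<open>z\<close>, and there are at most \<open>p\<close> of them.\<close>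

lemma started_pieces_bound:
  assumes R: "finite R" "\<And>k. k \<in> R \<Longrightarrow> h k \<in> W" "disjoint_family_on (\<lambda>k. supp (h k)) R"
    and j: "\<And>k. k \<in> R \<Longrightarrow> 2 \<le> j k"
    and fs: "\<And>k i. k \<in> R \<Longrightarrow> i \<in> {1..m k} \<Longrightarrow> fs k i \<in> W"
      "\<And>k. k \<in> R \<Longrightarrow> disjoint_family_on (\<lambda>i. supp (fs k i)) {1..m k}"
      "\<And>k. k \<in> R \<Longrightarrow> h k = (\<lambda>t. 1 / real (mm (j k)) * (\<Sum>i=1..m k. fs k i t))"
    and z: "supp z \<subseteq> {p<..p'}" "disjoint_bound p z \<Gamma>"
    and no: "\<And>k. k \<in> R \<Longrightarrow> minima {1..m k} (\<lambda>i. supp (fs k i)) \<inter> {p<..p'} = {}"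
  shows "(\<Sum>k\<in>R. \<bar>pairing (h k) z\<bar>) \<le> \<Gamma> / 32"
proof -
  define S where "S = (SIGMA k:R. {i\<in>{1..m k}. pairing (fs k i) z \<noteq> 0})"
  have fS: "finite S" using R(1) by (simp add: S_def)
  have finsupp: "finite (supp (fs k i))" if "k \<in> R" "i \<in> {1..m k}" for k i
    using fs(1)[OF that] W_c00 by (auto simp: c00_def)
  have supph: "supp (h k) = (\<Union>i\<in>{1..m k}. supp (fs k i))" if "k \<in> R" for k
    unfolding fs(3)[OF that] using fs(2)[OF that] mm_ge_32[OF j[OF that]]
    by (intro supp_disjoint_sum) auto
  define \<phi> where "\<phi> a = fs (fst a) (snd a)" for a
  have disj: "disjoint_family_on (\<lambda>a. supp (\<phi> a)) S"
    unfolding disjoint_family_on_def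
  proof (intro ballI impI)
    fix a b assume ab: "a \<in> S" "b \<in> S" "a \<noteq> b"
    obtain k i k' i' where e: "a = (k, i)" "b = (k', i')" by (metis surj_pair)
    then have *: "(k, i) \<in> S" "(k', i') \<in> S" "\<not> (k = k' \<and> i = i')" using ab by auto
    then have m: "k \<in> R" "k' \<in> R" "i \<in> {1..m k}" "i' \<in> {1..m k'}" by (auto simp: S_def)
    have "supp (fs k i) \<inter> supp (fs k' i') = {}"
    proof (cases "k = k'")
      case True
      then have "i \<noteq> i'" using * by blast
      then show ?thesis using fs(2)[OF m(1)] m True unfolding disjoint_family_on_def by blast
    next
      case False
      then have "supp (h k) \<inter> supp (h k') = {}"
        using R(3) m unfolding disjoint_family_on_def by blast
      then show ?thesis unfolding supph[OF m(1)] supph[OF m(2)] using m by blast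
    qed
    then show "supp (\<phi> a) \<inter> supp (\<phi> b) = {}" by (simp add: e \<phi>_def)
  qed
  \<comment> \<open>Disjoint pieces have distinct minima, so injectivity of \<mu> counts
    \<open>S\<close>. Vectors vanish at 0, which leaves exactly the \<open>p\<close> values
    \<open>{1..p}\<close>.\<close>
  define \<mu> where "\<mu> = (\<lambda>(k, i). Min (supp (fs k i)))"
  have \<mu>: "\<mu> (k, i) \<in> supp (fs k i)" "\<mu> (k, i) \<in> {1..p}" if ki: "(k, i) \<in> S" for k i
  proof -
    have m: "k \<in> R" "i \<in> {1..m k}" "pairing (fs k i) z \<noteq> 0" using ki by (auto simp: S_def)
    obtain t where t: "t \<in> supp z" "fs k i t * z t \<noteq> 0"
      using m(3) unfolding pairing_def by (rule sum.not_neutral_contains_not_neutral)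
    then have t': "t \<in> supp (fs k i)" "t \<le> p'" using z(1) by (auto simp: supp_def)
    then show mem: "\<mu> (k, i) \<in> supp (fs k i)"
      unfolding \<mu>_def using finsupp[OF m(1,2)] by (auto intro!: Min_in)
    have "\<mu> (k, i) \<le> t" unfolding \<mu>_def using finsupp[OF m(1,2)] t' by simp
    moreover have "\<mu> (k, i) \<in> minima {1..m k} (\<lambda>i. supp (fs k i))"
      unfolding minima_def \<mu>_def using m(2) t'(1) by auto
    ultimately have "\<mu> (k, i) \<le> p" using no[OF m(1)] t'(2) by fastforce
    moreover have "fs k i 0 = 0" using fs(1)[OF m(1,2)] W_c00 unfolding c00_def by blast
    then have "\<mu> (k, i) \<noteq> 0" using mem unfolding supp_def by (metis mem_Collect_eq)
    ultimately show "\<mu> (k, i) \<in> {1..p}" by simp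
  qed
  have "inj_on \<mu> S"
  proof (rule inj_onI)
    fix a b assume ab: "a \<in> S" "b \<in> S" "\<mu> a = \<mu> b"
    obtain k i k' i' where e: "a = (k, i)" "b = (k', i')" by fastforce
    have "supp (fs k i) \<inter> supp (fs k' i') \<noteq> {}"
      using \<mu>(1)[of k i] \<mu>(1)[of k' i'] ab e by auto
    then have "supp (\<phi> a) \<inter> supp (\<phi> b) \<noteq> {}" by (simp add: e \<phi>_def)
    then show "a = b" using disj ab unfolding disjoint_family_on_def by blast
  qed
  moreover have "\<mu> ` S \<subseteq> {1..p}" using \<mu>(2) by auto
  ultimately have "card S \<le> card {1..p}" by (intro card_inj_on_le) auto
  then have "card S \<le> p" by simp
  then have "(\<Sum>a\<in>S. \<bar>pairing (\<phi> a) z\<bar>) \<le> \<Gamma>"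
    using disj fs(1) by (intro disjoint_boundD[OF z(2) fS]) (auto simp: S_def \<phi>_def)
  moreover have "(\<Sum>a\<in>S. \<bar>pairing (\<phi> a) z\<bar>)
      = (\<Sum>k\<in>R. \<Sum>i\<in>{i\<in>{1..m k}. pairing (fs k i) z \<noteq> 0}. \<bar>pairing (fs k i) z\<bar>)"
    unfolding S_def using R(1) by (subst sum.Sigma) (auto simp: split_beta \<phi>_def intro!: sum.cong)
  moreover have "(\<Sum>i\<in>{i\<in>{1..m k}. pairing (fs k i) z \<noteq> 0}. \<bar>pairing (fs k i) z\<bar>)
      = (\<Sum>i\<in>{1..m k}. \<bar>pairing (fs k i) z\<bar>)" for k
    by (intro sum.mono_neutral_left) auto
  ultimately have S: "(\<Sum>k\<in>R. \<Sum>i\<in>{1..m k}. \<bar>pairing (fs k i) z\<bar>) \<le> \<Gamma>" by simp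
  have "(\<Sum>k\<in>R. \<bar>pairing (h k) z\<bar>) \<le> (\<Sum>k\<in>R. 1 / 32 * (\<Sum>i\<in>{1..m k}. \<bar>pairing (fs k i) z\<bar>))"
  proof (rule sum_mono)
    fix k assume k: "k \<in> R"
    have "pairing (h k) z = 1 / real (mm (j k)) * (\<Sum>i=1..m k. pairing (fs k i) z)"
      unfolding fs(3)[OF k] by (rule pairing_scaled_sum_left)
    then have "\<bar>pairing (h k) z\<bar> = 1 / real (mm (j k)) * \<bar>\<Sum>i=1..m k. pairing (fs k i) z\<bar>"
      by (simp add: abs_mult)
    also have "\<dots> \<le> 1 / 32 * (\<Sum>i\<in>{1..m k}. \<bar>pairing (fs k i) z\<bar>)"
      using mm_ge_32[OF j[OF k]] by (intro mult_mono sum_abs divide_left_mono) auto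
    finally show "\<bar>pairing (h k) z\<bar> \<le> 1 / 32 * (\<Sum>i\<in>{1..m k}. \<bar>pairing (fs k i) z\<bar>)" .
  qed
  also have "\<dots> \<le> \<Gamma> / 32" using S unfolding sum_distrib_left[symmetric] by linarith
  finally show ?thesis .
qed

text \<open>With weights bounded by \<open>J\<close> the minima of the pieces lie in one Schreier
  family, against which an average of blocks is chosen. On a block where no piece starts, splitting
  gains the factor 32; the remaining blocks have small total coefficient.\<close>

lemma low_weight_bound:
  assumes "tail_bound \<Gamma>" "0 < \<epsilon>"
  shows "\<exists>w\<in>C. supp w \<subseteq> {q..} \<and> (\<forall>h. \<forall>R::nat set. finite R \<and> card R \<le> d \<and> (\<forall>k\<in>R. h k \<in> W) \<and>
     disjoint_family_on (\<lambda>k. supp (h k)) R \<and> (\<forall>k\<in>R. \<exists>j\<le>J. has_weight j (h k)) \<longrightarrow>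
     (\<Sum>k\<in>R. \<bar>pairing (h k) w\<bar>) \<le> \<Gamma> / 32 + \<epsilon>)"
proof -
  obtain Z where Z: "\<And>D q. Z D q \<in> C" "\<And>D q. supp (Z D q) \<subseteq> {q..}" "\<And>D q. disjoint_bound D (Z D q) \<Gamma>"
    using assms(1) unfolding tail_bound_def Bex_def choice_iff by blast
  \<comment> \<open>The block after \<open>p\<close> is chosen to control \<open>p\<close> disjoint
    functionals, the largest number of pieces that can have started by then. Starting it at
    \<open>Suc p\<close> puts its support into a half-open range.\<close>
  define p where "p = rec_nat q (\<lambda>_ p. Max (insert (Suc p) (supp (Z p (Suc p)))))"
  have p0: "p 0 = q" and pS: "p (Suc s) = Max (insert (Suc (p s)) (supp (Z (p s) (Suc (p s)))))" for s
    by (simp_all add: p_def)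
  define z where "z s = Z (p s) (Suc (p s))" for s
  have zC: "z s \<in> C" and zb: "disjoint_bound (p s) (z s) \<Gamma>" for s using Z(1,3) by (simp_all add: z_def)
  have z00: "z s \<in> c00" for s using zC C_c00 by blast
  have p_ge: "t \<le> p (Suc s)" if "t \<in> insert (Suc (p s)) (supp (z s))" for t s
    unfolding pS by (rule Max_ge) (use that c00_finite_supp[OF z00[of s]] in \<open>auto simp: z_def\<close>)
  have zsupp: "supp (z s) \<subseteq> {p s<..p (Suc s)}" for s
    using p_ge[of _ s] Z(2)[of "p s" "Suc (p s)"] unfolding z_def by fastforce
  have "p s \<le> p (Suc s)" for s using p_ge[of "Suc (p s)" s] by simp
  then have mono: "mono p" by (rule mono_iff_le_Suc[THEN iffD2, OF allI])
  define n where "n = Max (nn ` {..J})"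
  have n: "nn j \<le> n" if "j \<le> J" for j unfolding n_def using that by (intro Max_ge) auto
  \<comment> \<open>At most \<open>d\<close> sets of minima are avoided, each up to \<epsilon>', and
    a bad block costs at most \<open>d * c\<close>. The added 1 keeps the denominator
    positive.\<close>
  define \<epsilon>' where "\<epsilon>' = \<epsilon> / (real d * (real d * c) + 1)"
  have "0 < real d * (real d * c) + 1" using c_nonneg by (simp add: add_nonneg_pos)
  then have \<epsilon>': "0 < \<epsilon>'" "real d * (real d * c) * \<epsilon>' \<le> \<epsilon>"
    using assms(2) by (simp_all add: \<epsilon>'_def field_simps)
  obtain a B where a: "finite B" "\<And>s. 0 \<le> a s" "sum a B = 1"
    "\<And>M. M \<in> schreier n \<Longrightarrow> sum a {s\<in>B. hits p M s} \<le> \<epsilon>'"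
    using schreier_small_average[OF mono \<epsilon>'(1), of 0 n] by blast
  define w where "w = (\<lambda>t. \<Sum>s\<in>B. a s * z s t)"
  have "w \<in> C" unfolding w_def using a zC by (intro C_convex)
  moreover have "supp w \<subseteq> {q..}"
  proof
    fix t assume "t \<in> supp w"
    then have "(\<Sum>s\<in>B. a s * z s t) \<noteq> 0" by (simp add: supp_def w_def)
    then obtain s where "a s * z s t \<noteq> 0" by (rule sum.not_neutral_contains_not_neutral)
    then have "t \<in> supp (z s)" by (simp add: supp_def)
    then have "p s < t" using zsupp by fastforce
    then show "t \<in> {q..}" using monoD[OF mono, of 0 s] p0 by simp
  qed
  moreover have "(\<Sum>k\<in>R. \<bar>pairing (h k) w\<bar>) \<le> \<Gamma> / 32 + \<epsilon>"
    if R: "finite R" "card R \<le> d" "\<forall>k\<in>R. h k \<in> W" "disjoint_family_on (\<lambda>k. supp (h k)) R"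
      and wt: "\<forall>k\<in>R. \<exists>j\<le>J. has_weight j (h k)" for h and R :: "nat set"
  proof -
    have "\<exists>j m fs. j \<le> J \<and> 2 \<le> j \<and> (\<forall>i\<in>{1..m}. fs i \<in> W) \<and>
       allowable (schreier (nn j)) {1..m} (\<lambda>i. supp (fs i)) \<and>
       h k = (\<lambda>t. 1 / real (mm j) * (\<Sum>i=1..m. fs i t))" if "k \<in> R" for k
      using wt that unfolding has_weight_def by blast
    then have "\<forall>k\<in>R. \<exists>j m fs. j \<le> J \<and> 2 \<le> j \<and> (\<forall>i\<in>{1..m}. fs i \<in> W) \<and>
       allowable (schreier (nn j)) {1..m} (\<lambda>i. supp (fs i)) \<and>
       h k = (\<lambda>t. 1 / real (mm j) * (\<Sum>i=1..m. fs i t))" by blast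
    then obtain j m fs where dec: "\<forall>k\<in>R. j k \<le> J \<and> 2 \<le> j k \<and> (\<forall>i\<in>{1..m k}. fs k i \<in> W) \<and>
       allowable (schreier (nn (j k))) {1..m k} (\<lambda>i. supp (fs k i)) \<and>
       h k = (\<lambda>t. 1 / real (mm (j k)) * (\<Sum>i=1..m k. fs k i t))"
      unfolding bchoice_iff by (elim exE) (rule that)
    define M where "M k = minima {1..m k} (\<lambda>i. supp (fs k i))" for k
    have M: "M k \<in> schreier n" if k: "k \<in> R" for k
    proof -
      have "M k \<in> schreier (nn (j k))" using dec k unfolding M_def allowable_def by blast
      then show ?thesis using schreier_mono[OF n[of "j k"]] dec k by blast
    qed
    define S where "S s = (\<Sum>k\<in>R. \<bar>pairing (h k) (z s)\<bar>)" for s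
    define bad where "bad = {s\<in>B. \<exists>k\<in>R. hits p (M k) s}"
    have good: "S s \<le> \<Gamma> / 32" if s: "s \<in> B - bad" for s
      unfolding S_def
    proof (rule started_pieces_bound[where p = "p s" and p' = "p (Suc s)" and j = j and m = m and fs = fs])
      show "minima {1..m k} (\<lambda>i. supp (fs k i)) \<inter> {p s<..p (Suc s)} = {}" if "k \<in> R" for k
        using s that unfolding bad_def hits_def M_def by blast
      show "disjoint_family_on (\<lambda>i. supp (fs k i)) {1..m k}" if "k \<in> R" for k
        using dec that unfolding allowable_def by blast
    qed (use R zsupp zb dec in blast)+
    have Sd: "S s \<le> real d * c" for s
    proof -
      have "S s \<le> card R * c" unfolding S_def using zC R(3) by (intro sum_abs_pairing_card) auto
      also have "\<dots> \<le> real d * c" using R(2) c_nonneg by (intro mult_right_mono) auto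
      finally show ?thesis .
    qed
    have S0: "0 \<le> S s" for s by (simp add: S_def sum_nonneg)
    \<comment> \<open>The empty family of functionals is a legitimate test.\<close>
    have "\<Gamma> \<ge> 0" using zb[of 0] unfolding disjoint_bound_def by (elim allE[of _ "\<lambda>_ _. 0"] allE[of _ "{}"])
        (simp add: disjoint_family_on_def)
    have "sum a bad \<le> (\<Sum>k\<in>R. sum a {s\<in>B. hits p (M k) s})"
      unfolding bad_def using a(1,2) R(1) by (intro sum_UN_bound)
    also have "\<dots> \<le> (\<Sum>k\<in>R. \<epsilon>')" by (intro sum_mono a(4) M)
    also have "\<dots> \<le> real d * \<epsilon>'" using R(2) \<epsilon>'(1) by (simp add: mult_right_mono)
    finally have abad: "sum a bad \<le> real d * \<epsilon>'" .
    have "(\<Sum>k\<in>R. \<bar>pairing (h k) w\<bar>) \<le> (\<Sum>s\<in>B. a s * S s)"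
      unfolding w_def S_def using a R(1) z00 by (intro sum_abs_pairing_comb) auto
    also have "\<dots> \<le> (\<Sum>s\<in>B. a s * (\<Gamma> / 32) + (if s \<in> bad then a s * (real d * c) else 0))"
    proof (rule sum_mono)
      fix s assume s: "s \<in> B"
      show "a s * S s \<le> a s * (\<Gamma> / 32) + (if s \<in> bad then a s * (real d * c) else 0)"
      proof (cases "s \<in> bad")
        case True
        have "a s * S s \<le> a s * (real d * c)" using a(2) Sd by (intro mult_left_mono) auto
        moreover have "0 \<le> a s * (\<Gamma> / 32)" using a(2) \<open>\<Gamma> \<ge> 0\<close> by simp
        ultimately show ?thesis using True by simp
      next
        case False
        then show ?thesis using mult_left_mono[OF good a(2)] s by simp
      qed
    qed
    also have "\<dots> = \<Gamma> / 32 + sum a bad * (real d * c)"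
    proof -
      have "(\<Sum>s\<in>B. if s \<in> bad then a s * (real d * c) else 0) = (\<Sum>s\<in>bad. a s * (real d * c))"
        using a(1) unfolding bad_def by (subst sum.inter_filter) (auto intro: sum.cong)
      then show ?thesis using a(3) by (simp add: sum.distrib sum_distrib_right[symmetric] sum_divide_distrib[symmetric])
    qed
    also have "sum a bad * (real d * c) \<le> real d * \<epsilon>' * (real d * c)"
      using abad c_nonneg by (intro mult_right_mono) auto
    also have "\<dots> \<le> \<epsilon>" using \<epsilon>'(2) by (simp add: ac_simps)
    finally show ?thesis by simp
  qed
  ultimately show ?thesis by (intro bexI[of _ w] conjI allI impI) auto
qed

text \<open>The weight bound is removed by averaging \<open>M\<close> vectors \<open>w i\<close>
  with increasing thresholds \<open>J i\<close>. Weights up to \<open>J i\<close> are controlled by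
  the choice of \<open>w i\<close>, weights beyond \<open>J (Suc i)\<close> are negligible on it,
  and a fixed functional falls between the two for at most one \<open>i\<close>. Functionals living
  on one coordinate meet at most one \<open>w i\<close> anyway.\<close>

lemma tail_bound_decrease:
  assumes P: "tail_bound \<Gamma>" and \<epsilon>: "0 < \<epsilon>"
  shows "tail_bound (\<Gamma> / 32 + \<epsilon>)"
  unfolding tail_bound_def
proof (intro allI)
  fix d q :: nat
  define \<delta> where "\<delta> = \<epsilon> / (3 * (real d + 1))"
  have \<delta>: "0 < \<delta>" "real d * \<delta> \<le> \<epsilon> / 3" using \<epsilon> by (simp_all add: \<delta>_def field_simps)
  have "\<forall>q J. \<exists>w\<in>C. supp w \<subseteq> {q..} \<and> (\<forall>h. \<forall>R::nat set. finite R \<and> card R \<le> d \<and> (\<forall>k\<in>R. h k \<in> W) \<and>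
     disjoint_family_on (\<lambda>k. supp (h k)) R \<and> (\<forall>k\<in>R. \<exists>j\<le>J. has_weight j (h k)) \<longrightarrow>
     (\<Sum>k\<in>R. \<bar>pairing (h k) w\<bar>) \<le> \<Gamma> / 32 + \<epsilon> / 3)"
    using \<epsilon> by (intro allI low_weight_bound[OF P]) simp
  then obtain v where v: "\<forall>q J. v q J \<in> C \<and> supp (v q J) \<subseteq> {q..} \<and> (\<forall>h. \<forall>R::nat set. finite R \<and> card R \<le> d \<and> (\<forall>k\<in>R. h k \<in> W) \<and>
     disjoint_family_on (\<lambda>k. supp (h k)) R \<and> (\<forall>k\<in>R. \<exists>j\<le>J. has_weight j (h k)) \<longrightarrow>
     (\<Sum>k\<in>R. \<bar>pairing (h k) (v q J)\<bar>) \<le> \<Gamma> / 32 + \<epsilon> / 3)"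
    unfolding Bex_def choice_iff by (elim exE) (rule that)
  \<comment> \<open>The new threshold is the l1 norm of \<open>w\<close> divided by \<delta>: any
    larger weight acts on \<open>w\<close> by at most \<delta>. The new starting point lies strictly
    after the support of \<open>w\<close>.\<close>
  define next_state where "next_state = (\<lambda>(q, J). let w = v q J in
    (Max (insert q (Suc ` supp w)), max J (nat \<lceil>(\<Sum>t\<in>supp w. \<bar>w t\<bar>) / \<delta>\<rceil>)))"
  define st where "st = rec_nat (q, 0::nat) (\<lambda>_. next_state)"
  define Q where "Q i = fst (st i)" for i
  define J where "J i = snd (st i)" for i
  define w where "w i = v (Q i) (J i)" for i
  have wC: "w i \<in> C" and wsupp: "supp (w i) \<subseteq> {Q i..}" for i using v by (auto simp: w_def)
  have low: "(\<Sum>k\<in>R. \<bar>pairing (h k) (w i)\<bar>) \<le> \<Gamma> / 32 + \<epsilon> / 3"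
    if "finite R" "card R \<le> d" "\<And>k. k \<in> R \<Longrightarrow> h k \<in> W" "disjoint_family_on (\<lambda>k. supp (h k)) R"
      "\<And>k. k \<in> R \<Longrightarrow> \<exists>j\<le>J i. has_weight j (h k)" for i h and R :: "nat set"
    unfolding w_def using v that by blast
  have w00: "w i \<in> c00" for i using wC C_c00 by blast
  have step: "st (Suc i) = next_state (Q i, J i)" for i by (simp add: st_def Q_def J_def)
  have QS: "Q (Suc i) = Max (insert (Q i) (Suc ` supp (w i)))"
    and JS: "J (Suc i) = max (J i) (nat \<lceil>(\<Sum>t\<in>supp (w i). \<bar>w i t\<bar>) / \<delta>\<rceil>)" for i
    unfolding Q_def[of "Suc i"] J_def[of "Suc i"] step next_state_def by (simp_all add: w_def Let_def)
  have Q0: "Q 0 = q" by (simp add: Q_def st_def)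
  have Q_ge: "t \<le> Q (Suc i)" if "t \<in> insert (Q i) (Suc ` supp (w i))" for t i
    unfolding QS by (rule Max_ge) (use that c00_finite_supp[OF w00[of i]] in auto)
  have Qmono: "Q i \<le> Q i'" if "i \<le> i'" for i i'
    by (rule lift_Suc_mono_le[OF _ that]) (rule Q_ge, simp)
  have Jmono: "J i \<le> J i'" if "i \<le> i'" for i i'
    by (rule lift_Suc_mono_le[OF _ that]) (simp add: JS)
  have disj: "i = i'" if t: "t \<in> supp (w i)" "t \<in> supp (w i')" for t i i'
  proof (rule ccontr)
    assume "i \<noteq> i'"
    moreover have False if "a < b" "t \<in> supp (w a)" "t \<in> supp (w b)" for a b
    proof -
      have "Suc t \<le> Q (Suc a)" using that(2) by (intro Q_ge) simp
      also have "\<dots> \<le> Q b" using that(1) by (intro Qmono) simp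
      also have "\<dots> \<le> t" using wsupp[of b] that(3) by auto
      finally show False by simp
    qed
    ultimately show False using t by (metis nat_neq_iff)
  qed
  \<comment> \<open>Each of at most \<open>d\<close> functionals spoils at most one vector, at cost
    \<open>c\<close>; averaging over \<open>M\<close> vectors makes this the last third of
    \<epsilon>.\<close>
  obtain M :: nat where M: "3 * (real d * c) / \<epsilon> < M" using reals_Archimedean2 by blast
  have "0 \<le> 3 * (real d * c) / \<epsilon>" using c_nonneg \<epsilon> by simp
  then have M0: "0 < real M" using M by linarith
  have Md: "real d * c / M \<le> \<epsilon> / 3" using M \<epsilon> M0 by (simp add: field_simps)
  define z where "z = (\<lambda>t. \<Sum>i\<in>{..<M}. 1 / real M * w i t)"
  have "z \<in> C" unfolding z_def using wC M0 by (intro C_convex) auto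
  moreover have "supp z \<subseteq> {q..}"
  proof
    fix t assume "t \<in> supp z"
    then have "(\<Sum>i\<in>{..<M}. 1 / real M * w i t) \<noteq> 0" by (simp add: supp_def z_def)
    then obtain i where "1 / real M * w i t \<noteq> 0" by (rule sum.not_neutral_contains_not_neutral)
    then have "t \<in> supp (w i)" by (simp add: supp_def)
    then have "Q i \<le> t" using wsupp by fastforce
    then show "t \<in> {q..}" using Qmono[of 0 i] Q0 by simp
  qed
  moreover have "disjoint_bound d z (\<Gamma> / 32 + \<epsilon>)"
    unfolding disjoint_bound_def
  proof (intro allI impI, elim conjE)
    fix h and R :: "nat set"
    assume R: "finite R" "card R \<le> d" "\<forall>k\<in>R. h k \<in> W" "disjoint_family_on (\<lambda>k. supp (h k)) R"
    define lw where "lw i k \<longleftrightarrow> (\<exists>j\<le>J i. has_weight j (h k))" for i k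
    define bad where "bad i k \<longleftrightarrow> \<not> lw i k \<and> \<delta> < \<bar>pairing (h k) (w i)\<bar>" for i k
    have bad_unique: "i = i'" if k: "k \<in> R" and b: "bad i k" "bad i' k" for k i i'
    proof -
      consider n where "supp (h k) \<subseteq> {n}" | j where "has_weight j (h k)"
        using singleton_or_weight R(3) k by blast
      then show ?thesis
      proof cases
        case 1
        have "n \<in> supp (w i)" if "bad i k" for i
        proof -
          have "pairing (h k) (w i) \<noteq> 0" using that \<delta>(1) by (auto simp: bad_def)
          then obtain t where "t \<in> supp (w i)" "h k t * w i t \<noteq> 0"
            unfolding pairing_def by (rule sum.not_neutral_contains_not_neutral)
          then show ?thesis using 1 by (auto simp: supp_def)
        qed
        then show ?thesis using disj b by blast
      next
        case 2
        have lo: "J i < j" if "bad i k" for i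
          using that 2 unfolding bad_def lw_def by (meson not_le)
        have hi: "j \<le> J (Suc i)" if "bad i k" for i
        proof (rule ccontr)
          let ?s = "\<Sum>t\<in>supp (w i). \<bar>w i t\<bar>"
          assume "\<not> j \<le> J (Suc i)"
          then have "?s / \<delta> \<le> j" unfolding JS by linarith
          moreover have "0 < j" using lo[OF that] by simp
          ultimately have "?s / j \<le> \<delta>" using \<delta>(1) by (simp add: field_simps)
          then have "\<bar>pairing (h k) (w i)\<bar> \<le> \<delta>"
            using large_weight_small[OF 2, of "w i"] by linarith
          then show False using that by (simp add: bad_def)
        qed
        have "\<not> a < b" if "bad a k" "bad b k" for a b
          using hi[OF that(1)] lo[OF that(2)] Jmono[of "Suc a" b] by linarith
        then show ?thesis using b by (meson nat_neq_iff)
      qed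
    qed
    have each: "(\<Sum>k\<in>R. \<bar>pairing (h k) (w i)\<bar>) \<le> \<Gamma> / 32 + 2 * \<epsilon> / 3 + (\<Sum>k\<in>R. if bad i k then c else 0)" for i
    proof -
      have "(\<Sum>k\<in>R. \<bar>pairing (h k) (w i)\<bar>) \<le>
          (\<Sum>k\<in>R. (if lw i k then \<bar>pairing (h k) (w i)\<bar> else 0) + \<delta> + (if bad i k then c else 0))"
      proof (rule sum_mono)
        fix k assume "k \<in> R"
        then have "\<bar>pairing (h k) (w i)\<bar> \<le> c"
          using R(3) pairing_le_N C_bound[OF wC] by (meson order_trans)
        then show "\<bar>pairing (h k) (w i)\<bar> \<le>
            (if lw i k then \<bar>pairing (h k) (w i)\<bar> else 0) + \<delta> + (if bad i k then c else 0)"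
          using \<delta>(1) c_nonneg by (auto simp: bad_def)
      qed
      also have "\<dots> = (\<Sum>k\<in>{k\<in>R. lw i k}. \<bar>pairing (h k) (w i)\<bar>) + card R * \<delta> + (\<Sum>k\<in>R. if bad i k then c else 0)"
        using R(1) by (simp add: sum.distrib sum.inter_filter)
      also have "(\<Sum>k\<in>{k\<in>R. lw i k}. \<bar>pairing (h k) (w i)\<bar>) \<le> \<Gamma> / 32 + \<epsilon> / 3"
      proof (rule low)
        show "card {k \<in> R. lw i k} \<le> d"
          using card_mono[OF R(1), of "{k \<in> R. lw i k}"] R(2) by auto
        show "disjoint_family_on (\<lambda>k. supp (h k)) {k \<in> R. lw i k}"
          using R(4) unfolding disjoint_family_on_def by blast
      qed (use R in \<open>auto simp: lw_def\<close>)
      also have "card R * \<delta> \<le> \<epsilon> / 3"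
        using R(2) \<delta>(1) by (intro order_trans[OF mult_right_mono \<delta>(2)]) auto
      finally show ?thesis by simp
    qed
    have "(\<Sum>k\<in>R. \<bar>pairing (h k) z\<bar>) \<le> (\<Sum>i\<in>{..<M}. 1 / real M * (\<Sum>k\<in>R. \<bar>pairing (h k) (w i)\<bar>))"
      unfolding z_def using R(1) w00 by (intro sum_abs_pairing_comb) auto
    also have "\<dots> \<le> (\<Sum>i\<in>{..<M}. 1 / real M * (\<Gamma> / 32 + 2 * \<epsilon> / 3 + (\<Sum>k\<in>R. if bad i k then c else 0)))"
      using each by (intro sum_mono mult_left_mono) auto
    also have "\<dots> = \<Gamma> / 32 + 2 * \<epsilon> / 3 + 1 / real M * (\<Sum>i\<in>{..<M}. \<Sum>k\<in>R. if bad i k then c else 0)"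
      unfolding sum_distrib_left[symmetric] sum.distrib using M0 by (simp add: field_simps)
    also have "1 / real M * (\<Sum>i\<in>{..<M}. \<Sum>k\<in>R. if bad i k then c else 0) \<le> 1 / real M * (real d * c)"
    proof (rule mult_left_mono)
      have "(\<Sum>i\<in>{..<M}. if bad i k then c else 0) \<le> c" if k: "k \<in> R" for k
      proof -
        have "card {i\<in>{..<M}. bad i k} \<le> 1"
          using bad_unique[OF k] by (auto simp: card_le_Suc0_iff_eq)
        then have "real (card {i\<in>{..<M}. bad i k}) * c \<le> 1 * c"
          using c_nonneg by (intro mult_right_mono) auto
        then show ?thesis by (simp add: sum.inter_filter[symmetric])
      qed
      then have "(\<Sum>k\<in>R. \<Sum>i\<in>{..<M}. if bad i k then c else 0) \<le> (\<Sum>k\<in>R. c)" by (rule sum_mono)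
      also have "\<dots> \<le> real d * c" using R(2) c_nonneg by (simp add: mult_right_mono)
      finally show "(\<Sum>i\<in>{..<M}. \<Sum>k\<in>R. if bad i k then c else 0) \<le> real d * c" by (subst sum.swap)
    qed simp
    also have "1 / real M * (real d * c) \<le> \<epsilon> / 3" using Md by simp
    finally show "(\<Sum>k\<in>R. \<bar>pairing (h k) z\<bar>) \<le> \<Gamma> / 32 + \<epsilon>" by simp
  qed
  ultimately show "\<exists>x\<in>C. supp x \<subseteq> {q..} \<and> disjoint_bound d x (\<Gamma> / 32 + \<epsilon>)" by blast
qed

lemma small_norm_exists:
  assumes "0 < \<epsilon>"
  shows "\<exists>x\<in>C. N x \<le> \<epsilon>"
proof -
  have "tail_bound (32 * (c + 1) / 2 ^ r)" for r
  proof (induction r)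
    case 0
    have "disjoint_bound D x (32 * (c + 1) / 2 ^ 0)" if "disjoint_bound D x (32 * c)" for D x
      using that by (rule disjoint_bound_mono) simp
    then show ?case using tail_bound_trivial unfolding tail_bound_def by blast
  next
    case (Suc r)
    let ?\<Gamma> = "32 * (c + 1) / 2 ^ r"
    \<comment> \<open>The error is chosen so that each round exactly halves the bound;
      \<open>c + 1\<close> in place of \<open>c\<close> keeps it positive.\<close>
    have "tail_bound (?\<Gamma> / 32 + ?\<Gamma> * (15 / 32))"
      using c_nonneg by (intro tail_bound_decrease[OF Suc]) simp
    moreover have "g / 32 + g * (15 / 32) = g / 2" for g :: real by simp
    moreover have "?\<Gamma> / 2 = 32 * (c + 1) / 2 ^ Suc r" by simp
    ultimately show ?case by (simp only:)
  qed
  moreover obtain r where "32 * (c + 1) / \<epsilon> < 2 ^ r"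
    using real_arch_pow[of 2 "32 * (c + 1) / \<epsilon>"] by auto
  then have "32 * (c + 1) / 2 ^ r \<le> \<epsilon>" using assms by (simp add: field_simps)
  ultimately obtain x where x: "x \<in> C" "disjoint_bound 1 x (32 * (c + 1) / 2 ^ r)"
    unfolding tail_bound_def by blast
  have "\<bar>pairing f x\<bar> \<le> 32 * (c + 1) / 2 ^ r" if "f \<in> W" for f
    using disjoint_boundD[OF x(2), of "{0::nat}" "\<lambda>_. f"] that by (simp add: disjoint_family_on_def)
  then have "N x \<le> 32 * (c + 1) / 2 ^ r" by (rule N_le)
  also have "\<dots> \<le> \<epsilon>" by fact
  finally show ?thesis using x(1) by blast
qed

end

section \<open>Averages over signs\<close>

text \<open>Subsets of \<open>F\<close> encode the choices of signs, and sums over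
  \<open>Pow F\<close> replace expectations of Rademacher averages.\<close>

definition sign :: "nat set \<Rightarrow> nat \<Rightarrow> real" where
  "sign S i = (if i \<in> S then 1 else - 1)"

lemma sign_square: "sign S i * sign S i = 1"
  by (simp add: sign_def)

lemma abs_sign: "\<bar>sign S i\<bar> = 1"
  by (simp add: sign_def)

text \<open>Switching the membership of \<open>i\<close> is an involution of \<open>Pow F\<close>
  that reverses the sign of every summand.\<close>

lemma sum_sign_orthogonal:
  assumes "finite F" "i \<in> F" "i \<noteq> j"
  shows "(\<Sum>S\<in>Pow F. sign S i * sign S j) = 0"
proof -
  define b where "b S = (if i \<in> S then S - {i} else insert i S)" for S
  have bb: "b (b S) = S" for S by (auto simp: b_def)
  have bP: "b S \<in> Pow F" if "S \<in> Pow F" for S using that assms(2) by (auto simp: b_def)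
  have "bij_betw b (Pow F) (Pow F)"
    by (rule bij_betw_byWitness[where f' = b]) (use bb bP in blast)+
  then have "(\<Sum>S\<in>Pow F. sign S i * sign S j) = (\<Sum>S\<in>Pow F. sign (b S) i * sign (b S) j)"
    by (rule sum.reindex_bij_betw[symmetric])
  also have "\<dots> = (\<Sum>S\<in>Pow F. - (sign S i * sign S j))"
    using assms(3) by (intro sum.cong) (auto simp: sign_def b_def)
  finally show ?thesis by (simp add: sum_negf)
qed

text \<open>Extraction of a Rademacher coefficient. It yields the second moment below, and later
  isolates a single image on the part selected for it.\<close>

lemma sum_sign_coefficient:
  assumes "finite F" "j \<in> F"
  shows "(\<Sum>S\<in>Pow F. sign S j * (\<Sum>i\<in>F. sign S i * x i)) = 2 ^ card F * x j"
proof -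
  have "(\<Sum>S\<in>Pow F. sign S j * (\<Sum>i\<in>F. sign S i * x i))
      = (\<Sum>S\<in>Pow F. \<Sum>i\<in>F. (sign S j * sign S i) * x i)"
    by (simp add: sum_distrib_left mult.assoc)
  also have "\<dots> = (\<Sum>i\<in>F. \<Sum>S\<in>Pow F. (sign S j * sign S i) * x i)" by (rule sum.swap)
  also have "\<dots> = (\<Sum>i\<in>F. if i = j then 2 ^ card F * x i else 0)"
  proof (rule sum.cong[OF refl])
    fix i
    show "(\<Sum>S\<in>Pow F. (sign S j * sign S i) * x i) = (if i = j then 2 ^ card F * x i else 0)"
      using assms sum_sign_orthogonal[OF assms, of i]
      by (auto simp: sign_square card_Pow sum_distrib_right[symmetric])
  qed
  also have "\<dots> = 2 ^ card F * x j" using assms by simp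
  finally show ?thesis .
qed

text \<open>The easy half of Khinchin's inequality: orthogonality computes the second moment, and
  the Cauchy-Schwarz inequality passes to the first. Taking \<open>card F\<close> to be a square
  avoids roots.\<close>

lemma sum_sign_abs_bound:
  assumes "finite F" "card F = R\<^sup>2" "\<And>i. i \<in> F \<Longrightarrow> \<bar>x i\<bar> \<le> \<tau>" "0 \<le> \<tau>"
  shows "(\<Sum>S\<in>Pow F. \<bar>\<Sum>i\<in>F. sign S i * x i\<bar>) \<le> 2 ^ card F * (R * \<tau>)"
proof -
  let ?y = "\<lambda>S. \<Sum>i\<in>F. sign S i * x i"
  have "(\<Sum>S\<in>Pow F. (?y S)\<^sup>2) = (\<Sum>S\<in>Pow F. \<Sum>j\<in>F. x j * (sign S j * ?y S))"
  proof (rule sum.cong[OF refl])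
    fix S
    have "(?y S)\<^sup>2 = (\<Sum>j\<in>F. sign S j * x j) * ?y S" by (simp add: power2_eq_square)
    also have "\<dots> = (\<Sum>j\<in>F. x j * (sign S j * ?y S))"
      unfolding sum_distrib_right by (rule sum.cong) (simp_all add: ac_simps)
    finally show "(?y S)\<^sup>2 = (\<Sum>j\<in>F. x j * (sign S j * ?y S))" .
  qed
  also have "\<dots> = (\<Sum>j\<in>F. \<Sum>S\<in>Pow F. x j * (sign S j * ?y S))" by (rule sum.swap)
  also have "\<dots> = (\<Sum>j\<in>F. 2 ^ card F * (x j)\<^sup>2)"
  proof (rule sum.cong[OF refl])
    fix j assume "j \<in> F"
    show "(\<Sum>S\<in>Pow F. x j * (sign S j * ?y S)) = 2 ^ card F * (x j)\<^sup>2"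
      unfolding sum_distrib_left[symmetric] sum_sign_coefficient[OF assms(1) \<open>j \<in> F\<close>]
      by (simp add: power2_eq_square)
  qed
  also have "\<dots> \<le> (\<Sum>j\<in>F. 2 ^ card F * \<tau>\<^sup>2)"
    using assms(3) by (intro sum_mono mult_left_mono) (auto simp: abs_le_square_iff[symmetric] assms(4))
  also have "\<dots> = 2 ^ card F * (R * \<tau>)\<^sup>2" using assms(2) by (simp add: power_mult_distrib)
  finally have sq: "(\<Sum>S\<in>Pow F. (?y S)\<^sup>2) \<le> 2 ^ card F * (R * \<tau>)\<^sup>2" .
  have "(\<Sum>S\<in>Pow F. \<bar>?y S\<bar>)\<^sup>2 \<le> (\<Sum>S\<in>Pow F. \<bar>?y S\<bar>\<^sup>2) * card (Pow F)"
    by (rule sum_squared_le_sum_of_squares)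
  also have "\<dots> = (\<Sum>S\<in>Pow F. (?y S)\<^sup>2) * 2 ^ card F" using assms(1) by (simp add: card_Pow)
  also have "\<dots> \<le> (2 ^ card F * (R * \<tau>)\<^sup>2) * 2 ^ card F" using sq by (rule mult_right_mono) simp
  also have "\<dots> = (2 ^ card F * (R * \<tau>))\<^sup>2" by (simp add: power2_eq_square)
  finally show ?thesis by (rule power2_le_imp_le) (use assms(4) in simp)
qed

lemma disjoint_sum_abs:
  fixes u :: "nat \<Rightarrow> nat \<Rightarrow> real"
  assumes "finite F" "disjoint_family_on (\<lambda>i. supp (u i)) F"
  shows "\<bar>\<Sum>i\<in>F. c i * u i t\<bar> = (\<Sum>i\<in>F. \<bar>c i * u i t\<bar>)"
proof (cases "\<exists>i\<in>F. u i t \<noteq> 0")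
  case True
  then obtain i where i: "i \<in> F" "u i t \<noteq> 0" by blast
  have "u i' t = 0" if "i' \<in> F - {i}" for i'
  proof -
    have "supp (u i') \<inter> supp (u i) = {}"
      using assms(2) i(1) that unfolding disjoint_family_on_def by blast
    then show ?thesis using i(2) unfolding supp_def by blast
  qed
  then have "(\<Sum>i\<in>F. c i * u i t) = c i * u i t" "(\<Sum>i\<in>F. \<bar>c i * u i t\<bar>) = \<bar>c i * u i t\<bar>"
    using assms(1) i(1) by (simp_all add: sum.remove[of F i])
  then show ?thesis by simp
next
  case False
  then show ?thesis by simp
qed

section \<open>Images of block sequences far out\<close>

context modified_norming_set
begin

lemma N_restr_le: "x \<in> c00 \<Longrightarrow> N (restr E x) \<le> N x"
  by (rule N_mono) (auto simp: restr_def)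

lemma N_unconditional:
  assumes "finite F" "disjoint_family_on (\<lambda>i. supp (u i)) F" "\<And>i. i \<in> F \<Longrightarrow> u i \<in> c00"
  shows "N (\<lambda>t. \<Sum>i\<in>F. sign S i * c i * u i t) \<le> N (\<lambda>t. \<Sum>i\<in>F. c i * u i t)"
proof (rule N_mono)
  show "(\<lambda>t. \<Sum>i\<in>F. c i * u i t) \<in> c00" using assms by (intro c00_lin_comb)
  show "\<bar>\<Sum>i\<in>F. sign S i * c i * u i t\<bar> \<le> \<bar>\<Sum>i\<in>F. c i * u i t\<bar>" for t
    unfolding disjoint_sum_abs[OF assms(1,2), of "\<lambda>i. sign S i * c i"]
      disjoint_sum_abs[OF assms(1,2)] by (simp add: abs_mult abs_sign)
qed

text \<open>This is the l1 spreading model: concavity applies since the blocks start no earlier than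
  their number, and disjointness makes the signs irrelevant to the modulus.\<close>

lemma N_sign_sum_lower:
  fixes \<alpha> :: real
  assumes F: "finite F" "\<And>i. i \<in> F \<Longrightarrow> card F \<le> i"
    and u: "\<And>i. i \<in> F \<Longrightarrow> u i \<in> c00" "\<And>i. i \<in> F \<Longrightarrow> supp (u i) \<subseteq> {i..}"
      "disjoint_family_on (\<lambda>i. supp (u i)) F" "\<And>i. i \<in> F \<Longrightarrow> \<alpha> \<le> N (u i)"
  shows "card F * \<alpha> / 32 \<le> N (\<lambda>t. \<Sum>i\<in>F. sign S i * u i t)"
proof -
  have "card F * \<alpha> = (\<Sum>i\<in>F. \<alpha>)" by simp
  also have "\<dots> \<le> (\<Sum>i\<in>F. N (u i))" using u(4) by (rule sum_mono)
  also have "\<dots> \<le> 32 * N (\<lambda>t. \<Sum>i\<in>F. \<bar>u i t\<bar>)"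
  proof (rule N_concave[OF F(1) le_refl u(1)])
    show "supp (u i) \<subseteq> {card F..}" if "i \<in> F" for i using u(2)[OF that] F(2)[OF that] by auto
  qed
  also have "N (\<lambda>t. \<Sum>i\<in>F. \<bar>u i t\<bar>) \<le> N (\<lambda>t. \<Sum>i\<in>F. sign S i * u i t)"
  proof (rule N_mono)
    show "(\<lambda>t. \<Sum>i\<in>F. sign S i * u i t) \<in> c00" using F u(1) by (intro c00_lin_comb)
    show "\<bar>\<Sum>i\<in>F. \<bar>u i t\<bar>\<bar> \<le> \<bar>\<Sum>i\<in>F. sign S i * u i t\<bar>" for t
      unfolding disjoint_sum_abs[OF F(1) u(3)] by (simp add: abs_mult abs_sign)
  qed
  finally show ?thesis by simp
qed

text \<open>The parts dominated by \<open>w\<close> and the parts before \<open>a\<close> contribute only \<open>O(R)\<close> to the average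
  over the signs, by orthogonality.\<close>

lemma sign_average_bound:
  fixes \<gamma> \<delta> \<kappa> \<tau> \<omega> :: real and a b :: nat
  assumes F: "finite F" "card F = R\<^sup>2" "2 ^ card F \<le> Suc b"
    and v: "\<And>i. i \<in> F \<Longrightarrow> v i \<in> c00" "\<And>i. i \<in> F \<Longrightarrow> supp (v i) \<inter> {a..b} = {}"
      "\<And>i. i \<in> F \<Longrightarrow> N (v i) \<le> \<kappa>" and "0 \<le> \<kappa>" and "a \<le> b"
    and lower: "\<And>S. S \<subseteq> F \<Longrightarrow> card F * \<gamma> \<le> N (\<lambda>t. \<Sum>i\<in>F. sign S i * v i t)"
    and w: "w \<in> c00" "\<And>t. 0 \<le> w t" "N w \<le> \<omega>" "0 \<le> \<tau>"
    and \<delta>: "\<And>i. i \<in> F \<Longrightarrow> N (restr {s. b < s \<and> \<tau> * w s < \<bar>v i s\<bar>} (v i)) \<le> \<delta>"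
  shows "(real R)\<^sup>2 * \<gamma> \<le> (real R)\<^sup>2 * \<delta> + R * (a * \<kappa> + 32 * (\<tau> * \<omega>))"
proof -
  \<comment> \<open>The gap leaves coordinates before \<open>a\<close> and after \<open>b\<close>;
    the latter are divided according to whether the multiple \<tau> of \<open>w\<close>
    dominates.\<close>
  define lo where "lo i = restr {..<a} (v i)" for i
  define big where "big i = restr {s. b < s \<and> \<tau> * w s < \<bar>v i s\<bar>} (v i)" for i
  define sm where "sm i = restr {s. b < s \<and> \<not> \<tau> * w s < \<bar>v i s\<bar>} (v i)" for i
  have c: "lo i \<in> c00" "big i \<in> c00" "sm i \<in> c00" if "i \<in> F" for i
    using v(1)[OF that] by (simp_all add: lo_def big_def sm_def restr_c00)
  have split: "v i t = lo i t + big i t + sm i t" if "i \<in> F" for i t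
  proof (cases "v i t = 0")
    case False
    then have "t \<notin> {a..b}" using v(2)[OF that] by (auto simp: supp_def)
    then have "t < a \<or> b < t" by auto
    then show ?thesis using \<open>a \<le> b\<close> by (auto simp: lo_def big_def sm_def restr_def)
  qed (simp add: lo_def big_def sm_def restr_def)
  let ?c = "\<lambda>S f t. \<Sum>i\<in>F. sign S i * f i t"
  have N3: "N (?c S v) \<le> N (?c S lo) + N (?c S big) + N (?c S sm)" for S
  proof -
    have "?c S v = (\<lambda>t. (?c S lo t + ?c S big t) + ?c S sm t)"
      using split by (simp add: fun_eq_iff sum.distrib[symmetric] distrib_left cong: sum.cong)
    then have "N (?c S v) = N (\<lambda>t. (?c S lo t + ?c S big t) + ?c S sm t)" by (rule arg_cong)
    also have "\<dots> \<le> N (\<lambda>t. ?c S lo t + ?c S big t) + N (?c S sm)"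
      using c F(1) by (intro N_add c00_add c00_lin_comb) auto
    also have "N (\<lambda>t. ?c S lo t + ?c S big t) \<le> N (?c S lo) + N (?c S big)"
      using c F(1) by (intro N_add c00_lin_comb) auto
    finally show ?thesis by simp
  qed
  have lo_sum: "(\<Sum>S\<in>Pow F. N (?c S lo)) \<le> 2 ^ card F * (R * (a * \<kappa>))"
  proof -
    \<comment> \<open>With only \<open>a\<close> coordinates, the l1 norm is a sufficient bound and
      reduces the estimate to scalars.\<close>
    have "N (?c S lo) \<le> (\<Sum>s<a. \<bar>?c S lo s\<bar>)" for S
    proof (rule N_le_sum)
      show "supp (?c S lo) \<subseteq> {..<a}"
      proof
        fix t assume "t \<in> supp (?c S lo)"
        then have "?c S lo t \<noteq> 0" by (simp add: supp_def)
        then obtain i where "sign S i * lo i t \<noteq> 0" by (rule sum.not_neutral_contains_not_neutral)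
        then show "t \<in> {..<a}" by (auto simp: lo_def restr_def split: if_splits)
      qed
    qed simp
    then have "(\<Sum>S\<in>Pow F. N (?c S lo)) \<le> (\<Sum>S\<in>Pow F. \<Sum>s<a. \<bar>?c S lo s\<bar>)" by (intro sum_mono)
    also have "\<dots> = (\<Sum>s<a. \<Sum>S\<in>Pow F. \<bar>?c S lo s\<bar>)" by (rule sum.swap)
    also have "\<dots> \<le> (\<Sum>s<a. 2 ^ card F * (R * \<kappa>))"
    proof (intro sum_mono sum_sign_abs_bound[OF F(1,2)])
      fix s i assume "i \<in> F"
      have "\<bar>lo i s\<bar> \<le> N (lo i)" using c(1)[OF \<open>i \<in> F\<close>] by (rule abs_le_N)
      also have "\<dots> \<le> N (v i)" unfolding lo_def using v(1)[OF \<open>i \<in> F\<close>] by (rule N_restr_le)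
      finally show "\<bar>lo i s\<bar> \<le> \<kappa>" using v(3)[OF \<open>i \<in> F\<close>] by simp
    qed (use \<open>0 \<le> \<kappa>\<close> in simp)
    finally show ?thesis by (simp add: ac_simps)
  qed
  have big_sum: "(\<Sum>S\<in>Pow F. N (?c S big)) \<le> 2 ^ card F * (R\<^sup>2 * \<delta>)"
  proof -
    have "N (?c S big) \<le> R\<^sup>2 * \<delta>" for S
    proof -
      have "N (?c S big) \<le> (\<Sum>i\<in>F. \<bar>sign S i\<bar> * N (big i))"
        using c(2) F(1) by (intro N_lin_comb)
      also have "\<dots> \<le> (\<Sum>i\<in>F. \<delta>)" using \<delta> by (intro sum_mono) (simp add: abs_sign big_def)
      finally show ?thesis using F(2) by simp
    qed
    then have "(\<Sum>S\<in>Pow F. N (?c S big)) \<le> (\<Sum>S\<in>Pow F. R\<^sup>2 * \<delta>)" by (rule sum_mono)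
    then show ?thesis using F(1) by (simp add: card_Pow)
  qed
  have sm_sum: "(\<Sum>S\<in>Pow F. N (?c S sm)) \<le> 2 ^ card F * (R * (32 * (\<tau> * \<omega>)))"
  proof -
    \<comment> \<open>Concavity moves the average over signs inside the norm, where the scalar
      estimate applies pointwise. It is available because all \<open>2 ^ card F\<close> vectors
      start after \<open>b\<close>.\<close>
    have "(\<Sum>S\<in>Pow F. N (?c S sm)) \<le> 32 * N (\<lambda>t. \<Sum>S\<in>Pow F. \<bar>?c S sm t\<bar>)"
    proof (rule N_concave[where q = "Suc b"])
      show "finite (Pow F)" "card (Pow F) \<le> Suc b" using F(1,3) by (simp_all add: card_Pow)
      show "?c S sm \<in> c00" for S using c(3) F(1) by (intro c00_lin_comb)
      show "supp (?c S sm) \<subseteq> {Suc b..}" for S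
      proof
        fix t assume "t \<in> supp (?c S sm)"
        then have "?c S sm t \<noteq> 0" by (simp add: supp_def)
        then obtain i where "sign S i * sm i t \<noteq> 0" by (rule sum.not_neutral_contains_not_neutral)
        then show "t \<in> {Suc b..}" by (auto simp: sm_def restr_def split: if_splits)
      qed
    qed
    also have "N (\<lambda>t. \<Sum>S\<in>Pow F. \<bar>?c S sm t\<bar>) \<le> N (\<lambda>t. (2 ^ card F * (R * \<tau>)) * w t)"
    proof (rule N_mono)
      show "(\<lambda>t. (2 ^ card F * (R * \<tau>)) * w t) \<in> c00" using w(1) by (rule c00_scale)
      fix t
      have "(\<Sum>S\<in>Pow F. \<bar>?c S sm t\<bar>) \<le> 2 ^ card F * (R * (\<tau> * w t))"
        using w(2,4) by (intro sum_sign_abs_bound[OF F(1,2)]) (auto simp: sm_def restr_def)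
      then show "\<bar>\<Sum>S\<in>Pow F. \<bar>?c S sm t\<bar>\<bar> \<le> \<bar>(2 ^ card F * (R * \<tau>)) * w t\<bar>"
        using w(2,4) by (simp add: sum_nonneg abs_mult ac_simps)
    qed
    also have "\<dots> = (2 ^ card F * (R * \<tau>)) * N w"
      using w(4) by (subst N_scale[OF w(1)]) (simp add: abs_mult)
    also have "\<dots> \<le> (2 ^ card F * (R * \<tau>)) * \<omega>" using w(3,4) by (intro mult_left_mono) auto
    finally show ?thesis by (simp add: ac_simps)
  qed
  have "(\<Sum>S\<in>Pow F. card F * \<gamma>) \<le> (\<Sum>S\<in>Pow F. N (?c S lo) + N (?c S big) + N (?c S sm))"
    using lower N3 by (intro sum_mono) (meson PowD order_trans)
  also have "\<dots> \<le> 2 ^ card F * (R * (a * \<kappa>)) + 2 ^ card F * (R\<^sup>2 * \<delta>) + 2 ^ card F * (R * (32 * (\<tau> * \<omega>)))"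
    unfolding sum.distrib using lo_sum big_sum sm_sum by linarith
  also have "\<dots> = 2 ^ card F * ((real R)\<^sup>2 * \<delta> + R * (a * \<kappa> + 32 * (\<tau> * \<omega>)))"
    by (simp add: algebra_simps)
  finally have "2 ^ card F * ((real R)\<^sup>2 * \<gamma>) \<le> 2 ^ card F * ((real R)\<^sup>2 * \<delta> + R * (a * \<kappa> + 32 * (\<tau> * \<omega>)))"
    using F(1,2) by (simp add: card_Pow)
  then show ?thesis by (rule mult_left_le_imp_le) simp
qed

end

lemma half_power_sum: "(\<Sum>i\<in>{r<..<n::nat}. (1 / 2) ^ i) \<le> (1 :: real)"
proof -
  \<comment> \<open>The range omits 0; restoring that term turns the bound 2 of the full geometric
    series into 1.\<close>
  have "(\<Sum>i\<in>insert 0 {r<..<n}. (1 / 2) ^ i) \<le> (\<Sum>i<Suc n. (1 / 2 :: real) ^ i)"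
    by (rule sum_mono2) auto
  also have "\<dots> \<le> 2" by (subst geometric_sum) auto
  finally show ?thesis by simp
qed

text \<open>Here \<open>v b i\<close> approximates the image of \<open>u i\<close> under an embedding that avoids \<open>[a, b]\<close>. A normalized
  block sequence has sign sums of norm at least \<open>1 / 64\<close> per term, so that parts of norm \<open>1 / 256\<close> can
  be selected; making them disjoint leaves \<open>1 / 512\<close>, and concavity turns this into the \<open>\<ell>\<^sub>1\<close> constant
  \<open>1 / 16384\<close>, half of which absorbs the error \<open>1 / 32768\<close>.\<close>

locale tail_copies = modified_norming_set +
  fixes u :: "nat \<Rightarrow> nat \<Rightarrow> real" and v :: "nat \<Rightarrow> nat \<Rightarrow> nat \<Rightarrow> real" and K :: real and a :: nat
  assumes K: "1 \<le> K"
    and u_c00: "u i \<in> c00" and u_supp: "supp (u i) \<subseteq> {i..}"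
    and u_disjoint: "disjoint_family (\<lambda>i. supp (u i))"
    and u_norm: "1 / 2 \<le> N (u i)" "N (u i) \<le> 2"
    and v_c00: "a \<le> b \<Longrightarrow> v b i \<in> c00" and v_supp: "a \<le> b \<Longrightarrow> supp (v b i) \<inter> {a..b} = {}"
    and v_upper: "a \<le> b \<Longrightarrow> finite F \<Longrightarrow>
      N (\<lambda>t. \<Sum>i\<in>F. c i * v b i t) \<le> K * N (\<lambda>t. \<Sum>i\<in>F. c i * u i t) + (\<Sum>i\<in>F. \<bar>c i\<bar>) / 32768"
    and v_lower: "a \<le> b \<Longrightarrow> finite F \<Longrightarrow>
      N (\<lambda>t. \<Sum>i\<in>F. c i * u i t) \<le> N (\<lambda>t. \<Sum>i\<in>F. c i * v b i t) + (\<Sum>i\<in>F. \<bar>c i\<bar>) / 32768"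
begin

definition \<kappa> :: real where "\<kappa> = 2 * K + 1"

lemma \<kappa>_pos: "0 < \<kappa>"
  using K by (simp add: \<kappa>_def)

lemma v_norm: "a \<le> b \<Longrightarrow> N (v b i) \<le> \<kappa>"
proof -
  assume "a \<le> b"
  then have "N (v b i) \<le> K * N (u i) + 1 / 32768" using v_upper[of b "{i}" "\<lambda>_. 1"] by simp
  moreover have "K * N (u i) \<le> K * 2" using K u_norm by (intro mult_left_mono) auto
  ultimately show ?thesis by (simp add: \<kappa>_def)
qed

text \<open>On this set the images indexed by \<open>Q\<close> are smaller than the present one by
  the factor \<tau>, so a large \<tau> makes them negligible there.\<close>

definition large_part :: "real \<Rightarrow> nat set \<Rightarrow> nat \<Rightarrow> nat \<Rightarrow> nat set" where
  "large_part \<tau> Q b i = {s. b < s \<and> \<tau> * (\<Sum>j\<in>Q. \<bar>v b j s\<bar>) < \<bar>v b i s\<bar>}"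

text \<open>If every large part were small, the sign average would be at least
  \<open>card F / 128\<close> by the spreading model but at most \<open>card F / 256\<close> plus a
  term linear in \<open>R\<close>. The set \<open>F\<close> is chosen independently of
  \<open>b\<close>, which the later pigeonhole needs.\<close>

lemma large_part_candidates:
  assumes "finite Q" "0 \<le> \<tau>"
  shows "\<exists>F B. finite F \<and> F \<subseteq> {m..} \<and> a \<le> B \<and>
    (\<forall>b\<ge>B. \<exists>i\<in>F. 1 / 256 < N (restr (large_part \<tau> Q b i) (v b i)))"
proof -
  define \<omega> where "\<omega> = card Q * \<kappa>"
  obtain R :: nat where R: "256 * (a * \<kappa> + 32 * (\<tau> * \<omega>)) < R" using reals_Archimedean2 by blast
  have "0 \<le> 256 * (a * \<kappa> + 32 * (\<tau> * \<omega>))" using assms(2) \<kappa>_pos by (simp add: \<omega>_def)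
  then have R0: "0 < real R" using R by linarith
  \<comment> \<open>Starting at \<open>R\<^sup>2\<close> or later makes \<open>card F\<close> a
    lower bound for all indices, as the spreading model requires.\<close>
  define F where "F = {max m (R\<^sup>2)..<max m (R\<^sup>2) + R\<^sup>2}"
  have F: "finite F" "card F = R\<^sup>2" "F \<subseteq> {m..}" "\<And>i. i \<in> F \<Longrightarrow> card F \<le> i" by (auto simp: F_def)
  have "\<exists>i\<in>F. 1 / 256 < N (restr (large_part \<tau> Q b i) (v b i))" if b: "max a (2 ^ card F) \<le> b" for b
  proof (rule ccontr)
    assume "\<not> ?thesis"
    then have small: "N (restr (large_part \<tau> Q b i) (v b i)) \<le> 1 / 256" if "i \<in> F" for i
      using that by (meson not_le)
    have ab: "a \<le> b" and b2: "2 ^ card F \<le> Suc b" using b by auto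
    let ?w = "\<lambda>s. \<Sum>j\<in>Q. \<bar>v b j s\<bar>"
    have "(real R)\<^sup>2 * (1 / 128) \<le> (real R)\<^sup>2 * (1 / 256) + R * (a * \<kappa> + 32 * (\<tau> * \<omega>))"
    proof (rule sign_average_bound[OF F(1,2) b2, where v = "v b" and w = ?w])
      show "card F * (1 / 128) \<le> N (\<lambda>t. \<Sum>i\<in>F. sign S i * v b i t)" for S
      proof -
        \<comment> \<open>Per index, the spreading model gives 1/64; after the approximation error
          1/32768 more than 1/128 remains.\<close>
        have "card F * (1 / 2) / 32 \<le> N (\<lambda>t. \<Sum>i\<in>F. sign S i * u i t)"
          using F(1,4) u_c00 u_supp u_norm(1) u_disjoint
          by (intro N_sign_sum_lower) (auto simp: disjoint_family_on_def)
        also have "\<dots> \<le> N (\<lambda>t. \<Sum>i\<in>F. sign S i * v b i t) + card F / 32768"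
          using v_lower[OF ab F(1), of "sign S"] by (simp add: abs_sign)
        finally show ?thesis by simp
      qed
      show "?w \<in> c00" using assms(1) v_c00[OF ab] by (intro c00_sum c00_abs)
      have "N ?w \<le> (\<Sum>j\<in>Q. N (\<lambda>s. \<bar>v b j s\<bar>))" using assms(1) v_c00[OF ab] by (intro N_sum c00_abs)
      also have "\<dots> \<le> (\<Sum>j\<in>Q. \<kappa>)"
      proof (rule sum_mono)
        fix j
        have "N (\<lambda>s. \<bar>v b j s\<bar>) \<le> N (v b j)" by (rule N_mono[OF v_c00[OF ab]]) simp
        then show "N (\<lambda>s. \<bar>v b j s\<bar>) \<le> \<kappa>" using v_norm[OF ab] by (rule order_trans)
      qed
      finally show "N ?w \<le> \<omega>" by (simp add: \<omega>_def)
      show "N (restr {s. b < s \<and> \<tau> * ?w s < \<bar>v b i s\<bar>} (v b i)) \<le> 1 / 256" if "i \<in> F" for i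
        using small[OF that] by (simp add: large_part_def)
    qed (use v_c00[OF ab] v_supp[OF ab] v_norm[OF ab] ab assms(2) \<kappa>_pos in \<open>auto simp: sum_nonneg\<close>)
    then have "R * (real R / 256) \<le> R * (a * \<kappa> + 32 * (\<tau> * \<omega>))" by (simp add: power2_eq_square)
    then have "real R / 256 \<le> a * \<kappa> + 32 * (\<tau> * \<omega>)" using R0 by (rule mult_left_le_imp_le)
    then show False using R by simp
  qed
  then show ?thesis using F(1,3) by (intro exI[of _ F] exI[of _ "max a (2 ^ card F)"]) auto
qed

text \<open>Chosen so that an earlier image, whose comparison vector has norm at most \<kappa>,
  keeps norm at most \<open>(1 / 2) ^ r / 512\<close> on the part selected at stage
  \<open>r\<close>. These errors sum to at most 1/512.\<close>

definition threshold :: "nat \<Rightarrow> real" where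
  "threshold r = 512 * 2 ^ r * \<kappa>"

text \<open>The large parts vary with \<open>b\<close>, but the indices must not. At each stage
  finitely many candidates serve all late \<open>b\<close>, so one of them serves infinitely many of
  the \<open>b\<close> still in use.\<close>

lemma selection:
  "\<exists>\<iota>. strict_mono \<iota> \<and> (\<forall>n. infinite {b. a \<le> b \<and>
    (\<forall>r<n. 1 / 256 < N (restr (large_part (threshold r) (\<iota> ` {..<r}) b (\<iota> r)) (v b (\<iota> r))))})"
proof -
  define G where "G b r Q i \<longleftrightarrow> 1 / 256 < N (restr (large_part (threshold r) Q b i) (v b i))" for b r Q i
  \<comment> \<open>The state of the recursion is the list of indices chosen so far; the prefix
    \<open>take r xs\<close> is what stage \<open>r\<close> had to dominate.\<close>
  define P where "P n xs \<longleftrightarrow> length xs = n \<and>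
    infinite {b. a \<le> b \<and> (\<forall>r<n. G b r (set (take r xs)) (xs ! r))}" for n xs
  have "\<exists>f. \<forall>n. P n (f n) \<and> (\<exists>i. f (Suc n) = f n @ [i] \<and> (\<forall>j\<in>set (f n). j < i))"
  proof (rule dependent_nat_choice)
    have "{b. a \<le> b} = {a..}" by auto
    then show "\<exists>xs. P 0 xs" by (intro exI[of _ "[]"]) (simp add: P_def infinite_Ici)
    fix xs n assume xs: "P n xs"
    define m where "m = Suc (Max (insert 0 (set xs)))"
    have m: "j < i" if "j \<in> set xs" "m \<le> i" for i j
    proof -
      have "j \<le> Max (insert 0 (set xs))" by (rule Max_ge) (use that in auto)
      then show ?thesis using that(2) by (simp add: m_def)
    qed
    obtain F B where F: "finite F" "F \<subseteq> {m..}" "\<And>b. B \<le> b \<Longrightarrow> \<exists>i\<in>F. G b n (set xs) i"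
      using large_part_candidates[of "set xs" "threshold n" m] \<kappa>_pos
      unfolding G_def threshold_def by auto
    define I where "I = {b. a \<le> b \<and> (\<forall>r<n. G b r (set (take r xs)) (xs ! r))}"
    have inf: "infinite (I - {..<B})" using xs unfolding P_def I_def by (intro Diff_infinite_finite) auto
    have "\<forall>b\<in>I - {..<B}. \<exists>i\<in>F. G b n (set xs) i" using F(3) by auto
    \<comment> \<open>One candidate is kept together with an infinite subset of the former values of
      \<open>b\<close>.\<close>
    from pigeonhole_infinite_rel[OF inf F(1) this] obtain i where i: "i \<in> F" "infinite {b\<in>I - {..<B}. G b n (set xs) i}"
      by blast
    have "{b\<in>I - {..<B}. G b n (set xs) i} \<subseteq>
      {b. a \<le> b \<and> (\<forall>r<Suc n. G b r (set (take r (xs @ [i]))) ((xs @ [i]) ! r))}"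
      using xs by (auto simp: I_def P_def less_Suc_eq nth_append)
    then have "P (Suc n) (xs @ [i])"
      using i(2) xs finite_subset unfolding P_def by auto
    then show "\<exists>ys. P (Suc n) ys \<and> (\<exists>i. ys = xs @ [i] \<and> (\<forall>j\<in>set xs. j < i))"
      using m i(1) F(2) by (intro exI[of _ "xs @ [i]"]) auto
  qed
  then obtain f where f: "\<And>n. P n (f n)" "\<And>n. \<exists>i. f (Suc n) = f n @ [i] \<and> (\<forall>j\<in>set (f n). j < i)"
    by blast
  define \<iota> where "\<iota> n = f (Suc n) ! n" for n
  have len: "length (f n) = n" for n using f(1) by (simp add: P_def)
  have fS: "f (Suc n) = f n @ [\<iota> n]" and lt: "j \<in> set (f n) \<Longrightarrow> j < \<iota> n" for n j
    using f(2)[of n] len[of n] unfolding \<iota>_def by (auto simp: nth_append)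
  have f_map: "f n = map \<iota> [0..<n]" for n
    by (induction n) (use len[of 0] fS in auto)
  have "strict_mono \<iota>"
    unfolding strict_mono_Suc_iff
  proof
    fix n
    show "\<iota> n < \<iota> (Suc n)" by (rule lt) (simp add: fS)
  qed
  moreover have "infinite {b. a \<le> b \<and> (\<forall>r<n. G b r (\<iota> ` {..<r}) (\<iota> r))}" for n
  proof -
    have "set (take r (f n)) = \<iota> ` {..<r}" "f n ! r = \<iota> r" if "r < n" for r
      using that by (simp_all add: f_map take_map lessThan_atLeast0)
    then have "{b. a \<le> b \<and> (\<forall>r<n. G b r (\<iota> ` {..<r}) (\<iota> r))}
        = {b. a \<le> b \<and> (\<forall>r<n. G b r (set (take r (f n))) (f n ! r))}" by auto
    then show ?thesis using f(1)[of n] by (simp add: P_def)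
  qed
  ultimately show ?thesis unfolding G_def by blast
qed

text \<open>All later parts are removed from each part. On a later part the earlier image is tiny by
  the choice of \<open>threshold\<close>, so at most 1/512 of the norm 1/256 is lost.\<close>

lemma disjoint_parts:
  assumes ab: "a \<le> b"
    and large: "\<And>r. r < n \<Longrightarrow>
      1 / 256 < N (restr (large_part (threshold r) (\<iota> ` {..<r}) b (\<iota> r)) (v b (\<iota> r)))"
  obtains E where "disjoint_family_on E {..<n}" "\<And>r. r < n \<Longrightarrow> E r \<subseteq> {Suc b..}"
    "\<And>r. r < n \<Longrightarrow> 1 / 512 \<le> N (restr (E r) (v b (\<iota> r)))"
proof -
  define E where "E r = large_part (threshold r) (\<iota> ` {..<r}) b (\<iota> r)" for r
  define E' where "E' r = E r - (\<Union>r'\<in>{r<..<n}. E r')" for r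
  define V where "V r = v b (\<iota> r)" for r
  have V: "V r \<in> c00" "N (V r) \<le> \<kappa>" for r using v_c00[OF ab] v_norm[OF ab] by (simp_all add: V_def)
  have later: "N (restr (E r') (V r)) \<le> (1 / 2) ^ r' / 512" if "r < r'" for r r'
  proof -
    have t: "0 < threshold r'" using \<kappa>_pos by (simp add: threshold_def)
    have "N (restr (E r') (V r)) \<le> N (\<lambda>s. 1 / threshold r' * V r' s)"
    proof (rule N_mono)
      show "(\<lambda>s. 1 / threshold r' * V r' s) \<in> c00" using V(1) by (rule c00_scale)
      fix s
      show "\<bar>restr (E r') (V r) s\<bar> \<le> \<bar>1 / threshold r' * V r' s\<bar>"
      proof (cases "s \<in> E r'")
        case True
        have "threshold r' * \<bar>V r s\<bar> \<le> threshold r' * (\<Sum>j\<in>\<iota> ` {..<r'}. \<bar>v b j s\<bar>)"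
          using t that unfolding V_def by (intro mult_left_mono member_le_sum) auto
        also have "\<dots> < \<bar>V r' s\<bar>" using True by (simp add: E_def large_part_def V_def)
        finally show ?thesis using t True by (simp add: restr_def field_simps abs_mult)
      qed (simp add: restr_def)
    qed
    also have "\<dots> = 1 / threshold r' * N (V r')" using t by (subst N_scale[OF V(1)]) simp
    also have "\<dots> \<le> 1 / threshold r' * \<kappa>" using t V(2) by (intro mult_left_mono) auto
    also have "\<dots> = (1 / 2) ^ r' / 512" using \<kappa>_pos by (simp add: threshold_def power_divide)
    finally show ?thesis .
  qed
  have "1 / 512 \<le> N (restr (E' r) (V r))" if r: "r < n" for r
  proof -
    let ?L = "\<lambda>s. \<Sum>r'\<in>{r<..<n}. \<bar>restr (E r') (V r) s\<bar>"
    have c: "(\<lambda>s. \<bar>restr (E' r) (V r) s\<bar>) \<in> c00" "?L \<in> c00"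
      using V(1) by (auto intro!: c00_abs c00_sum restr_c00)
    have abs: "N (\<lambda>s. \<bar>restr X (V r) s\<bar>) \<le> N (restr X (V r))" for X
      using V(1) by (intro N_mono restr_c00) simp_all
    have "1 / 256 \<le> N (restr (E r) (V r))" using large[OF r] by (simp add: E_def V_def)
    also have "\<dots> \<le> N (\<lambda>s. \<bar>restr (E' r) (V r) s\<bar> + ?L s)"
    proof (rule N_mono)
      show "(\<lambda>s. \<bar>restr (E' r) (V r) s\<bar> + ?L s) \<in> c00" using c by (rule c00_add)
      fix s
      have "\<bar>restr (E r) (V r) s\<bar> \<le> \<bar>restr (E' r) (V r) s\<bar> + ?L s"
      proof (cases "s \<in> E r \<and> s \<notin> E' r")
        case True
        then obtain r' where r': "r' \<in> {r<..<n}" "s \<in> E r'" by (auto simp: E'_def)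
        have "\<bar>restr (E r') (V r) s\<bar> \<le> ?L s" using r'(1) by (intro member_le_sum) auto
        then show ?thesis using True r'(2) by (simp add: restr_def)
      next
        case False
        have "0 \<le> ?L s" by (simp add: sum_nonneg)
        then show ?thesis using False by (auto simp: restr_def)
      qed
      then show "\<bar>restr (E r) (V r) s\<bar> \<le> \<bar>\<bar>restr (E' r) (V r) s\<bar> + ?L s\<bar>" by linarith
    qed
    also have "\<dots> \<le> N (\<lambda>s. \<bar>restr (E' r) (V r) s\<bar>) + N ?L" using c by (rule N_add)
    also have "N ?L \<le> (\<Sum>r'\<in>{r<..<n}. N (\<lambda>s. \<bar>restr (E r') (V r) s\<bar>))"
      using V(1) by (intro N_sum) (auto intro!: c00_abs restr_c00)
    also have "\<dots> \<le> (\<Sum>r'\<in>{r<..<n}. (1 / 2) ^ r' / 512)"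
      by (intro sum_mono order_trans[OF abs later]) simp
    also have "\<dots> \<le> 1 / 512"
      using half_power_sum[of r n] by (simp add: sum_divide_distrib[symmetric])
    finally show ?thesis using abs[of "E' r"] by linarith
  qed
  moreover have "disjoint_family_on E' {..<n}"
    unfolding disjoint_family_on_def
  proof (intro ballI impI)
    fix r r' assume "r \<in> {..<n}" "r' \<in> {..<n}" "r \<noteq> r'"
    then have "r' \<in> {r<..<n} \<or> r \<in> {r'<..<n}" by auto
    then show "E' r \<inter> E' r' = {}" unfolding E'_def by blast
  qed
  moreover have "E' r \<subseteq> {Suc b..}" for r by (auto simp: E'_def E_def large_part_def)
  ultimately show ?thesis using that unfolding V_def by blast
qed

text \<open>Averaging the sign sums \<open>x S\<close> against the sign of \<open>r\<close> leaves
  only the image with coefficient \<open>c r\<close>, so on average \<open>x S\<close> is large on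
  every \<open>E r\<close>. Concavity adds these \<open>n\<close> disjoint parts, and
  \<open>v_upper\<close> with unconditionality bounds all \<open>x S\<close> by one combination of
  \<open>u\<close>.\<close>

lemma l1_lower_bound:
  assumes \<iota>: "strict_mono \<iota>" and ab: "a \<le> b" "n \<le> b"
    and E: "disjoint_family_on E {..<n}" "\<And>r. r < n \<Longrightarrow> E r \<subseteq> {Suc b..}"
    "\<And>r. r < n \<Longrightarrow> 1 / 512 \<le> N (restr (E r) (v b (\<iota> r)))"
  shows "(\<Sum>r<n. \<bar>c r\<bar>) / (32768 * K) \<le> N (\<lambda>t. \<Sum>r<n. c r * u (\<iota> r) t)"
proof -
  have inj: "inj \<iota>" using \<iota> by (rule strict_mono_imp_inj_on)
  \<comment> \<open>The coefficients are transported to the original numbering, in which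
    \<open>v_upper\<close> is formulated.\<close>
  define c' where "c' i = c (inv \<iota> i)" for i
  have reindex: "(\<Sum>i\<in>\<iota> ` {..<n}. c' i * x i) = (\<Sum>r<n. c r * x (\<iota> r))" for x :: "nat \<Rightarrow> real"
    using inj by (subst sum.reindex) (auto simp: c'_def inj_on_def)
  have reindex_abs: "(\<Sum>i\<in>\<iota> ` {..<n}. \<bar>c' i\<bar>) = (\<Sum>r<n. \<bar>c r\<bar>)"
    using inj by (subst sum.reindex) (auto simp: c'_def inj_on_def)
  let ?U = "N (\<lambda>t. \<Sum>r<n. c r * u (\<iota> r) t)"
  let ?s = "\<Sum>r<n. \<bar>c r\<bar>"
  define V where "V r = v b (\<iota> r)" for r
  have V: "V r \<in> c00" for r using v_c00[OF ab(1)] by (simp add: V_def)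
  define x where "x S = (\<lambda>t. \<Sum>r<n. sign S r * (c r * V r t))" for S
  have x00: "x S \<in> c00" for S
    using V c00_lin_comb[of "{..<n}" V "\<lambda>r. sign S r * c r"] by (simp add: x_def mult.assoc)
  have upper: "N (x S) \<le> K * ?U + ?s / 32768" for S
  proof -
    define S' where "S' = \<iota> ` S"
    have sS': "sign S' (\<iota> r) = sign S r" for r using inj by (auto simp: sign_def S'_def inj_def)
    have d: "disjoint_family_on (\<lambda>i. supp (u i)) (\<iota> ` {..<n})"
      using u_disjoint by (auto simp: disjoint_family_on_def)
    have r2: "(\<Sum>i\<in>\<iota> ` {..<n}. sign S' i * c' i * y i) = (\<Sum>r<n. sign S r * (c r * y (\<iota> r)))"
      for y :: "nat \<Rightarrow> real"
      using inj by (subst sum.reindex) (auto simp: c'_def inj_on_def sS' mult.assoc)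
    have "N (x S) = N (\<lambda>t. \<Sum>i\<in>\<iota> ` {..<n}. sign S' i * c' i * v b i t)"
      by (simp add: r2 x_def V_def)
    also have "\<dots> \<le> K * N (\<lambda>t. \<Sum>i\<in>\<iota> ` {..<n}. sign S' i * c' i * u i t)
        + (\<Sum>i\<in>\<iota> ` {..<n}. \<bar>sign S' i * c' i\<bar>) / 32768"
      by (rule v_upper[OF ab(1)]) simp
    also have "(\<Sum>i\<in>\<iota> ` {..<n}. \<bar>sign S' i * c' i\<bar>) = ?s"
      using reindex_abs by (simp add: abs_mult abs_sign)
    also have "N (\<lambda>t. \<Sum>i\<in>\<iota> ` {..<n}. sign S' i * c' i * u i t) \<le> N (\<lambda>t. \<Sum>i\<in>\<iota> ` {..<n}. c' i * u i t)"
      using d u_c00 by (intro N_unconditional) auto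
    also have "(\<lambda>t. \<Sum>i\<in>\<iota> ` {..<n}. c' i * u i t) = (\<lambda>t. \<Sum>r<n. c r * u (\<iota> r) t)"
      by (simp add: reindex)
    finally show ?thesis using K by (simp add: mult_left_mono)
  qed
  have lower: "(\<Sum>r<n. N (restr (E r) (x S))) \<le> 32 * N (x S)" for S
  proof -
    have "(\<Sum>r<n. N (restr (E r) (x S))) \<le> 32 * N (\<lambda>t. \<Sum>r<n. \<bar>restr (E r) (x S) t\<bar>)"
    \<comment> \<open>The hypothesis \<open>n \<le> b\<close> is what permits \<open>n\<close>
      summands here.\<close>
    proof (rule N_concave[where q = "Suc b"])
      show "supp (restr (E r) (x S)) \<subseteq> {Suc b..}" if "r \<in> {..<n}" for r
        using E(2)[of r] that by (auto simp: supp_restr)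
    qed (use ab(2) x00 restr_c00 in auto)
    also have "N (\<lambda>t. \<Sum>r<n. \<bar>restr (E r) (x S) t\<bar>) \<le> N (x S)"
    proof (rule N_mono[OF x00])
      fix t
      have "disjoint_family_on (\<lambda>r. supp (restr (E r) (x S))) {..<n}"
        using E(1) unfolding disjoint_family_on_def supp_restr by blast
      then have "(\<Sum>r<n. \<bar>1 * restr (E r) (x S) t\<bar>) = \<bar>\<Sum>r<n. 1 * restr (E r) (x S) t\<bar>"
        by (intro disjoint_sum_abs[symmetric]) auto
      moreover have "\<bar>\<Sum>r<n. 1 * restr (E r) (x S) t\<bar> \<le> \<bar>x S t\<bar>"
      proof (cases "\<exists>r<n. t \<in> E r")
        case True
        then obtain r where r: "r < n" "t \<in> E r" by blast
        have "restr (E r') (x S) t = 0" if "r' \<in> {..<n} - {r}" for r'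
        proof -
          have "E r' \<inter> E r = {}" using E(1) that r(1) unfolding disjoint_family_on_def by blast
          then show ?thesis using r(2) by (auto simp: restr_def)
        qed
        then have "(\<Sum>r<n. 1 * restr (E r) (x S) t) = restr (E r) (x S) t"
          using r(1) by (subst sum.remove[of _ r]) auto
        then show ?thesis by (simp add: restr_def)
      next
        case False
        then have "(\<Sum>r<n. 1 * restr (E r) (x S) t) = 0" by (intro sum.neutral) (auto simp: restr_def)
        then show ?thesis by simp
      qed
      ultimately show "\<bar>\<Sum>r<n. \<bar>restr (E r) (x S) t\<bar>\<bar> \<le> \<bar>x S t\<bar>" by simp
    qed
    finally show ?thesis by simp
  qed
  have single: "2 ^ n * (\<bar>c r\<bar> / 512) \<le> (\<Sum>S\<in>Pow {..<n}. N (restr (E r) (x S)))" if r: "r < n" for r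
  proof -
    have "2 ^ n * (\<bar>c r\<bar> * (1 / 512)) \<le> 2 ^ n * (\<bar>c r\<bar> * N (restr (E r) (V r)))"
      using E(3)[OF r] unfolding V_def by (intro mult_left_mono) auto
    also have "\<dots> = N (\<lambda>t. (2 ^ n * c r) * restr (E r) (V r) t)"
      using V by (subst N_scale) (auto simp: restr_c00 abs_mult)
    also have "(\<lambda>t. (2 ^ n * c r) * restr (E r) (V r) t)
        = (\<lambda>t. \<Sum>S\<in>Pow {..<n}. sign S r * restr (E r) (x S) t)"
    proof
      fix t
      have "(\<Sum>S\<in>Pow {..<n}. sign S r * x S t) = 2 ^ n * (c r * V r t)"
        unfolding x_def using sum_sign_coefficient[of "{..<n}" r "\<lambda>r. c r * V r t"] r by simp
      then show "(2 ^ n * c r) * restr (E r) (V r) t = (\<Sum>S\<in>Pow {..<n}. sign S r * restr (E r) (x S) t)"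
        by (cases "t \<in> E r") (simp_all add: restr_def mult.assoc)
    qed
    also have "N \<dots> \<le> (\<Sum>S\<in>Pow {..<n}. \<bar>sign S r\<bar> * N (restr (E r) (x S)))"
      using x00 by (intro N_lin_comb restr_c00) auto
    finally show ?thesis by (simp add: abs_sign)
  qed
  have "2 ^ n * (?s / 512) = (\<Sum>r<n. 2 ^ n * (\<bar>c r\<bar> / 512))"
    by (simp add: sum_distrib_left sum_divide_distrib)
  also have "\<dots> \<le> (\<Sum>r<n. \<Sum>S\<in>Pow {..<n}. N (restr (E r) (x S)))"
    using single by (intro sum_mono) auto
  also have "\<dots> = (\<Sum>S\<in>Pow {..<n}. \<Sum>r<n. N (restr (E r) (x S)))" by (rule sum.swap)
  also have "\<dots> \<le> (\<Sum>S\<in>Pow {..<n}. 32 * (K * ?U + ?s / 32768))"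
    by (intro sum_mono order_trans[OF lower] mult_left_mono upper) simp
  also have "\<dots> = 2 ^ n * (32 * (K * ?U + ?s / 32768))" by (simp add: card_Pow)
  \<comment> \<open>Division by 32 turns 1/512 into 1/16384, and the error 1/32768 takes half of
    it.\<close>
  finally have "?s / 512 \<le> 32 * (K * ?U + ?s / 32768)" by (rule mult_left_le_imp_le) simp
  then have "?s / 32768 \<le> K * ?U" by (simp add: field_simps)
  then show ?thesis using K by (simp add: field_simps)
qed

end

section \<open>The l1 subsequence against small convex combinations\<close>

context tail_copies
begin

lemma contradiction: False
proof -
  obtain \<iota> where \<iota>: "strict_mono \<iota>" and inf: "\<And>n. infinite {b. a \<le> b \<and>
    (\<forall>r<n. 1 / 256 < N (restr (large_part (threshold r) (\<iota> ` {..<r}) b (\<iota> r)) (v b (\<iota> r))))}"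
    using selection by blast
  have l1: "(\<Sum>r<n. \<bar>c r\<bar>) / (32768 * K) \<le> N (\<lambda>t. \<Sum>r<n. c r * u (\<iota> r) t)" for n c
  proof -
    \<comment> \<open>The gap depends on \<open>n\<close>, but the resulting bound does not, so it
      holds for combinations of any length.\<close>
    obtain b where b: "n \<le> b" "a \<le> b"
      "\<And>r. r < n \<Longrightarrow> 1 / 256 < N (restr (large_part (threshold r) (\<iota> ` {..<r}) b (\<iota> r)) (v b (\<iota> r)))"
      using inf[of n] unfolding infinite_nat_iff_unbounded_le by blast
    obtain E where "disjoint_family_on E {..<n}" "\<And>r. r < n \<Longrightarrow> E r \<subseteq> {Suc b..}"
      "\<And>r. r < n \<Longrightarrow> 1 / 512 \<le> N (restr (E r) (v b (\<iota> r)))"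
      using disjoint_parts[of b n \<iota>] b(2,3) by blast
    then show ?thesis by (rule l1_lower_bound[OF \<iota> b(2,1)])
  qed
  \<comment> \<open>Coefficients vanish from \<open>n\<close> on, so combinations of different
    lengths can be rewritten with a common length.\<close>
  define C where "C = {\<lambda>t. \<Sum>r<n. c r * u (\<iota> r) t | n c.
    (\<forall>r. 0 \<le> c r) \<and> (\<forall>r\<ge>n. c r = 0) \<and> (\<Sum>r<n. c r) = 1}"
  interpret convex_block_set W C 2
  proof unfold_locales
    show "C \<subseteq> c00" using u_c00 by (auto simp: C_def intro!: c00_lin_comb)
    fix x assume "x \<in> C"
    then obtain n c where c: "x = (\<lambda>t. \<Sum>r<n. c r * u (\<iota> r) t)" "\<forall>r. 0 \<le> c r" "(\<Sum>r<n. c r) = 1"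
      unfolding C_def by blast
    have "N x \<le> (\<Sum>r<n. \<bar>c r\<bar> * N (u (\<iota> r)))" unfolding c(1) using u_c00 by (intro N_lin_comb) auto
    also have "\<dots> \<le> (\<Sum>r<n. c r * 2)" using c(2) u_norm(2) N_nonneg by (intro sum_mono mult_mono) auto
    finally show "N x \<le> 2" using c(3) by (simp add: sum_distrib_right[symmetric])
  next
    fix I :: "nat set" and z a
    assume I: "finite I" "\<And>i. i \<in> I \<Longrightarrow> z i \<in> C" "\<And>i. i \<in> I \<Longrightarrow> 0 \<le> a i" "sum a I = (1 :: real)"
    have "\<forall>i\<in>I. \<exists>n c. z i = (\<lambda>t. \<Sum>r<n. c r * u (\<iota> r) t) \<and> (\<forall>r. 0 \<le> c r) \<and> (\<forall>r\<ge>n. c r = 0) \<and> (\<Sum>r<n. c r) = 1"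
      using I(2) unfolding C_def by blast
    then obtain n c where nc: "\<forall>i\<in>I. z i = (\<lambda>t. \<Sum>r<n i. c i r * u (\<iota> r) t) \<and> (\<forall>r. 0 \<le> c i r) \<and>
        (\<forall>r\<ge>n i. c i r = 0) \<and> (\<Sum>r<n i. c i r) = 1"
      unfolding bchoice_iff by (elim exE) (rule that)
    define m where "m = (\<Sum>i\<in>I. n i)"
    have m: "n i \<le> m" if "i \<in> I" for i unfolding m_def using I(1) that by (intro member_le_sum) auto
    have ext: "(\<Sum>r<n i. c i r * y r) = (\<Sum>r<m. c i r * y r)" if i: "i \<in> I" for i and y :: "nat \<Rightarrow> real"
      using m[OF i] nc i by (intro sum.mono_neutral_left) auto
    define d where "d r = (\<Sum>i\<in>I. a i * c i r)" for r
    have "(\<Sum>i\<in>I. a i * z i t) = (\<Sum>r<m. d r * u (\<iota> r) t)" for t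
    proof -
      have "(\<Sum>i\<in>I. a i * z i t) = (\<Sum>i\<in>I. a i * (\<Sum>r<m. c i r * u (\<iota> r) t))"
        using nc ext by (intro sum.cong) auto
      also have "\<dots> = (\<Sum>i\<in>I. \<Sum>r<m. a i * c i r * u (\<iota> r) t)"
        by (simp add: sum_distrib_left mult.assoc)
      also have "\<dots> = (\<Sum>r<m. \<Sum>i\<in>I. a i * c i r * u (\<iota> r) t)" by (rule sum.swap)
      finally show ?thesis by (simp add: d_def sum_distrib_right)
    qed
    moreover have "\<forall>r. 0 \<le> d r" using I(3) nc by (auto simp: d_def intro!: sum_nonneg)
    moreover have "\<forall>r\<ge>m. d r = 0"
    proof (intro allI impI)
      fix r assume "m \<le> r"
      then have "c i r = 0" if "i \<in> I" for i using m[OF that] nc that by simp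
      then show "d r = 0" by (simp add: d_def)
    qed
    moreover have "(\<Sum>r<m. d r) = 1"
    proof -
      have "(\<Sum>r<m. d r) = (\<Sum>i\<in>I. a i * (\<Sum>r<m. c i r))"
        unfolding d_def sum_distrib_left by (rule sum.swap)
      also have "\<dots> = (\<Sum>i\<in>I. a i * 1)"
        using nc ext[of _ "\<lambda>_. 1"] by (intro sum.cong) auto
      finally show ?thesis using I(4) by simp
    qed
    ultimately show "(\<lambda>t. \<Sum>i\<in>I. a i * z i t) \<in> C"
      unfolding C_def mem_Collect_eq by (intro exI[of _ m] exI[of _ d]) auto
  next
    fix q
    have "(\<lambda>t. \<Sum>r<Suc q. (if r = q then 1 else 0) * u (\<iota> r) t) \<in> C"
      unfolding C_def mem_Collect_eq
      by (intro exI[of _ "Suc q"] exI[of _ "\<lambda>r. if r = q then 1 else 0"]) auto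
    moreover have "(\<lambda>t. \<Sum>r<Suc q. (if r = q then 1 else 0) * u (\<iota> r) t) = u (\<iota> q)"
      by (simp add: fun_eq_iff)
    ultimately have "u (\<iota> q) \<in> C" by simp
    moreover have "supp (u (\<iota> q)) \<subseteq> {q..}"
      using u_supp[of "\<iota> q"] strict_mono_imp_increasing[OF \<iota>, of q] by auto
    ultimately show "\<exists>x\<in>C. supp x \<subseteq> {q..}" by blast
  qed
  \<comment> \<open>Half of the lower bound that \<open>l1\<close> gives when the coefficients sum
    to 1.\<close>
  obtain x where "x \<in> C" and x: "N x \<le> 1 / (65536 * K)"
    using small_norm_exists[of "1 / (65536 * K)"] K by auto
  then obtain n c where c: "x = (\<lambda>t. \<Sum>r<n. c r * u (\<iota> r) t)" "\<forall>r. 0 \<le> c r" "(\<Sum>r<n. c r) = 1"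
    unfolding C_def by blast
  have "1 / (32768 * K) \<le> N x" using l1[where n = n and c = c] c by simp
  then show False using x K by (simp add: field_simps)
qed

end

section \<open>The completion\<close>

lemma subspace_closure:
  fixes S :: "'a::real_normed_vector set"
  assumes "subspace S"
  shows "subspace (closure S)"
  unfolding subspace_def
proof (intro conjI ballI allI)
  show "0 \<in> closure S" using subspace_0[OF assms] closure_subset by blast
next
  fix x y assume "x \<in> closure S" "y \<in> closure S"
  then obtain f g where fg: "\<forall>n. f n \<in> S" "f \<longlonglongrightarrow> x" "\<forall>n. g n \<in> S" "g \<longlonglongrightarrow> y"
    unfolding closure_sequential by blast
  then have "\<forall>n. f n + g n \<in> S" "(\<lambda>n. f n + g n) \<longlonglongrightarrow> x + y"
    using assms by (auto intro: subspace_add tendsto_add)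
  then show "x + y \<in> closure S"
    unfolding closure_sequential by (intro exI[of _ "\<lambda>n. f n + g n"] conjI)
next
  fix c x assume "x \<in> closure S"
  then obtain f where f: "\<forall>n. f n \<in> S" "f \<longlonglongrightarrow> x"
    unfolding closure_sequential by blast
  then have "\<forall>n. c *\<^sub>R f n \<in> S" "(\<lambda>n. c *\<^sub>R f n) \<longlonglongrightarrow> c *\<^sub>R x"
    using assms by (auto intro: subspace_scale tendsto_scaleR)
  then show "c *\<^sub>R x \<in> closure S"
    unfolding closure_sequential by (intro exI[of _ "\<lambda>n. c *\<^sub>R f n"] conjI)
qed

lemma subspace_closed_span: "subspace (closed_span e I)"
  unfolding closed_span_def by (intro subspace_closure subspace_span)

section \<open>Finite linear combinations in the completion\<close>

lemma lin_comb_superset: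
  assumes "finite A" "supp x \<subseteq> A"
  shows "lin_comb b x = (\<Sum>t\<in>A. x t *\<^sub>R b t)"
  unfolding lin_comb_def using assms by (intro sum.mono_neutral_left) (auto simp: supp_def)

lemma lin_comb_lin_comb:
  assumes "finite I" "\<And>i. i \<in> I \<Longrightarrow> x i \<in> c00"
  shows "lin_comb b (\<lambda>t. \<Sum>i\<in>I. c i * x i t) = (\<Sum>i\<in>I. c i *\<^sub>R lin_comb b (x i))"
proof -
  define A where "A = (\<Union>i\<in>I. supp (x i))"
  have A: "finite A" using assms by (auto simp: A_def c00_def)
  have "supp (\<lambda>t. \<Sum>i\<in>I. c i * x i t) \<subseteq> A"
  proof
    fix t assume "t \<in> supp (\<lambda>t. \<Sum>i\<in>I. c i * x i t)"
    then have "(\<Sum>i\<in>I. c i * x i t) \<noteq> 0" by (simp add: supp_def)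
    then obtain i where "i \<in> I" "c i * x i t \<noteq> 0" by (rule sum.not_neutral_contains_not_neutral)
    then show "t \<in> A" by (auto simp: A_def supp_def)
  qed
  then have "lin_comb b (\<lambda>t. \<Sum>i\<in>I. c i * x i t) = (\<Sum>t\<in>A. \<Sum>i\<in>I. (c i * x i t) *\<^sub>R b t)"
    using A by (simp add: lin_comb_superset scaleR_sum_left)
  also have "\<dots> = (\<Sum>i\<in>I. \<Sum>t\<in>A. (c i * x i t) *\<^sub>R b t)" by (rule sum.swap)
  also have "\<dots> = (\<Sum>i\<in>I. c i *\<^sub>R lin_comb b (x i))"
  proof (rule sum.cong[OF refl])
    fix i assume "i \<in> I"
    then have "supp (x i) \<subseteq> A" by (auto simp: A_def)
    then show "(\<Sum>t\<in>A. (c i * x i t) *\<^sub>R b t) = c i *\<^sub>R lin_comb b (x i)"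
      using A by (simp add: lin_comb_superset scaleR_sum_right)
  qed
  finally show ?thesis .
qed

lemma lin_comb_diff:
  assumes "x \<in> c00" "y \<in> c00"
  shows "lin_comb b (\<lambda>t. x t - y t) = lin_comb b x - lin_comb b y"
  using lin_comb_lin_comb[of "{0, 1::nat}" "\<lambda>i. if i = 0 then x else y" b "\<lambda>i. if i = 0 then 1 else - 1"] assms
  by simp

lemma lin_comb_unit_vec: "lin_comb b (unit_vec n) = b n"
proof -
  have "supp (unit_vec n) = {n}" by (auto simp: supp_def unit_vec_def indicator_def)
  then show ?thesis by (simp add: lin_comb_def unit_vec_def)
qed

lemma closed_span_approx:
  assumes "z \<in> closed_span b I" "I \<subseteq> {1..}" "0 < \<epsilon>"
  shows "\<exists>x\<in>c00. supp x \<subseteq> I \<and> norm (z - lin_comb b x) < \<epsilon>"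
proof -
  let ?S = "lin_comb b ` {x \<in> c00. supp x \<subseteq> I}"
  have "subspace ?S"
    unfolding subspace_def
  proof (intro conjI ballI allI)
    have "lin_comb b (\<lambda>_. 0) = 0" by (simp add: lin_comb_def)
    moreover have "(\<lambda>_. 0) \<in> {x \<in> c00. supp x \<subseteq> I}" using zero_c00 by (simp add: supp_def)
    ultimately show "0 \<in> ?S" by (rule image_eqI[OF sym])
    fix y z assume "y \<in> ?S" "z \<in> ?S"
    then obtain y' z' where *: "y = lin_comb b y'" "z = lin_comb b z'" "y' \<in> c00" "z' \<in> c00"
      "supp y' \<subseteq> I" "supp z' \<subseteq> I" by blast
    have "lin_comb b (\<lambda>t. y' t + z' t) = y + z"
      using lin_comb_lin_comb[of "{0, 1::nat}" "\<lambda>i. if i = 0 then y' else z'" b "\<lambda>_. 1"] *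
      by simp
    moreover have "supp (\<lambda>t. y' t + z' t) \<subseteq> supp y' \<union> supp z'" by (auto simp: supp_def)
    then have "(\<lambda>t. y' t + z' t) \<in> {x \<in> c00. supp x \<subseteq> I}"
      using * c00_add by blast
    ultimately show "y + z \<in> ?S" by (rule image_eqI[OF sym])
  next
    fix c y assume "y \<in> ?S"
    then obtain y' where *: "y = lin_comb b y'" "y' \<in> c00" "supp y' \<subseteq> I" by blast
    have "lin_comb b (\<lambda>t. c * y' t) = c *\<^sub>R y"
      using lin_comb_lin_comb[of "{0::nat}" "\<lambda>_. y'" b "\<lambda>_. c"] * by simp
    moreover have "supp (\<lambda>t. c * y' t) \<subseteq> supp y'" by (auto simp: supp_def)
    then have "(\<lambda>t. c * y' t) \<in> {x \<in> c00. supp x \<subseteq> I}"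
      using * c00_scale by blast
    ultimately show "c *\<^sub>R y \<in> ?S" by (rule image_eqI[OF sym])
  qed
  moreover have "b ` I \<subseteq> ?S"
  proof
    fix y assume "y \<in> b ` I"
    then obtain i where i: "i \<in> I" "y = b i" by blast
    then have "unit_vec i \<in> {x \<in> c00. supp x \<subseteq> I}"
      using assms(2) unit_vec_c00(1)[of i] by (auto simp: supp_def unit_vec_def indicator_def)
    then show "y \<in> ?S" unfolding i(2) lin_comb_unit_vec[of b i, symmetric] by (rule imageI)
  qed
  ultimately have sub: "span (b ` I) \<subseteq> ?S" by (intro span_minimal)
  obtain y where "y \<in> span (b ` I)" "dist y z < \<epsilon>"
    using assms(1,3) unfolding closed_span_def closure_approachable by blast
  then obtain x where "x \<in> c00" "supp x \<subseteq> I" "dist (lin_comb b x) z < \<epsilon>" using sub by blast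
  then show ?thesis by (metis dist_commute dist_norm)
qed

text \<open>Boundedness makes the supremum genuine. At zero the quotient is 0 by division by zero
  and carries no information, hence the separate assumption there.\<close>

lemma onorm_on_bound:
  assumes "bounded_on_set Y T" "y \<in> Y" "y = 0 \<Longrightarrow> T y = 0"
  shows "norm (T y) \<le> onorm_on Y T * norm y" "0 \<le> onorm_on Y T"
proof -
  obtain C where C: "\<And>x. x \<in> Y \<Longrightarrow> norm (T x) \<le> C * norm x"
    using assms(1) by (auto simp: bounded_on_set_def)
  have "norm (T x) / norm x \<le> max C 0" if "x \<in> Y" for x
    using C[OF that] by (cases "x = 0") (auto simp: divide_le_eq le_max_iff_disj)
  then have "bdd_above ((\<lambda>x. norm (T x) / norm x) ` Y)" by (rule bdd_aboveI2)
  then have *: "norm (T y) / norm y \<le> onorm_on Y T"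
    unfolding onorm_on_def using assms(2) by (rule cSUP_upper2) simp
  then show "norm (T y) \<le> onorm_on Y T * norm y"
    using assms(3) by (cases "y = 0") (auto simp: divide_le_eq)
  show "0 \<le> onorm_on Y T" using * by (rule order_trans[rotated]) simp
qed

text \<open>Multiplying the embedding by the norm of its inverse normalizes the lower bound to 1 and
  moves the whole constant to the upper bound.\<close>

lemma embeds_with_constantE:
  assumes "embeds_with_constant C Y Z" "subspace Y" "subspace Z"
  obtains T where "linear_on_set Y T" "T ` Y \<subseteq> Z"
    "\<And>y. y \<in> Y \<Longrightarrow> norm y \<le> norm (T y)" "\<And>y. y \<in> Y \<Longrightarrow> norm (T y) \<le> C * norm y"
proof -
  obtain T where T: "linear_on_set Y T" "T ` Y \<subseteq> Z" "inj_on T Y"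
    "bounded_on_set Y T" "bounded_on_set (T ` Y) (inv_into Y T)"
    "onorm_on Y T * onorm_on (T ` Y) (inv_into Y T) \<le> C"
    using assms(1) unfolding embeds_with_constant_def by blast
  have Y0: "0 \<in> Y" using assms(2) by (rule subspace_0)
  have "T (0 *\<^sub>R 0) = 0 *\<^sub>R T 0" using T(1) Y0 unfolding linear_on_set_def by blast
  then have T0: "T 0 = 0" by simp
  define \<beta> where "\<beta> = onorm_on (T ` Y) (inv_into Y T)"
  have up: "norm (T y) \<le> onorm_on Y T * norm y" if "y \<in> Y" for y
    using onorm_on_bound(1)[OF T(4) that] T0 by blast
  have inv0: "inv_into Y T x = 0" if "x = 0" for x
    using inv_into_f_f[OF T(3) Y0] T0 that by simp
  have low: "norm y \<le> \<beta> * norm (T y)" if "y \<in> Y" for y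
    using onorm_on_bound(1)[OF T(5), of "T y"] inv0 inv_into_f_f[OF T(3) that] that
    unfolding \<beta>_def by simp
  have \<beta>: "0 \<le> \<beta>"
    unfolding \<beta>_def by (rule onorm_on_bound(2)[OF T(5), of 0]) (use Y0 T0 inv0 in force)+
  show ?thesis
  proof (rule that[of "\<lambda>y. \<beta> *\<^sub>R T y"])
    show "linear_on_set Y (\<lambda>y. \<beta> *\<^sub>R T y)"
      using T(1) unfolding linear_on_set_def by (simp add: scaleR_add_right)
    show "(\<lambda>y. \<beta> *\<^sub>R T y) ` Y \<subseteq> Z" using T(2) assms(3) by (auto intro: subspace_scale)
    fix y assume y: "y \<in> Y"
    show "norm y \<le> norm (\<beta> *\<^sub>R T y)" using low[OF y] \<beta> by simp
    have "norm (\<beta> *\<^sub>R T y) \<le> \<beta> * (onorm_on Y T * norm y)"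
      using up[OF y] \<beta> by (simp add: mult_left_mono)
    also have "\<dots> = (onorm_on Y T * \<beta>) * norm y" by simp
    also have "\<dots> \<le> C * norm y" using T(6) unfolding \<beta>_def by (rule mult_right_mono) simp
    finally show "norm (\<beta> *\<^sub>R T y) \<le> C * norm y" .
  qed
qed

lemma linear_on_set_sum:
  assumes "linear_on_set Y T" "subspace Y" "finite F" "\<And>i. i \<in> F \<Longrightarrow> y i \<in> Y"
  shows "T (\<Sum>i\<in>F. c i *\<^sub>R y i) = (\<Sum>i\<in>F. c i *\<^sub>R T (y i))"
  using assms(3,4)
proof (induction F rule: finite_induct)
  case empty
  have "T (0 *\<^sub>R 0) = 0 *\<^sub>R T 0"
    using assms(1) subspace_0[OF assms(2)] unfolding linear_on_set_def by blast
  then show ?case by simp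
next
  case (insert i F)
  have "c i *\<^sub>R y i \<in> Y" "(\<Sum>i\<in>F. c i *\<^sub>R y i) \<in> Y"
    using insert.prems assms(2) by (auto intro: subspace_scale subspace_sum)
  then have "T (c i *\<^sub>R y i + (\<Sum>i\<in>F. c i *\<^sub>R y i)) = c i *\<^sub>R T (y i) + T (\<Sum>i\<in>F. c i *\<^sub>R y i)"
    using assms(1) insert.prems unfolding linear_on_set_def by simp
  then show ?case using insert by simp
qed

section \<open>Subspaces of the completion: tails, blocks, gaps\<close>

locale completion = modified_norming_set +
  fixes e :: "nat \<Rightarrow> 'a::banach"
  assumes norm_lin_comb: "x \<in> c00 \<Longrightarrow> norm (lin_comb e x) = N x"
begin

text \<open>Coordinates of finitely supported vectors are bounded by the norm, so those of
  approximating vectors form a Cauchy sequence; its limit is the coefficient to subtract.\<close>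

lemma closed_span_remove_first:
  assumes "1 \<le> n" "z \<in> closed_span e {n..}"
  shows "\<exists>c. z - c *\<^sub>R e n \<in> closed_span e {Suc n..}"
proof -
  have "{n..} \<subseteq> {1..}" using assms(1) by auto
  then have "\<forall>k. \<exists>x. x \<in> c00 \<and> supp x \<subseteq> {n..} \<and> norm (z - lin_comb e x) < 1 / real (Suc k)"
    using closed_span_approx[OF assms(2)] by (meson of_nat_0_less_iff zero_less_Suc zero_less_divide_1_iff)
  then obtain x where x: "\<And>k. x k \<in> c00" "\<And>k. supp (x k) \<subseteq> {n..}"
    "\<And>k. norm (z - lin_comb e (x k)) < 1 / real (Suc k)" by metis
  have lim: "(\<lambda>k. lin_comb e (x k)) \<longlonglongrightarrow> z"
  proof (rule LIMSEQ_I)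
    fix r :: real assume "0 < r"
    then obtain k0 where "1 / real (Suc k0) < r" using nat_approx_posE by blast
    moreover have "1 / real (Suc k) \<le> 1 / real (Suc k0)" if "k0 \<le> k" for k
      using that by (simp add: frac_le)
    ultimately have "norm (lin_comb e (x k) - z) < r" if "k0 \<le> k" for k
      using x(3)[of k] that by (metis norm_minus_commute less_le_trans less_trans order.strict_trans1)
    then show "\<exists>k0. \<forall>k\<ge>k0. norm (lin_comb e (x k) - z) < r" by blast
  qed
  then have "Cauchy (\<lambda>k. lin_comb e (x k))" by (rule LIMSEQ_imp_Cauchy)
  have coord: "\<bar>x k n - x l n\<bar> \<le> norm (lin_comb e (x k) - lin_comb e (x l))" for k l
  proof -
    have d: "(\<lambda>t. x k t - x l t) \<in> c00"
      using c00_add[OF x(1)[of k] c00_scale[OF x(1)[of l], of "- 1"]] by simp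
    have "\<bar>x k n - x l n\<bar> \<le> N (\<lambda>t. x k t - x l t)" using abs_le_N[OF d, of n] by simp
    then show ?thesis using norm_lin_comb[OF d] by (simp only: lin_comb_diff[OF x(1) x(1)])
  qed
  have "Cauchy (\<lambda>k. x k n)"
    unfolding Cauchy_iff
  proof (intro allI impI)
    fix r :: real assume "0 < r"
    then obtain M where "\<forall>k\<ge>M. \<forall>l\<ge>M. norm (lin_comb e (x k) - lin_comb e (x l)) < r"
      using \<open>Cauchy (\<lambda>k. lin_comb e (x k))\<close> unfolding Cauchy_iff by blast
    then have "\<forall>k\<ge>M. \<forall>l\<ge>M. norm (x k n - x l n) < r"
      using coord by (metis order.strict_trans1 real_norm_def)
    then show "\<exists>M. \<forall>k\<ge>M. \<forall>l\<ge>M. norm (x k n - x l n) < r" by blast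
  qed
  then obtain c where c: "(\<lambda>k. x k n) \<longlonglongrightarrow> c"
    using real_Cauchy_convergent unfolding convergent_def by blast
  define y where "y k = lin_comb e (x k) - x k n *\<^sub>R e n" for k
  have "y k \<in> span (e ` {Suc n..})" for k
  proof -
    define A where "A = insert n (supp (x k))"
    have A: "finite A" "supp (x k) \<subseteq> A" using c00_finite_supp[OF x(1)] by (auto simp: A_def)
    have "y k = (\<Sum>t\<in>A - {n}. x k t *\<^sub>R e t)"
    proof -
      have "n \<in> A" by (simp add: A_def)
      then show ?thesis unfolding y_def lin_comb_superset[OF A] using A(1) by (simp add: sum.remove[of A n])
    qed
    also have "\<dots> \<in> span (e ` {Suc n..})"
    proof (intro span_sum span_scale span_base imageI)
      fix t assume "t \<in> A - {n}"
      then have "t \<in> {n..}" "t \<noteq> n" using x(2)[of k] by (auto simp: A_def)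
      then show "t \<in> {Suc n..}" by simp
    qed
    finally show ?thesis .
  qed
  moreover have "y \<longlonglongrightarrow> z - c *\<^sub>R e n"
    unfolding y_def by (intro tendsto_diff lim tendsto_scaleR c tendsto_const)
  ultimately have "z - c *\<^sub>R e n \<in> closed_span e {Suc n..}"
    unfolding closed_span_def closure_sequential by (intro exI[of _ y]) blast
  then show ?thesis by blast
qed

text \<open>Passing to the next tail costs at most one dimension: a vector \<open>z0\<close> with
  nonzero first coefficient corrects all others into the smaller tail.\<close>

lemma infinite_dimensional_tail:
  assumes "subspace Y" "Y \<subseteq> closed_span e {1..}" "infinite_dimensional Y"
  shows "infinite_dimensional (Y \<inter> closed_span e {Suc n..})"
proof (induction n)
  case 0
  have "Y \<inter> closed_span e {Suc 0..} = Y" using assms(2) by auto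
  then show ?case using assms(3) by simp
next
  case (Suc n)
  define Z where "Z = Y \<inter> closed_span e {Suc n..}"
  let ?S = "closed_span e {Suc (Suc n)..}"
  have Z: "subspace Z" unfolding Z_def using assms(1) subspace_closed_span by (rule subspace_inter)
  have dec: "\<exists>c. z - c *\<^sub>R e (Suc n) \<in> ?S" if "z \<in> Z" for z
    using that unfolding Z_def by (intro closed_span_remove_first) auto
  have "\<not> Y \<inter> ?S \<subseteq> span B" if B: "finite B" for B
  proof
    assume sub: "Y \<inter> ?S \<subseteq> span B"
    have "\<exists>B'. finite B' \<and> Z \<subseteq> span B'"
    proof (cases "\<exists>z0\<in>Z. \<exists>c0. c0 \<noteq> 0 \<and> z0 - c0 *\<^sub>R e (Suc n) \<in> ?S")
      case True
      then obtain z0 c0 where z0: "z0 \<in> Z" "c0 \<noteq> 0" "z0 - c0 *\<^sub>R e (Suc n) \<in> ?S" by blast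
      have "z \<in> span (insert z0 B)" if z: "z \<in> Z" for z
      proof -
        obtain c where c: "z - c *\<^sub>R e (Suc n) \<in> ?S" using dec[OF z] by blast
        let ?y = "z - (c / c0) *\<^sub>R z0"
        have "?y = (z - c *\<^sub>R e (Suc n)) - (c / c0) *\<^sub>R (z0 - c0 *\<^sub>R e (Suc n))"
          using z0(2) by (simp add: scaleR_diff_right)
        then have "?y \<in> ?S"
          using c z0(3) subspace_closed_span[of e "{Suc (Suc n)..}"]
          by (metis subspace_diff subspace_scale)
        moreover have "?y \<in> Y"
          using z z0(1) assms(1) unfolding Z_def by (auto intro: subspace_diff subspace_scale)
        ultimately have "?y \<in> span B" using sub by blast
        then have "?y \<in> span (insert z0 B)" using span_mono[of B "insert z0 B"] by blast
        moreover have "(c / c0) *\<^sub>R z0 \<in> span (insert z0 B)" by (intro span_scale span_base) simp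
        ultimately have "?y + (c / c0) *\<^sub>R z0 \<in> span (insert z0 B)" by (rule span_add)
        then show ?thesis by simp
      qed
      then show ?thesis using B by (intro exI[of _ "insert z0 B"]) auto
    next
      case False
      have "z \<in> ?S" if z: "z \<in> Z" for z
      proof -
        obtain c where c: "z - c *\<^sub>R e (Suc n) \<in> ?S" using dec[OF z] by blast
        then have "c = 0" using False z by blast
        then show ?thesis using c by simp
      qed
      then have "Z \<subseteq> span B" using sub unfolding Z_def by blast
      then show ?thesis using B by blast
    qed
    then show False using Suc.IH unfolding infinite_dimensional_def Z_def by blast
  qed
  then show ?case unfolding infinite_dimensional_def by blast
qed

text \<open>Gliding hump: an infinite dimensional subspace has a unit vector in every tail. The
  errors need not decay, since they will be measured against the sum of the absolute coefficients in
  an l1 estimate.\<close>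

lemma block_approximation:
  assumes "subspace Y" "Y \<subseteq> closed_span e {1..}" "infinite_dimensional Y" "0 < \<eta>"
  shows "\<exists>y u. (\<forall>i. y i \<in> Y \<and> norm (y i) = 1 \<and> u i \<in> c00 \<and> supp (u i) \<subseteq> {i..} \<and>
      norm (y i - lin_comb e (u i)) < \<eta>) \<and> disjoint_family (\<lambda>i::nat. supp (u i))"
proof -
  have "\<exists>y x. y \<in> Y \<and> norm y = 1 \<and> x \<in> c00 \<and> supp x \<subseteq> {Suc n..} \<and> norm (y - lin_comb e x) < \<eta>" for n
  proof -
    let ?Z = "Y \<inter> closed_span e {Suc n..}"
    have "subspace ?Z" using assms(1) subspace_closed_span by (rule subspace_inter)
    have "\<not> ?Z \<subseteq> span {}"
      using infinite_dimensional_tail[OF assms(1-3), of n] unfolding infinite_dimensional_def by blast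
    then obtain z where z: "z \<in> ?Z" "z \<noteq> 0" by auto
    define y where "y = (1 / norm z) *\<^sub>R z"
    have y: "y \<in> ?Z" "norm y = 1"
      using z subspace_scale[OF \<open>subspace ?Z\<close>] by (auto simp: y_def simp del: Int_iff)
    then obtain x where "x \<in> c00" "supp x \<subseteq> {Suc n..}" "norm (y - lin_comb e x) < \<eta>"
      using closed_span_approx[of y e "{Suc n..}" \<eta>] assms(4) by fastforce
    then show ?thesis using y by blast
  qed
  then obtain Yf Uf where f: "\<And>n. Yf n \<in> Y" "\<And>n. norm (Yf n) = 1" "\<And>n. Uf n \<in> c00"
    "\<And>n. supp (Uf n) \<subseteq> {Suc n..}" "\<And>n. norm (Yf n - lin_comb e (Uf n)) < \<eta>"
    by metis
  \<comment> \<open>The next vector starts at \<open>Suc (q i)\<close>, after the previous support;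
    growth of \<open>q\<close> also gives \<open>i \<le> q i\<close>, hence supports in
    \<open>{i..}\<close>.\<close>
  define q where "q = rec_nat 0 (\<lambda>_ q. Max (insert (Suc q) (supp (Uf q))))"
  have qS: "q (Suc i) = Max (insert (Suc (q i)) (supp (Uf (q i))))" for i by (simp add: q_def)
  have q_ge: "t \<le> q (Suc i)" if "t \<in> insert (Suc (q i)) (supp (Uf (q i)))" for t i
    unfolding qS by (rule Max_ge) (use that c00_finite_supp[OF f(3)] in auto)
  have "q i < q (Suc i)" for i using q_ge[of "Suc (q i)" i] by simp
  then have sm: "strict_mono q" by (simp add: strict_mono_Suc_iff)
  have "supp (Uf (q i)) \<subseteq> {i..}" for i
    using f(4)[of "q i"] strict_mono_imp_increasing[OF sm, of i] by fastforce
  moreover have "disjoint_family (\<lambda>i. supp (Uf (q i)))"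
  proof -
    have lt: "supp (Uf (q i)) \<inter> supp (Uf (q i')) = {}" if "i < i'" for i i'
    proof (rule ccontr)
      assume "supp (Uf (q i)) \<inter> supp (Uf (q i')) \<noteq> {}"
      then obtain t where t: "t \<in> supp (Uf (q i))" "t \<in> supp (Uf (q i'))" by blast
      have "t \<le> q (Suc i)" using t(1) by (intro q_ge) simp
      also have "\<dots> \<le> q i'" using that by (intro monoD[OF strict_mono_mono[OF sm]]) simp
      also have "\<dots> < t" using t(2) f(4)[of "q i'"] by auto
      finally show False by simp
    qed
    then show ?thesis unfolding disjoint_family_on_def by (metis Int_commute nat_neq_iff)
  qed
  ultimately show ?thesis using f
    by (intro exI[of _ "\<lambda>i. Yf (q i)"] exI[of _ "\<lambda>i. Uf (q i)"] conjI allI) simp_all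
qed

text \<open>The left end of the gap is arbitrary, which later allows successive gaps. If every right
  end failed, the approximated images would satisfy the impossible assumptions of
  \<open>tail_copies\<close>.\<close>

lemma no_embedding:
  assumes Y: "subspace Y" "Y \<subseteq> closed_span e {1..}" "infinite_dimensional Y"
    and K: "1 \<le> K" and a: "1 \<le> a"
  shows "\<exists>b\<ge>a. \<not> embeds_with_constant K Y (closed_span e ({1..} - {a..b}))"
proof (rule ccontr)
  assume "\<not> ?thesis"
  then have emb: "embeds_with_constant K Y (closed_span e ({1..} - {a..b}))" if "a \<le> b" for b
    using that by blast
  \<comment> \<open>The upper estimate loses \<open>K + 1\<close> times \<eta> per coefficient and
    the lower one twice \<eta>; both are at most 1/32768 because \<open>K\<close> is at least
    1.\<close>
  define \<eta> where "\<eta> = 1 / (65536 * K)"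
  have \<eta>: "0 < \<eta>" "(K + 1) * \<eta> \<le> 1 / 32768" "2 * \<eta> \<le> 1 / 32768"
    using K by (simp_all add: \<eta>_def field_simps)
  obtain y u where yu: "\<And>i. y i \<in> Y" "\<And>i. norm (y i) = 1" "\<And>i. u i \<in> c00" "\<And>i. supp (u i) \<subseteq> {i..}"
    "\<And>i. norm (y i - lin_comb e (u i)) < \<eta>" and disj: "disjoint_family (\<lambda>i. supp (u i))"
    using block_approximation[OF Y \<eta>(1)] by blast
  have "\<forall>b. \<exists>T v. a \<le> b \<longrightarrow> linear_on_set Y T \<and> (\<forall>y\<in>Y. norm y \<le> norm (T y) \<and> norm (T y) \<le> K * norm y) \<and>
    (\<forall>i. v i \<in> c00 \<and> supp (v i) \<subseteq> {1..} - {a..b} \<and> norm (T (y i) - lin_comb e (v i)) < \<eta>)"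
  proof
    fix b
    show "\<exists>T v. a \<le> b \<longrightarrow> linear_on_set Y T \<and> (\<forall>y\<in>Y. norm y \<le> norm (T y) \<and> norm (T y) \<le> K * norm y) \<and>
      (\<forall>i. v i \<in> c00 \<and> supp (v i) \<subseteq> {1..} - {a..b} \<and> norm (T (y i) - lin_comb e (v i)) < \<eta>)"
    proof (cases "a \<le> b")
      case True
      obtain T where T: "linear_on_set Y T" "T ` Y \<subseteq> closed_span e ({1..} - {a..b})"
        "\<And>y. y \<in> Y \<Longrightarrow> norm y \<le> norm (T y)" "\<And>y. y \<in> Y \<Longrightarrow> norm (T y) \<le> K * norm y"
        using embeds_with_constantE[OF emb[OF True] Y(1) subspace_closed_span] by blast
      have "T (y i) \<in> closed_span e ({1..} - {a..b})" for i using T(2) yu(1) by blast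
      then have "\<forall>i. \<exists>x. x \<in> c00 \<and> supp x \<subseteq> {1..} - {a..b} \<and> norm (T (y i) - lin_comb e x) < \<eta>"
        using closed_span_approx[OF _ _ \<eta>(1), of _ e "{1..} - {a..b}"] by blast
      then obtain v where "\<forall>i. v i \<in> c00 \<and> supp (v i) \<subseteq> {1..} - {a..b} \<and> norm (T (y i) - lin_comb e (v i)) < \<eta>"
        unfolding choice_iff by blast
      then show ?thesis using T(1,3,4) by (intro exI[of _ T] exI[of _ v]) blast
    qed blast
  qed
  then obtain T v where Tv: "\<forall>b. a \<le> b \<longrightarrow> linear_on_set Y (T b) \<and>
    (\<forall>y\<in>Y. norm y \<le> norm (T b y) \<and> norm (T b y) \<le> K * norm y) \<and>
    (\<forall>i. v b i \<in> c00 \<and> supp (v b i) \<subseteq> {1..} - {a..b} \<and> norm (T b (y i) - lin_comb e (v b i)) < \<eta>)"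
    unfolding choice_iff by (elim exE) (rule that)
  have perturb: "norm ((\<Sum>i\<in>F. c i *\<^sub>R x i) - (\<Sum>i\<in>F. c i *\<^sub>R z i)) \<le> \<eta> * (\<Sum>i\<in>F. \<bar>c i\<bar>)"
    if "\<And>i. norm (x i - z i) < \<eta>" for F :: "nat set" and c and x z :: "nat \<Rightarrow> 'a"
  proof -
    have "(\<Sum>i\<in>F. c i *\<^sub>R x i) - (\<Sum>i\<in>F. c i *\<^sub>R z i) = (\<Sum>i\<in>F. c i *\<^sub>R (x i - z i))"
      by (simp add: sum_subtractf scaleR_diff_right)
    also have "norm \<dots> \<le> (\<Sum>i\<in>F. norm (c i *\<^sub>R (x i - z i)))" by (rule norm_sum)
    also have "\<dots> \<le> (\<Sum>i\<in>F. \<eta> * \<bar>c i\<bar>)"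
    proof (rule sum_mono)
      fix i
      show "norm (c i *\<^sub>R (x i - z i)) \<le> \<eta> * \<bar>c i\<bar>"
        using mult_left_mono[OF less_imp_le[OF that[of i]], of "\<bar>c i\<bar>"] by (simp add: mult.commute)
    qed
    finally show ?thesis by (simp add: sum_distrib_left)
  qed
  have u_comb: "norm (\<Sum>i\<in>F. c i *\<^sub>R lin_comb e (u i)) = N (\<lambda>t. \<Sum>i\<in>F. c i * u i t)" if "finite F" for F c
    using that yu(3) by (simp add: lin_comb_lin_comb[symmetric] norm_lin_comb c00_lin_comb)
  have Tsum: "T b (\<Sum>i\<in>F. c i *\<^sub>R y i) = (\<Sum>i\<in>F. c i *\<^sub>R T b (y i))" "(\<Sum>i\<in>F. c i *\<^sub>R y i) \<in> Y"
    if "a \<le> b" "finite F" for b F c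
    using that Tv yu(1) Y(1) by (auto intro!: linear_on_set_sum subspace_sum subspace_scale)
  interpret tail_copies W u v K a
  proof unfold_locales
    show "1 \<le> K" "u i \<in> c00" "supp (u i) \<subseteq> {i..}" "disjoint_family (\<lambda>i. supp (u i))" for i
      using K yu(3,4) disj by auto
    have "\<bar>norm (lin_comb e (u i)) - 1\<bar> < \<eta>" for i
      using yu(2,5)[of i] norm_triangle_ineq3[of "y i" "lin_comb e (u i)"] by linarith
    moreover have "\<eta> \<le> 1 / 2" using \<eta>(3) by simp
    ultimately have "\<bar>N (u i) - 1\<bar> < 1 / 2" for i
      using norm_lin_comb[OF yu(3)] by (metis less_le_trans)
    then show "1 / 2 \<le> N (u i)" "N (u i) \<le> 2" for i
      by (smt (verit, best) field_sum_of_halves)+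
    fix b assume b: "a \<le> b"
    note Tb = Tv[rule_format, OF b]
    show v0: "v b i \<in> c00" "supp (v b i) \<inter> {a..b} = {}" for i using Tb by auto
    have v_comb: "norm (\<Sum>i\<in>F. c i *\<^sub>R lin_comb e (v b i)) = N (\<lambda>t. \<Sum>i\<in>F. c i * v b i t)" if "finite F" for F c
      using that v0 by (simp add: lin_comb_lin_comb[symmetric] norm_lin_comb c00_lin_comb)
    fix F :: "nat set" and c :: "nat \<Rightarrow> real" assume F: "finite F"
    let ?y = "\<Sum>i\<in>F. c i *\<^sub>R y i" and ?u = "\<Sum>i\<in>F. c i *\<^sub>R lin_comb e (u i)"
      and ?Ty = "\<Sum>i\<in>F. c i *\<^sub>R T b (y i)" and ?v = "\<Sum>i\<in>F. c i *\<^sub>R lin_comb e (v b i)"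
    let ?s = "\<Sum>i\<in>F. \<bar>c i\<bar>"
    have s0: "0 \<le> ?s" by (simp add: sum_nonneg)
    have yu': "norm (?y - ?u) \<le> \<eta> * ?s" by (rule perturb) (rule yu)
    have Tv': "norm (?Ty - ?v) \<le> \<eta> * ?s" by (rule perturb) (use Tb in blast)
    have T': "norm ?y \<le> norm ?Ty" "norm ?Ty \<le> K * norm ?y"
      using Tb Tsum[OF b F, of c] by metis+
    have "norm ?v \<le> norm ?Ty + \<eta> * ?s" using Tv' norm_triangle_ineq3[of ?Ty ?v] by linarith
    moreover have "norm ?y \<le> norm ?u + \<eta> * ?s" using yu' norm_triangle_ineq3[of ?y ?u] by linarith
    then have "K * norm ?y \<le> K * (norm ?u + \<eta> * ?s)" using K by (intro mult_left_mono) auto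
    ultimately have "norm ?v \<le> K * norm ?u + ((K + 1) * \<eta>) * ?s"
      using T'(2) by (simp add: algebra_simps)
    also have "\<dots> \<le> K * norm ?u + 1 / 32768 * ?s"
      using mult_right_mono[OF \<eta>(2) s0] by simp
    finally show "N (\<lambda>t. \<Sum>i\<in>F. c i * v b i t) \<le> K * N (\<lambda>t. \<Sum>i\<in>F. c i * u i t) + ?s / 32768"
      unfolding v_comb[OF F] u_comb[OF F] by simp
    have "norm ?u \<le> norm ?y + \<eta> * ?s" using yu' norm_triangle_ineq3[of ?y ?u] by linarith
    moreover have "norm ?Ty \<le> norm ?v + \<eta> * ?s" using Tv' norm_triangle_ineq3[of ?Ty ?v] by linarith
    ultimately have "norm ?u \<le> norm ?v + (2 * \<eta>) * ?s" using T'(1) by simp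
    also have "\<dots> \<le> norm ?v + 1 / 32768 * ?s"
      using mult_right_mono[OF \<eta>(3) s0] by simp
    finally show "N (\<lambda>t. \<Sum>i\<in>F. c i * u i t) \<le> N (\<lambda>t. \<Sum>i\<in>F. c i * v b i t) + ?s / 32768"
      unfolding v_comb[OF F] u_comb[OF F] by simp
  qed
  show False by (rule contradiction)
qed

text \<open>Each gap is started just after the previous one and made long enough for the constant
  equal to its number.\<close>

lemma tight: "tight_with_constants e"
  unfolding tight_with_constants_def
proof (intro allI impI, elim conjE)
  fix Y assume Y: "subspace Y" "closed Y" "Y \<subseteq> closed_span e {1..}" "infinite_dimensional Y"
  have "\<forall>k a. \<exists>b. 1 \<le> a \<longrightarrow> a \<le> b \<and>
      (1 \<le> k \<longrightarrow> \<not> embeds_with_constant (real k) Y (closed_span e ({1..} - {a..b})))"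
    using no_embedding[OF Y(1,3,4)] by (metis le_refl of_nat_1 of_nat_mono)
  then obtain B where B: "\<forall>k a. 1 \<le> a \<longrightarrow> a \<le> B k a \<and>
      (1 \<le> k \<longrightarrow> \<not> embeds_with_constant (real k) Y (closed_span e ({1..} - {a..B k a})))"
    unfolding choice_iff by blast
  \<comment> \<open>The recursion starts at number 0 with left end 1. The gap with number 0 has no
    embedding to exclude and merely shifts the others to the right.\<close>
  define s where "s = rec_nat 1 (\<lambda>k a. Suc (B k a))"
  have sS: "s (Suc k) = Suc (B k (s k))" for k by (simp add: s_def)
  have s1: "1 \<le> s k" for k by (cases k) (simp_all add: sS, simp add: s_def)
  have sB: "s k \<le> B k (s k)" for k using B s1 by blast
  have mono: "s k \<le> s k'" if "k \<le> k'" for k k'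
    by (rule lift_Suc_mono_le[OF _ that]) (simp add: sS sB le_SucI)
  show "\<exists>I. (\<forall>k\<ge>1. interval (I k)) \<and> successive {1..} I \<and>
         (\<forall>K\<ge>1. \<not> embeds_with_constant (real K) Y (closed_span e ({1..} - I K)))"
  proof (intro exI[of _ "\<lambda>k. {s k..B k (s k)}"] conjI allI impI)
    show "interval {s k..B k (s k)}" for k
      unfolding interval_def using s1 sB by blast
    show "successive {1..} (\<lambda>k. {s k..B k (s k)})"
      unfolding successive_def set_less_def
    proof (intro ballI impI)
      fix k k' a b assume "k < k'" "a \<in> {s k..B k (s k)}" "b \<in> {s k'..B k' (s k')}"
      then show "a < b" using mono[of "Suc k" k'] sS[of k] by auto
    qed
    show "\<not> embeds_with_constant (real k) Y (closed_span e ({1..} - {s k..B k (s k)}))" if "1 \<le> k" for k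
      using B s1 that by blast
  qed
qed

end

theorem theorem3p2:
  fixes l :: "nat \<Rightarrow> real \<Rightarrow> nat"
    and L\<^sub>1 L\<^sub>2 :: "nat set"
    and \<sigma> :: "nat set list \<Rightarrow> nat"
    and e :: "nat \<Rightarrow> 'a::banach"
  assumes "l_function l"
    and "L\<^sub>1 \<union> L\<^sub>2 = {1..}" "L\<^sub>1 \<inter> L\<^sub>2 = {}" "infinite L\<^sub>1" "infinite L\<^sub>2"
    and "coding_function l L\<^sub>2 \<sigma>"
    and "realises_completion (norming_set L\<^sub>1 (rho l) \<sigma>) e"
  shows "tight_with_constants e"
proof -
  interpret modified_norming_set "norming_set L\<^sub>1 (rho l) \<sigma>"
    using assms(4) by (rule modified_norming_set_norming_set)
  interpret completion "norming_set L\<^sub>1 (rho l) \<sigma>" e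
    using assms(7) by unfold_locales (simp add: realises_completion_def)
  show ?thesis by (rule tight)
qed

end
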